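(* Let $\mathcal{T}$ be a triangulated category and $\mathcal{X}$ a contravariantly finite rigid subcategory of $\mathcal{T}$. Let $\mathcal{R}$ be the class of regular maps in $\mathcal{T}/\mathcal{X}^{\bot}$. Then the class $\mathcal{R}$ admits a calculus of left and right fractions, the localization category $(\mathcal{T}/\mathcal{X}^{\bot})[\mathcal{R}^{-1}]$ exists, the canonical functor $\mathsf{P}:\mathcal{T}/\mathcal{X}^{\bot}\to(\mathcal{T}/\mathcal{X}^{\bot})[\mathcal{R}^{-1}]$ is faithful, preserves kernels and cokernels, and admits a fully faithful left adjoint, and there is an equivalence $(\mathcal{T}/\mathcal{X}^{\bot})[\mathcal{R}^{-1}]\simeq\mathrm{mod}\text{-}\mathcal{X}$.
   Context: $\mathcal{T}$ is a triangulated category with split idempotents and shift $[1]$. Subcategories are full, additive, and closed under isomorphisms and direct summands. $\mathcal{X}\subseteq\mathcal{T}$ is contravariantly finite if every $A\in\mathcal{T}$ admits a map $X_A\to A$ with $X_A\in\mathcal{X}$ such that $\mathcal{T}(X,X_A)\to\mathcal{T}(X,A)$ is surjective for all $X\in\mathcal{X}$. $\mathcal{X}$ is rigid if $\mathcal{T}(\mathcal{X},\mathcal{X}[1])=0$. $\mathcal{X}^{\bot}=\{A\in\mathcal{T}\mid\mathcal{T}(\mathcal{X},A)=0\}$. The factor category $\mathcal{T}/\mathcal{X}^{\bot}$ has the objects of $\mathcal{T}$ and morphisms those of $\mathcal{T}$ modulo maps factoring through an object of $\mathcal{X}^{\bot}$. A map is regular if it is both a monomorphism and an epimorphism. Localization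 is in the sense of Gabriel-Zisman. $\mathrm{mod}\text{-}\mathcal{X}$ is the category of coherent functors $F:\mathcal{X}^{\mathrm{op}}\to\mathrm{Ab}$, i.e. those admitting an exact sequence $\mathcal{X}(-,X^1)\to\mathcal{X}(-,X^0)\to F\to0$ with $X^0,X^1\in\mathcal{X}$. *)

theory Defs
  imports "HOL-Algebra.Coset" "HOL-Library.FuncSet"
begin

section \<open>Categories\<close>

text \<open>
  Objects may form a proper part of a type. Hom-sets are indexed by source and target and
  need not be disjoint; identities, composition and actions of functors on morphisms are
  indexed accordingly. So the type of objects may be arbitrarily larger than the
  type of morphisms, which plays the role of the universe of small sets.
  For \<open>f : A \<rightarrow> B\<close> and \<open>g : B \<rightarrow> D\<close>, the composite \<open>g \<circ> f\<close> is \<open>Cmp C A B D g f\<close>.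
\<close>

record ('o, 'm) cat =
  Obj :: "'o set"
  Hom :: "'o \<Rightarrow> 'o \<Rightarrow> 'm set"
  Idn :: "'o \<Rightarrow> 'm"
  Cmp :: "'o \<Rightarrow> 'o \<Rightarrow> 'o \<Rightarrow> 'm \<Rightarrow> 'm \<Rightarrow> 'm"

locale category =
  fixes C :: "('o, 'm, 'x) cat_scheme"
  assumes Idn_in_Hom: "A \<in> Obj C \<Longrightarrow> Idn C A \<in> Hom C A A"
    and Cmp_in_Hom:
      "\<lbrakk>A \<in> Obj C; B \<in> Obj C; D \<in> Obj C; f \<in> Hom C A B; g \<in> Hom C B D\<rbrakk>
        \<Longrightarrow> Cmp C A B D g f \<in> Hom C A D"
    and Cmp_Idn_right: "\<lbrakk>A \<in> Obj C; B \<in> Obj C; f \<in> Hom C A B\<rbrakk> \<Longrightarrow> Cmp C A A B f (Idn C A) = f"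
    and Cmp_Idn_left: "\<lbrakk>A \<in> Obj C; B \<in> Obj C; f \<in> Hom C A B\<rbrakk> \<Longrightarrow> Cmp C A B B (Idn C B) f = f"
    and Cmp_assoc:
      "\<lbrakk>A \<in> Obj C; B \<in> Obj C; D \<in> Obj C; E \<in> Obj C;
        f \<in> Hom C A B; g \<in> Hom C B D; h \<in> Hom C D E\<rbrakk>
        \<Longrightarrow> Cmp C A B E (Cmp C B D E h g) f = Cmp C A D E h (Cmp C A B D g f)"

definition op_cat :: "('o, 'm, 'x) cat_scheme \<Rightarrow> ('o, 'm) cat" where
  "op_cat C = \<lparr>Obj = Obj C, Hom = (\<lambda>A B. Hom C B A), Idn = Idn C,
                Cmp = (\<lambda>A B D g f. Cmp C D B A f g)\<rparr>"

definition full_subcat :: "('o, 'm, 'x) cat_scheme \<Rightarrow> 'o set \<Rightarrow> ('o, 'm) cat" where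
  "full_subcat C S = \<lparr>Obj = S, Hom = Hom C, Idn = Idn C, Cmp = Cmp C\<rparr>"

definition iso_mor :: "('o, 'm, 'x) cat_scheme \<Rightarrow> 'o \<Rightarrow> 'o \<Rightarrow> 'm \<Rightarrow> bool" where
  "iso_mor C A B f \<longleftrightarrow> f \<in> Hom C A B \<and>
     (\<exists>g\<in>Hom C B A. Cmp C A B A g f = Idn C A \<and> Cmp C B A B f g = Idn C B)"

definition mono_mor :: "('o, 'm, 'x) cat_scheme \<Rightarrow> 'o \<Rightarrow> 'o \<Rightarrow> 'm \<Rightarrow> bool" where
  "mono_mor C A B f \<longleftrightarrow> f \<in> Hom C A B \<and>
     (\<forall>W\<in>Obj C. \<forall>u\<in>Hom C W A. \<forall>v\<in>Hom C W A.
        Cmp C W A B f u = Cmp C W A B f v \<longrightarrow> u = v)"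

definition epi_mor :: "('o, 'm, 'x) cat_scheme \<Rightarrow> 'o \<Rightarrow> 'o \<Rightarrow> 'm \<Rightarrow> bool" where
  "epi_mor C A B f \<longleftrightarrow> f \<in> Hom C A B \<and>
     (\<forall>W\<in>Obj C. \<forall>u\<in>Hom C B W. \<forall>v\<in>Hom C B W.
        Cmp C A B W u f = Cmp C A B W v f \<longrightarrow> u = v)"

text \<open>Classes of morphisms are given as families of subsets of the hom-sets.\<close>

definition regular_maps :: "('o, 'm, 'x) cat_scheme \<Rightarrow> 'o \<Rightarrow> 'o \<Rightarrow> 'm set" where
  "regular_maps C A B = {f \<in> Hom C A B. mono_mor C A B f \<and> epi_mor C A B f}"

definition zero_object :: "('o, 'm, 'x) cat_scheme \<Rightarrow> 'o \<Rightarrow> bool" where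
  "zero_object C Z \<longleftrightarrow> Z \<in> Obj C \<and>
     (\<forall>A\<in>Obj C. (\<exists>!f. f \<in> Hom C A Z) \<and> (\<exists>!f. f \<in> Hom C Z A))"

definition zero_mor :: "('o, 'm, 'x) cat_scheme \<Rightarrow> 'o \<Rightarrow> 'o \<Rightarrow> 'm \<Rightarrow> bool" where
  "zero_mor C A B f \<longleftrightarrow>
     (\<exists>Z. zero_object C Z \<and> (\<exists>g\<in>Hom C A Z. \<exists>h\<in>Hom C Z B. f = Cmp C A Z B h g))"

definition is_kernel :: "('o, 'm, 'x) cat_scheme \<Rightarrow> 'o \<Rightarrow> 'o \<Rightarrow> 'm \<Rightarrow> 'o \<Rightarrow> 'm \<Rightarrow> bool" where
  "is_kernel C A B f K k \<longleftrightarrow>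
     A \<in> Obj C \<and> B \<in> Obj C \<and> f \<in> Hom C A B \<and> K \<in> Obj C \<and> k \<in> Hom C K A \<and>
     zero_mor C K B (Cmp C K A B f k) \<and>
     (\<forall>W\<in>Obj C. \<forall>w\<in>Hom C W A. zero_mor C W B (Cmp C W A B f w) \<longrightarrow>
        (\<exists>!u. u \<in> Hom C W K \<and> Cmp C W K A k u = w))"

text \<open>\<open>is_cokernel C A B f Q q\<close>: the morphism \<open>q : B \<rightarrow> Q\<close> is a cokernel of \<open>f : A \<rightarrow> B\<close>.\<close>

definition is_cokernel :: "('o, 'm, 'x) cat_scheme \<Rightarrow> 'o \<Rightarrow> 'o \<Rightarrow> 'm \<Rightarrow> 'o \<Rightarrow> 'm \<Rightarrow> bool" where
  "is_cokernel C A B f Q q \<longleftrightarrow> is_kernel (op_cat C) B A f Q q"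


section \<open>Functors\<close>

record ('o, 'm, 'p, 'n) cfun =
  Fo :: "'o \<Rightarrow> 'p"
  Fm :: "'o \<Rightarrow> 'o \<Rightarrow> 'm \<Rightarrow> 'n"

definition is_functor ::
  "('o, 'm, 'x) cat_scheme \<Rightarrow> ('p, 'n, 'y) cat_scheme \<Rightarrow> ('o, 'm, 'p, 'n) cfun \<Rightarrow> bool" where
  "is_functor C D F \<longleftrightarrow>
     (\<forall>A\<in>Obj C. Fo F A \<in> Obj D) \<and>
     (\<forall>A\<in>Obj C. \<forall>B\<in>Obj C. \<forall>f\<in>Hom C A B. Fm F A B f \<in> Hom D (Fo F A) (Fo F B)) \<and>
     (\<forall>A\<in>Obj C. Fm F A A (Idn C A) = Idn D (Fo F A)) \<and>
     (\<forall>A\<in>Obj C. \<forall>B\<in>Obj C. \<forall>E\<in>Obj C. \<forall>f\<in>Hom C A B. \<forall>g\<in>Hom C B E.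
        Fm F A E (Cmp C A B E g f) = Cmp D (Fo F A) (Fo F B) (Fo F E) (Fm F B E g) (Fm F A B f))"

definition id_cfun :: "('o, 'm, 'o, 'm) cfun" where
  "id_cfun = \<lparr>Fo = (\<lambda>A. A), Fm = (\<lambda>A B f. f)\<rparr>"

definition comp_cfun ::
  "('p, 'n, 'q, 'k) cfun \<Rightarrow> ('o, 'm, 'p, 'n) cfun \<Rightarrow> ('o, 'm, 'q, 'k) cfun" where
  "comp_cfun G F = \<lparr>Fo = (\<lambda>A. Fo G (Fo F A)),
                    Fm = (\<lambda>A B f. Fm G (Fo F A) (Fo F B) (Fm F A B f))\<rparr>"

text \<open>Equality of functors with domain \<open>C\<close>, ignoring junk values outside \<open>C\<close>.\<close>

definition cfun_eq ::
  "('o, 'm, 'x) cat_scheme \<Rightarrow> ('o, 'm, 'p, 'n) cfun \<Rightarrow> ('o, 'm, 'p, 'n) cfun \<Rightarrow> bool" where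
  "cfun_eq C F G \<longleftrightarrow>
     (\<forall>A\<in>Obj C. Fo F A = Fo G A) \<and>
     (\<forall>A\<in>Obj C. \<forall>B\<in>Obj C. \<forall>f\<in>Hom C A B. Fm F A B f = Fm G A B f)"

definition faithful ::
  "('o, 'm, 'x) cat_scheme \<Rightarrow> ('p, 'n, 'y) cat_scheme \<Rightarrow> ('o, 'm, 'p, 'n) cfun \<Rightarrow> bool" where
  "faithful C D F \<longleftrightarrow> (\<forall>A\<in>Obj C. \<forall>B\<in>Obj C. inj_on (Fm F A B) (Hom C A B))"

definition fully_faithful ::
  "('o, 'm, 'x) cat_scheme \<Rightarrow> ('p, 'n, 'y) cat_scheme \<Rightarrow> ('o, 'm, 'p, 'n) cfun \<Rightarrow> bool" where
  "fully_faithful C D F \<longleftrightarrow>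
     (\<forall>A\<in>Obj C. \<forall>B\<in>Obj C. bij_betw (Fm F A B) (Hom C A B) (Hom D (Fo F A) (Fo F B)))"

definition nat_trans ::
  "('o, 'm, 'x) cat_scheme \<Rightarrow> ('p, 'n, 'y) cat_scheme \<Rightarrow> ('o, 'm, 'p, 'n) cfun \<Rightarrow>
   ('o, 'm, 'p, 'n) cfun \<Rightarrow> ('o \<Rightarrow> 'n) \<Rightarrow> bool" where
  "nat_trans C D F G \<alpha> \<longleftrightarrow>
     (\<forall>A\<in>Obj C. \<alpha> A \<in> Hom D (Fo F A) (Fo G A)) \<and>
     (\<forall>A\<in>Obj C. \<forall>B\<in>Obj C. \<forall>f\<in>Hom C A B.
        Cmp D (Fo F A) (Fo G A) (Fo G B) (Fm G A B f) (\<alpha> A) =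
        Cmp D (Fo F A) (Fo F B) (Fo G B) (\<alpha> B) (Fm F A B f))"

definition nat_isomorphic ::
  "('o, 'm, 'x) cat_scheme \<Rightarrow> ('p, 'n, 'y) cat_scheme \<Rightarrow> ('o, 'm, 'p, 'n) cfun \<Rightarrow>
   ('o, 'm, 'p, 'n) cfun \<Rightarrow> bool" where
  "nat_isomorphic C D F G \<longleftrightarrow>
     (\<exists>\<alpha>. nat_trans C D F G \<alpha> \<and> (\<forall>A\<in>Obj C. iso_mor D (Fo F A) (Fo G A) (\<alpha> A)))"

definition is_equivalence ::
  "('o, 'm, 'x) cat_scheme \<Rightarrow> ('p, 'n, 'y) cat_scheme \<Rightarrow> ('o, 'm, 'p, 'n) cfun \<Rightarrow> bool" where
  "is_equivalence C D F \<longleftrightarrow> is_functor C D F \<and>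
     (\<exists>G. is_functor D C G \<and>
          nat_isomorphic C C (comp_cfun G F) id_cfun \<and>
          nat_isomorphic D D (comp_cfun F G) id_cfun)"

definition equivalent_cats ::
  "('o, 'm, 'x) cat_scheme \<Rightarrow> ('p, 'n, 'y) cat_scheme \<Rightarrow> bool" where
  "equivalent_cats C D \<longleftrightarrow> (\<exists>F. is_equivalence C D F)"

text \<open>\<open>left_adjoint C D F G\<close>: the functor \<open>F : C \<rightarrow> D\<close> is left adjoint to \<open>G : D \<rightarrow> C\<close>.\<close>

definition left_adjoint ::
  "('o, 'm, 'x) cat_scheme \<Rightarrow> ('p, 'n, 'y) cat_scheme \<Rightarrow> ('o, 'm, 'p, 'n) cfun \<Rightarrow>
   ('p, 'n, 'o, 'm) cfun \<Rightarrow> bool" where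
  "left_adjoint C D F G \<longleftrightarrow> is_functor C D F \<and> is_functor D C G \<and>
     (\<exists>\<phi>.
       (\<forall>A\<in>Obj C. \<forall>B\<in>Obj D. bij_betw (\<phi> A B) (Hom D (Fo F A) B) (Hom C A (Fo G B))) \<and>
       (\<forall>A\<in>Obj C. \<forall>A'\<in>Obj C. \<forall>B\<in>Obj D. \<forall>B'\<in>Obj D.
        \<forall>a\<in>Hom C A' A. \<forall>b\<in>Hom D B B'. \<forall>h\<in>Hom D (Fo F A) B.
          \<phi> A' B' (Cmp D (Fo F A') (Fo F A) B' (Cmp D (Fo F A) B B' b h) (Fm F A' A a)) =
          Cmp C A' A (Fo G B') (Cmp C A (Fo G B) (Fo G B') (Fm G B B' b) (\<phi> A B h)) a))"

definition preserves_kernels ::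
  "('o, 'm, 'x) cat_scheme \<Rightarrow> ('p, 'n, 'y) cat_scheme \<Rightarrow> ('o, 'm, 'p, 'n) cfun \<Rightarrow> bool" where
  "preserves_kernels C D F \<longleftrightarrow>
     (\<forall>A B f K k. is_kernel C A B f K k \<longrightarrow>
        is_kernel D (Fo F A) (Fo F B) (Fm F A B f) (Fo F K) (Fm F K A k))"

definition preserves_cokernels ::
  "('o, 'm, 'x) cat_scheme \<Rightarrow> ('p, 'n, 'y) cat_scheme \<Rightarrow> ('o, 'm, 'p, 'n) cfun \<Rightarrow> bool" where
  "preserves_cokernels C D F \<longleftrightarrow>
     (\<forall>A B f Q q. is_cokernel C A B f Q q \<longrightarrow>
        is_cokernel D (Fo F A) (Fo F B) (Fm F A B f) (Fo F Q) (Fm F B Q q))"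


section \<open>Calculus of fractions and Gabriel-Zisman localization\<close>

definition left_fractions ::
  "('o, 'm, 'x) cat_scheme \<Rightarrow> ('o \<Rightarrow> 'o \<Rightarrow> 'm set) \<Rightarrow> bool" where
  "left_fractions C R \<longleftrightarrow>
     (\<forall>A\<in>Obj C. \<forall>B\<in>Obj C. R A B \<subseteq> Hom C A B) \<and>
     (\<forall>A\<in>Obj C. Idn C A \<in> R A A) \<and>
     (\<forall>A\<in>Obj C. \<forall>B\<in>Obj C. \<forall>D\<in>Obj C. \<forall>s\<in>R A B. \<forall>t\<in>R B D. Cmp C A B D t s \<in> R A D) \<and>
     (\<forall>A\<in>Obj C. \<forall>A'\<in>Obj C. \<forall>B\<in>Obj C. \<forall>s\<in>R A A'. \<forall>u\<in>Hom C A B.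
        \<exists>B'\<in>Obj C. \<exists>s'\<in>R B B'. \<exists>u'\<in>Hom C A' B'. Cmp C A A' B' u' s = Cmp C A B B' s' u) \<and>
     (\<forall>A'\<in>Obj C. \<forall>A\<in>Obj C. \<forall>B\<in>Obj C. \<forall>s\<in>R A' A. \<forall>f\<in>Hom C A B. \<forall>g\<in>Hom C A B.
        Cmp C A' A B f s = Cmp C A' A B g s \<longrightarrow>
        (\<exists>B'\<in>Obj C. \<exists>t\<in>R B B'. Cmp C A B B' t f = Cmp C A B B' t g))"

definition right_fractions ::
  "('o, 'm, 'x) cat_scheme \<Rightarrow> ('o \<Rightarrow> 'o \<Rightarrow> 'm set) \<Rightarrow> bool" where
  "right_fractions C R \<longleftrightarrow> left_fractions (op_cat C) (\<lambda>A B. R B A)"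

text \<open>
  The Gabriel-Zisman construction: paths in the quiver with an arrow \<open>Fwd A B f\<close> from \<open>A\<close> to
  \<open>B\<close> for each \<open>f : A \<rightarrow> B\<close> in \<open>C\<close> and an arrow \<open>Inv A B s\<close> from \<open>B\<close> to \<open>A\<close> for each
  \<open>s : A \<rightarrow> B\<close> in \<open>R\<close>, modulo the congruence that makes \<open>Fwd\<close> functorial and \<open>Inv A B s\<close>
  inverse to \<open>Fwd A B s\<close>. Paths are listed in order of traversal.
\<close>

datatype ('o, 'm) zarrow = Fwd 'o 'o 'm | Inv 'o 'o 'm

fun zpath ::
  "('o, 'm, 'x) cat_scheme \<Rightarrow> ('o \<Rightarrow> 'o \<Rightarrow> 'm set) \<Rightarrow> 'o \<Rightarrow> ('o, 'm) zarrow list \<Rightarrow> 'o \<Rightarrow> bool"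
where
  "zpath C R A [] B \<longleftrightarrow> A \<in> Obj C \<and> A = B"
| "zpath C R A (Fwd D E f # p) B \<longleftrightarrow>
     D = A \<and> D \<in> Obj C \<and> E \<in> Obj C \<and> f \<in> Hom C D E \<and> zpath C R E p B"
| "zpath C R A (Inv D E s # p) B \<longleftrightarrow>
     E = A \<and> D \<in> Obj C \<and> E \<in> Obj C \<and> s \<in> R D E \<and> zpath C R D p B"

inductive zeq ::
  "('o, 'm, 'x) cat_scheme \<Rightarrow> ('o \<Rightarrow> 'o \<Rightarrow> 'm set) \<Rightarrow>
   'o \<Rightarrow> 'o \<Rightarrow> ('o, 'm) zarrow list \<Rightarrow> ('o, 'm) zarrow list \<Rightarrow> bool"
  for C :: "('o, 'm, 'x) cat_scheme" and R :: "'o \<Rightarrow> 'o \<Rightarrow> 'm set"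
where
  zeq_refl: "zpath C R A p B \<Longrightarrow> zeq C R A B p p"
| zeq_sym: "zeq C R A B p q \<Longrightarrow> zeq C R A B q p"
| zeq_trans: "\<lbrakk>zeq C R A B p q; zeq C R A B q r\<rbrakk> \<Longrightarrow> zeq C R A B p r"
| zeq_append:
    "\<lbrakk>zeq C R A B p p'; zeq C R B D q q'\<rbrakk> \<Longrightarrow> zeq C R A D (p @ q) (p' @ q')"
| zeq_Idn: "A \<in> Obj C \<Longrightarrow> zeq C R A A [Fwd A A (Idn C A)] []"
| zeq_Cmp:
    "\<lbrakk>A \<in> Obj C; B \<in> Obj C; D \<in> Obj C; f \<in> Hom C A B; g \<in> Hom C B D\<rbrakk>
      \<Longrightarrow> zeq C R A D [Fwd A B f, Fwd B D g] [Fwd A D (Cmp C A B D g f)]"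
| zeq_Fwd_Inv:
    "\<lbrakk>A \<in> Obj C; B \<in> Obj C; s \<in> Hom C A B; s \<in> R A B\<rbrakk>
      \<Longrightarrow> zeq C R A A [Fwd A B s, Inv A B s] []"
| zeq_Inv_Fwd:
    "\<lbrakk>A \<in> Obj C; B \<in> Obj C; s \<in> Hom C A B; s \<in> R A B\<rbrakk>
      \<Longrightarrow> zeq C R B B [Inv A B s, Fwd A B s] []"

definition zclass ::
  "('o, 'm, 'x) cat_scheme \<Rightarrow> ('o \<Rightarrow> 'o \<Rightarrow> 'm set) \<Rightarrow>
   'o \<Rightarrow> 'o \<Rightarrow> ('o, 'm) zarrow list \<Rightarrow> ('o, 'm) zarrow list set" where
  "zclass C R A B p = {q. zeq C R A B p q}"

definition localization ::
  "('o, 'm, 'x) cat_scheme \<Rightarrow> ('o \<Rightarrow> 'o \<Rightarrow> 'm set) \<Rightarrow> ('o, ('o, 'm) zarrow list set) cat" where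
  "localization C R =
     \<lparr>Obj = Obj C,
      Hom = (\<lambda>A B. {zclass C R A B p | p. zpath C R A p B}),
      Idn = (\<lambda>A. zclass C R A A []),
      Cmp = (\<lambda>A B D G F. \<Union>p\<in>F. \<Union>q\<in>G. zclass C R A D (p @ q))\<rparr>"

definition localization_functor ::
  "('o, 'm, 'x) cat_scheme \<Rightarrow> ('o \<Rightarrow> 'o \<Rightarrow> 'm set) \<Rightarrow>
   ('o, 'm, 'o, ('o, 'm) zarrow list set) cfun" where
  "localization_functor C R =
     \<lparr>Fo = (\<lambda>A. A), Fm = (\<lambda>A B f. zclass C R A B [Fwd A B f])\<rparr>"

definition inverts ::
  "('o, 'm, 'x) cat_scheme \<Rightarrow> ('o \<Rightarrow> 'o \<Rightarrow> 'm set) \<Rightarrow> ('p, 'n, 'y) cat_scheme \<Rightarrow>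
   ('o, 'm, 'p, 'n) cfun \<Rightarrow> bool" where
  "inverts C R D F \<longleftrightarrow>
     (\<forall>A\<in>Obj C. \<forall>B\<in>Obj C. \<forall>s\<in>R A B. iso_mor D (Fo F A) (Fo F B) (Fm F A B s))"

text \<open>The universal property of \<open>P : C \<rightarrow> L\<close>, for functors with values in \<open>D\<close>.\<close>

definition universally_inverts ::
  "('o, 'm, 'x) cat_scheme \<Rightarrow> ('o \<Rightarrow> 'o \<Rightarrow> 'm set) \<Rightarrow> ('p, 'n, 'y) cat_scheme \<Rightarrow>
   ('o, 'm, 'p, 'n) cfun \<Rightarrow> ('q, 'k, 'z) cat_scheme \<Rightarrow> bool" where
  "universally_inverts C R L P D \<longleftrightarrow>
     (\<forall>F. is_functor C D F \<and> inverts C R D F \<longrightarrow>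
        (\<exists>G. is_functor L D G \<and> cfun_eq C (comp_cfun G P) F \<and>
             (\<forall>G'. is_functor L D G' \<and> cfun_eq C (comp_cfun G' P) F \<longrightarrow> cfun_eq L G G')))"

text \<open>
  Every hom-set is in bijection with a set of elements of the type \<open>'h\<close>. The localization above
  always satisfies the axioms of a category; the size of its hom-sets is the set-theoretic issue
  in asserting that it exists.
\<close>

definition has_small_homs :: "'h itself \<Rightarrow> ('o, 'm, 'x) cat_scheme \<Rightarrow> bool" where
  "has_small_homs _ C \<longleftrightarrow> (\<forall>A\<in>Obj C. \<forall>B\<in>Obj C. \<exists>\<iota> :: 'm \<Rightarrow> 'h. inj_on \<iota> (Hom C A B))"


section \<open>Additive categories\<close>

record ('o, 'm) addcat = "('o, 'm) cat" +
  Add :: "'o \<Rightarrow> 'o \<Rightarrow> 'm \<Rightarrow> 'm \<Rightarrow> 'm"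
  Zero :: "'o \<Rightarrow> 'o \<Rightarrow> 'm"

text \<open>Abelian groups are written multiplicatively, as instances of \<^locale>\<open>comm_group\<close>.\<close>

definition hom_group :: "('o, 'm, 'x) addcat_scheme \<Rightarrow> 'o \<Rightarrow> 'o \<Rightarrow> 'm monoid" where
  "hom_group C A B = \<lparr>carrier = Hom C A B, mult = Add C A B, one = Zero C A B\<rparr>"

definition is_biproduct ::
  "('o, 'm, 'x) addcat_scheme \<Rightarrow> 'o \<Rightarrow> 'o \<Rightarrow> 'o \<Rightarrow> 'm \<Rightarrow> 'm \<Rightarrow> 'm \<Rightarrow> 'm \<Rightarrow> bool" where
  "is_biproduct C A B S i j p q \<longleftrightarrow> S \<in> Obj C \<and>
     i \<in> Hom C A S \<and> j \<in> Hom C B S \<and> p \<in> Hom C S A \<and> q \<in> Hom C S B \<and>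
     Cmp C A S A p i = Idn C A \<and> Cmp C B S B q j = Idn C B \<and>
     Cmp C A S B q i = Zero C A B \<and> Cmp C B S A p j = Zero C B A \<and>
     Add C S S (Cmp C S A S i p) (Cmp C S B S j q) = Idn C S"

definition is_direct_sum :: "('o, 'm, 'x) addcat_scheme \<Rightarrow> 'o \<Rightarrow> 'o \<Rightarrow> 'o \<Rightarrow> bool" where
  "is_direct_sum C A B S \<longleftrightarrow> (\<exists>i j p q. is_biproduct C A B S i j p q)"

locale additive_category = category C
  for C :: "('o, 'm, 'x) addcat_scheme" +
  assumes hom_comm_group: "\<lbrakk>A \<in> Obj C; B \<in> Obj C\<rbrakk> \<Longrightarrow> comm_group (hom_group C A B)"
    and Cmp_Add_right:
      "\<lbrakk>A \<in> Obj C; B \<in> Obj C; D \<in> Obj C; f \<in> Hom C A B; f' \<in> Hom C A B; g \<in> Hom C B D\<rbrakk>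
        \<Longrightarrow> Cmp C A B D g (Add C A B f f') = Add C A D (Cmp C A B D g f) (Cmp C A B D g f')"
    and Cmp_Add_left:
      "\<lbrakk>A \<in> Obj C; B \<in> Obj C; D \<in> Obj C; f \<in> Hom C A B; g \<in> Hom C B D; g' \<in> Hom C B D\<rbrakk>
        \<Longrightarrow> Cmp C A B D (Add C B D g g') f = Add C A D (Cmp C A B D g f) (Cmp C A B D g' f)"
    and zero_object_exists: "\<exists>Z. zero_object C Z"
    and direct_sum_exists: "\<lbrakk>A \<in> Obj C; B \<in> Obj C\<rbrakk> \<Longrightarrow> \<exists>S. is_direct_sum C A B S"

definition split_idempotents :: "('o, 'm, 'x) cat_scheme \<Rightarrow> bool" where
  "split_idempotents C \<longleftrightarrow>
     (\<forall>A\<in>Obj C. \<forall>e\<in>Hom C A A. Cmp C A A A e e = e \<longrightarrow>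
        (\<exists>B\<in>Obj C. \<exists>p\<in>Hom C A B. \<exists>i\<in>Hom C B A.
           Cmp C B A B p i = Idn C B \<and> Cmp C A B A i p = e))"

definition subcategory :: "('o, 'm, 'x) addcat_scheme \<Rightarrow> 'o set \<Rightarrow> bool" where
  "subcategory C X \<longleftrightarrow> X \<subseteq> Obj C \<and>
     (\<exists>Z\<in>X. zero_object C Z) \<and>
     (\<forall>A\<in>X. \<forall>B\<in>X. \<forall>S\<in>Obj C. is_direct_sum C A B S \<longrightarrow> S \<in> X) \<and>
     (\<forall>A\<in>X. \<forall>B\<in>Obj C. (\<exists>f. iso_mor C A B f) \<longrightarrow> B \<in> X) \<and>
     (\<forall>S\<in>X. \<forall>A\<in>Obj C. \<forall>B\<in>Obj C. is_direct_sum C A B S \<longrightarrow> A \<in> X)"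

definition contravariantly_finite :: "('o, 'm, 'x) cat_scheme \<Rightarrow> 'o set \<Rightarrow> bool" where
  "contravariantly_finite C X \<longleftrightarrow>
     (\<forall>A\<in>Obj C. \<exists>XA\<in>X. \<exists>p\<in>Hom C XA A.
        \<forall>Y\<in>X. (\<lambda>f. Cmp C Y XA A p f) ` Hom C Y XA = Hom C Y A)"

definition perp :: "('o, 'm, 'x) addcat_scheme \<Rightarrow> 'o set \<Rightarrow> 'o set" where
  "perp C X = {A \<in> Obj C. \<forall>Y\<in>X. Hom C Y A = {Zero C Y A}}"

definition maps_through ::
  "('o, 'm, 'x) cat_scheme \<Rightarrow> 'o set \<Rightarrow> 'o \<Rightarrow> 'o \<Rightarrow> 'm set" where
  "maps_through C Y A B =
     {Cmp C A W B g f | W f g. W \<in> Y \<and> f \<in> Hom C A W \<and> g \<in> Hom C W B}"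

text \<open>
  Morphisms are the cosets of the subgroup of maps factoring through an object of \<open>Y\<close>. The
  composite is a union because the pointwise product of two cosets is in general only a
  part of a coset.
\<close>

definition factor_category ::
  "('o, 'm, 'x) addcat_scheme \<Rightarrow> 'o set \<Rightarrow> ('o, 'm set) cat" where
  "factor_category C Y =
     \<lparr>Obj = Obj C,
      Hom = (\<lambda>A B. carrier (hom_group C A B Mod maps_through C Y A B)),
      Idn = (\<lambda>A. maps_through C Y A A #>\<^bsub>hom_group C A A\<^esub> Idn C A),
      Cmp = (\<lambda>A B D G F. \<Union>f\<in>F. \<Union>g\<in>G.
               maps_through C Y A D #>\<^bsub>hom_group C A D\<^esub> Cmp C A B D g f)\<rparr>"


section \<open>Triangulated categories\<close>

text \<open>
  \<open>Tri T A B D f g h\<close>: the diagram \<open>A \<rightarrow> B \<rightarrow> D \<rightarrow> A[1]\<close> with maps \<open>f\<close>, \<open>g\<close>, \<open>h\<close> is a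
  distinguished triangle.
\<close>

record ('o, 'm) tricat = "('o, 'm) addcat" +
  Shift :: "('o, 'm, 'o, 'm) cfun"
  Tri :: "'o \<Rightarrow> 'o \<Rightarrow> 'o \<Rightarrow> 'm \<Rightarrow> 'm \<Rightarrow> 'm \<Rightarrow> bool"

definition triangle ::
  "('o, 'm, 'x) tricat_scheme \<Rightarrow> 'o \<Rightarrow> 'o \<Rightarrow> 'o \<Rightarrow> 'm \<Rightarrow> 'm \<Rightarrow> 'm \<Rightarrow> bool" where
  "triangle T A B D f g h \<longleftrightarrow> A \<in> Obj T \<and> B \<in> Obj T \<and> D \<in> Obj T \<and>
     f \<in> Hom T A B \<and> g \<in> Hom T B D \<and> h \<in> Hom T D (Fo (Shift T) A)"

definition triangle_morphism ::
  "('o, 'm, 'x) tricat_scheme \<Rightarrow>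
   'o \<Rightarrow> 'o \<Rightarrow> 'o \<Rightarrow> 'm \<Rightarrow> 'm \<Rightarrow> 'm \<Rightarrow> 'o \<Rightarrow> 'o \<Rightarrow> 'o \<Rightarrow> 'm \<Rightarrow> 'm \<Rightarrow> 'm \<Rightarrow>
   'm \<Rightarrow> 'm \<Rightarrow> 'm \<Rightarrow> bool" where
  "triangle_morphism T A B D f g h A' B' D' f' g' h' a b d \<longleftrightarrow>
     a \<in> Hom T A A' \<and> b \<in> Hom T B B' \<and> d \<in> Hom T D D' \<and>
     Cmp T A B B' b f = Cmp T A A' B' f' a \<and>
     Cmp T B D D' d g = Cmp T B B' D' g' b \<and>
     Cmp T D (Fo (Shift T) A) (Fo (Shift T) A') (Fm (Shift T) A A' a) h =
       Cmp T D D' (Fo (Shift T) A') h' d"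

text \<open>The shift is an additive auto-equivalence, not necessarily an automorphism.\<close>

locale triangulated_category = additive_category T
  for T :: "('o, 'm, 'x) tricat_scheme" +
  assumes Shift_equivalence: "is_equivalence T T (Shift T)"
    and Shift_Add:
      "\<lbrakk>A \<in> Obj T; B \<in> Obj T; f \<in> Hom T A B; g \<in> Hom T A B\<rbrakk>
        \<Longrightarrow> Fm (Shift T) A B (Add T A B f g) =
            Add T (Fo (Shift T) A) (Fo (Shift T) B) (Fm (Shift T) A B f) (Fm (Shift T) A B g)"
    and Tri_triangle: "Tri T A B D f g h \<Longrightarrow> triangle T A B D f g h"
    and TR1_iso:
      "\<lbrakk>Tri T A B D f g h; triangle T A' B' D' f' g' h';
        triangle_morphism T A B D f g h A' B' D' f' g' h' a b d;
        iso_mor T A A' a; iso_mor T B B' b; iso_mor T D D' d\<rbrakk>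
        \<Longrightarrow> Tri T A' B' D' f' g' h'"
    and TR1_Idn:
      "\<lbrakk>A \<in> Obj T; zero_object T Z\<rbrakk>
        \<Longrightarrow> Tri T A A Z (Idn T A) (Zero T A Z) (Zero T Z (Fo (Shift T) A))"
    and TR1_cone:
      "\<lbrakk>A \<in> Obj T; B \<in> Obj T; f \<in> Hom T A B\<rbrakk> \<Longrightarrow> \<exists>D g h. Tri T A B D f g h"
    and TR2:
      "triangle T A B D f g h \<Longrightarrow>
        Tri T A B D f g h \<longleftrightarrow>
        Tri T B D (Fo (Shift T) A) g h
          (inv\<^bsub>hom_group T (Fo (Shift T) A) (Fo (Shift T) B)\<^esub> (Fm (Shift T) A B f))"
    and TR3:
      "\<lbrakk>Tri T A B D f g h; Tri T A' B' D' f' g' h'; a \<in> Hom T A A'; b \<in> Hom T B B';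
        Cmp T A B B' b f = Cmp T A A' B' f' a\<rbrakk>
        \<Longrightarrow> \<exists>d. triangle_morphism T A B D f g h A' B' D' f' g' h' a b d"
    and TR4:
      "\<lbrakk>Tri T A B D' f i j; Tri T B D A' g k l; Tri T A D B' (Cmp T A B D g f) m n\<rbrakk>
        \<Longrightarrow> \<exists>u v.
          Tri T D' B' A' u v
            (Cmp T A' (Fo (Shift T) B) (Fo (Shift T) D') (Fm (Shift T) B D' i) l) \<and>
          Cmp T B D' B' u i = Cmp T B D B' m g \<and>
          Cmp T D' B' (Fo (Shift T) A) n u = j \<and>
          Cmp T D B' A' v m = k \<and>
          Cmp T B' A' (Fo (Shift T) B) l v =
            Cmp T B' (Fo (Shift T) A) (Fo (Shift T) B) (Fm (Shift T) A B f) n"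

definition rigid :: "('o, 'm, 'x) tricat_scheme \<Rightarrow> 'o set \<Rightarrow> bool" where
  "rigid T X \<longleftrightarrow> (\<forall>Y\<in>X. \<forall>Z\<in>X. Hom T Y (Fo (Shift T) Z) = {Zero T Y (Fo (Shift T) Z)})"


section \<open>Coherent functors\<close>

text \<open>Abelian groups whose elements belong to the type \<open>'g\<close>.\<close>

definition Ab_cat :: "('g monoid, 'g \<Rightarrow> 'g) cat" where
  "Ab_cat =
     \<lparr>Obj = {G. comm_group G},
      Hom = (\<lambda>G H. hom G H \<inter> extensional (carrier G)),
      Idn = (\<lambda>G. \<lambda>x\<in>carrier G. x),
      Cmp = (\<lambda>G H K \<psi> \<phi>. compose (carrier G) \<psi> \<phi>)\<rparr>"

definition representable ::
  "('o, 'm, 'x) addcat_scheme \<Rightarrow> 'o \<Rightarrow> ('o, 'm, 'm monoid, 'm \<Rightarrow> 'm) cfun" where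
  "representable C X0 =
     \<lparr>Fo = (\<lambda>A. hom_group C A X0), Fm = (\<lambda>A B f. \<lambda>g\<in>Hom C A X0. Cmp C B A X0 g f)\<rparr>"

definition coherent ::
  "('o, 'm, 'x) addcat_scheme \<Rightarrow> 'o set \<Rightarrow> ('o, 'm, 'm monoid, 'm \<Rightarrow> 'm) cfun \<Rightarrow> bool" where
  "coherent C X F \<longleftrightarrow> is_functor (op_cat (full_subcat C X)) Ab_cat F \<and>
     (\<exists>X0\<in>X. \<exists>X1\<in>X. \<exists>\<alpha> \<beta>.
        nat_trans (op_cat (full_subcat C X)) Ab_cat (representable C X1) (representable C X0) \<alpha> \<and>
        nat_trans (op_cat (full_subcat C X)) Ab_cat (representable C X0) F \<beta> \<and>
        (\<forall>A\<in>X. \<alpha> A ` carrier (hom_group C A X1) = kernel (hom_group C A X0) (Fo F A) (\<beta> A) \<and>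
               \<beta> A ` carrier (hom_group C A X0) = carrier (Fo F A)))"

definition mod_cat ::
  "('o, 'm, 'x) addcat_scheme \<Rightarrow> 'o set \<Rightarrow>
   (('o, 'm, 'm monoid, 'm \<Rightarrow> 'm) cfun, 'o \<Rightarrow> 'm \<Rightarrow> 'm) cat" where
  "mod_cat C X =
     \<lparr>Obj = {F. coherent C X F},
      Hom = (\<lambda>F G. {\<alpha> \<in> extensional X. nat_trans (op_cat (full_subcat C X)) Ab_cat F G \<alpha>}),
      Idn = (\<lambda>F. \<lambda>A\<in>X. Idn Ab_cat (Fo F A)),
      Cmp = (\<lambda>F G H \<beta> \<alpha>. \<lambda>A\<in>X. Cmp Ab_cat (Fo F A) (Fo G A) (Fo H A) (\<beta> A) (\<alpha> A))\<rparr>"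

end

theory Submission
  imports Defs
begin

text \<open>
  Say that a map \<open>f : A \<rightarrow> B\<close> acts on \<open>X\<close> by \<open>T(Y,A) \<rightarrow> T(Y,B)\<close>, \<open>Y \<in> X\<close>. The cone \<open>U\<close> of a right
  \<open>X\<close>-approximation of \<open>A\<close> lies in \<open>X\<^sup>\<bottom>\<close> by rigidity, so \<open>f\<close> factors through \<open>X\<^sup>\<bottom>\<close> iff it acts as zero;
  hence \<open>H : A \<mapsto> T(-,A)|X\<close> is faithful on \<open>T/X\<^sup>\<bottom>\<close>, and a map there is regular iff it acts bijectively.
  If \<open>X1 \<rightarrow> X0 \<rightarrow> W \<rightarrow> X1[1]\<close> is a triangle with \<open>X1, X0 \<in> X\<close>, then \<open>H W\<close> is the cokernel of
  \<open>H X1 \<rightarrow> H X0\<close>, and \<open>(T/X\<^sup>\<bottom>)(W,B) \<rightarrow> Hom(H W, H B)\<close> is bijective for all \<open>B\<close>. So \<open>W\<close> sees regular maps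
  as isomorphisms, every object \<open>A\<close> receives a regular map from such a \<open>W\<close>, and \<open>A \<mapsto> W\<close> is the left
  adjoint of the localization functor, while every coherent functor is of the form \<open>H W\<close>.
\<close>

section \<open>Equivalences and regular maps\<close>

text \<open>The localization consists of zigzags, so neither equality nor size of its hom-sets is
  visible. Both are read off at objects \<open>W\<close> for which \<open>Hom Q W\<close> inverts
  regular maps: this functor then factors through \<open>P\<close>, which makes \<open>P\<close>
  injective on maps out of \<open>W\<close>, and formal inverses can be divided out, which makes it
  surjective. Since each \<open>A\<close> becomes isomorphic to such an \<open>r A\<close>, the
  hom-set \<open>Hom L A B\<close> is in bijection with \<open>Hom Q (r A) B\<close>. Smallness, the
  adjoint, faithfulness and kernels rest on this; for cokernels the test object is the target, and
  there left fractions are used. The quotient is encoded without addition or triangles, so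
  constructions are made in \<open>T\<close> with representatives and compared through their actions
  on \<open>X\<close>. The substitute for exactness is that a triangle
  \<open>X1 \<rightarrow> A \<rightarrow> B\<close> with \<open>X1\<close> in \<open>X\<close> gives
  a surjection from \<open>T(Y,A)\<close> to \<open>T(Y,B)\<close> for \<open>Y\<close> in
  \<open>X\<close>; this is where rigidity enters. The shift is only an equivalence, so a map is
  shifted back by fullness, and an object only up to isomorphism.\<close>

lemma is_functorD:
  assumes "is_functor C D F"
  shows "\<And>A. A \<in> Obj C \<Longrightarrow> Fo F A \<in> Obj D"
    and "\<And>A B f. \<lbrakk>A \<in> Obj C; B \<in> Obj C; f \<in> Hom C A B\<rbrakk> \<Longrightarrow> Fm F A B f \<in> Hom D (Fo F A) (Fo F B)"
    and "\<And>A. A \<in> Obj C \<Longrightarrow> Fm F A A (Idn C A) = Idn D (Fo F A)"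
    and "\<And>A B E f g. \<lbrakk>A \<in> Obj C; B \<in> Obj C; E \<in> Obj C; f \<in> Hom C A B; g \<in> Hom C B E\<rbrakk>
      \<Longrightarrow> Fm F A E (Cmp C A B E g f) =
          Cmp D (Fo F A) (Fo F B) (Fo F E) (Fm F B E g) (Fm F A B f)"
  using assms unfolding is_functor_def by blast+

text \<open>A chosen inverse, so that it can occur in terms such as \<open>zeval\<close>. The value
  is meaningful only for isomorphisms; in a category, \<open>inv_mor_eqI\<close> makes it the unique
  inverse.\<close>

definition inv_mor :: "('o, 'm, 'x) cat_scheme \<Rightarrow> 'o \<Rightarrow> 'o \<Rightarrow> 'm \<Rightarrow> 'm" where
  "inv_mor C A B f =
     (SOME g. g \<in> Hom C B A \<and> Cmp C A B A g f = Idn C A \<and> Cmp C B A B f g = Idn C B)"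

lemma inv_mor:
  assumes "iso_mor C A B f"
  shows "f \<in> Hom C A B" "inv_mor C A B f \<in> Hom C B A"
    "Cmp C A B A (inv_mor C A B f) f = Idn C A"
    "Cmp C B A B f (inv_mor C A B f) = Idn C B"
proof -
  have ex: "\<exists>g. g \<in> Hom C B A \<and> Cmp C A B A g f = Idn C A \<and> Cmp C B A B f g = Idn C B"
    using assms unfolding iso_mor_def by blast
  show "f \<in> Hom C A B" using assms unfolding iso_mor_def by blast
  show "inv_mor C A B f \<in> Hom C B A" "Cmp C A B A (inv_mor C A B f) f = Idn C A"
    "Cmp C B A B f (inv_mor C A B f) = Idn C B"
    using someI_ex[OF ex] unfolding inv_mor_def by blast+
qed

context category
begin

lemma inv_mor_eqI:
  assumes "A \<in> Obj C" "B \<in> Obj C" "f \<in> Hom C A B" "g \<in> Hom C B A"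
    "Cmp C A B A g f = Idn C A" "Cmp C B A B f g = Idn C B"
  shows "inv_mor C A B f = g"
proof -
  have "iso_mor C A B f" using assms unfolding iso_mor_def by blast
  note i = inv_mor[OF this]
  have "inv_mor C A B f = Cmp C B A A (Cmp C A B A g f) (inv_mor C A B f)"
    using assms i by (simp add: Cmp_Idn_left)
  also have "\<dots> = Cmp C B B A g (Cmp C B A B f (inv_mor C A B f))"
    using assms i Cmp_assoc[of B A B A] by blast
  also have "\<dots> = g" using assms i by (simp add: Cmp_Idn_right)
  finally show ?thesis .
qed

lemma inv_mor_Cmp_cancel:
  assumes "iso_mor C A B f" "W \<in> Obj C" "A \<in> Obj C" "B \<in> Obj C"
  shows "x \<in> Hom C W A \<Longrightarrow> Cmp C W B A (inv_mor C A B f) (Cmp C W A B f x) = x"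
    and "y \<in> Hom C W B \<Longrightarrow> Cmp C W A B f (Cmp C W B A (inv_mor C A B f) y) = y"
  using inv_mor[OF assms(1)] assms Cmp_assoc[of W A B A x f "inv_mor C A B f"]
    Cmp_assoc[of W B A B y "inv_mor C A B f" f] by (simp_all add: Cmp_Idn_left)

lemma Cmp_inv_mor_cancel:
  assumes "iso_mor C A B f" "W \<in> Obj C" "A \<in> Obj C" "B \<in> Obj C"
  shows "x \<in> Hom C A W \<Longrightarrow> Cmp C A B W (Cmp C B A W x (inv_mor C A B f)) f = x"
    and "y \<in> Hom C B W \<Longrightarrow> Cmp C B A W (Cmp C A B W y f) (inv_mor C A B f) = y"
  using inv_mor[OF assms(1)] assms by (simp_all add: Cmp_assoc Cmp_Idn_right)

lemma iso_cancel_left: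
  assumes "W \<in> Obj C" "A \<in> Obj C" "B \<in> Obj C" "iso_mor C A B f"
    "u \<in> Hom C W A" "v \<in> Hom C W A" "Cmp C W A B f u = Cmp C W A B f v"
  shows "u = v"
  using inv_mor_Cmp_cancel(1)[OF assms(4,1-3)] assms(5-7) by metis

lemma iso_cancel_right:
  assumes "W \<in> Obj C" "A \<in> Obj C" "B \<in> Obj C" "iso_mor C A B f"
    "u \<in> Hom C B W" "v \<in> Hom C B W" "Cmp C A B W u f = Cmp C A B W v f"
  shows "u = v"
  using Cmp_inv_mor_cancel(2)[OF assms(4,1-3)] assms(5-7) by metis

lemma iso_mor_inv:
  assumes "iso_mor C A B f"
  shows "iso_mor C B A (inv_mor C A B f)"
  using inv_mor[OF assms] unfolding iso_mor_def[of C B A] by blast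

lemma iso_comp_bij_right:
  assumes "W \<in> Obj C" "A \<in> Obj C" "B \<in> Obj C" "iso_mor C A B f"
  shows "bij_betw (\<lambda>u. Cmp C A B W u f) (Hom C B W) (Hom C A W)"
proof (rule bij_betw_byWitness[where f' = "\<lambda>u. Cmp C B A W u (inv_mor C A B f)"])
  show "(\<lambda>u. Cmp C A B W u f) ` Hom C B W \<subseteq> Hom C A W"
    "(\<lambda>u. Cmp C B A W u (inv_mor C A B f)) ` Hom C A W \<subseteq> Hom C B W"
    using assms inv_mor[OF assms(4)] Cmp_in_Hom by blast+
qed (simp_all add: Cmp_inv_mor_cancel[OF assms(4,1-3)])

lemma iso_comp_bij_left:
  assumes "W \<in> Obj C" "A \<in> Obj C" "B \<in> Obj C" "iso_mor C A B f"
  shows "bij_betw (\<lambda>u. Cmp C W A B f u) (Hom C W A) (Hom C W B)"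
proof (rule bij_betw_byWitness[where f' = "\<lambda>u. Cmp C W B A (inv_mor C A B f) u"])
  show "(\<lambda>u. Cmp C W A B f u) ` Hom C W A \<subseteq> Hom C W B"
    "(\<lambda>u. Cmp C W B A (inv_mor C A B f) u) ` Hom C W B \<subseteq> Hom C W A"
    using assms inv_mor[OF assms(4)] Cmp_in_Hom by blast+
qed (simp_all add: inv_mor_Cmp_cancel[OF assms(4,1-3)])

end

lemma (in category) regular_maps_Idn:
  assumes A: "A \<in> Obj C"
  shows "Idn C A \<in> regular_maps C A A"
  using A Idn_in_Hom[OF A]
  unfolding regular_maps_def mono_mor_def epi_mor_def by (simp add: Cmp_Idn_left Cmp_Idn_right)

lemma (in category) regular_maps_Cmp:
  assumes O: "A \<in> Obj C" "B \<in> Obj C" "D \<in> Obj C"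
    and s: "s \<in> regular_maps C A B" and t: "t \<in> regular_maps C B D"
  shows "Cmp C A B D t s \<in> regular_maps C A D"
proof -
  have sH: "s \<in> Hom C A B" and tH: "t \<in> Hom C B D"
    and sm: "mono_mor C A B s" and tm: "mono_mor C B D t"
    and se: "epi_mor C A B s" and te: "epi_mor C B D t"
    using s t unfolding regular_maps_def by blast+
  have "u = v"
    if W: "W \<in> Obj C" and u: "u \<in> Hom C W A" and v: "v \<in> Hom C W A"
      and eq: "Cmp C W A D (Cmp C A B D t s) u = Cmp C W A D (Cmp C A B D t s) v" for W u v
  proof -
    have "Cmp C W B D t (Cmp C W A B s u) = Cmp C W B D t (Cmp C W A B s v)"
      using eq Cmp_assoc[OF W O u sH tH] Cmp_assoc[OF W O v sH tH] by simp
    then have "Cmp C W A B s u = Cmp C W A B s v"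
      using tm W Cmp_in_Hom[OF W O(1,2) u sH] Cmp_in_Hom[OF W O(1,2) v sH]
      unfolding mono_mor_def by blast
    then show ?thesis using sm W u v unfolding mono_mor_def by blast
  qed
  moreover have "u = v"
    if W: "W \<in> Obj C" and u: "u \<in> Hom C D W" and v: "v \<in> Hom C D W"
      and eq: "Cmp C A D W u (Cmp C A B D t s) = Cmp C A D W v (Cmp C A B D t s)" for W u v
  proof -
    have "Cmp C A B W (Cmp C B D W u t) s = Cmp C A B W (Cmp C B D W v t) s"
      using eq Cmp_assoc[OF O W sH tH u] Cmp_assoc[OF O W sH tH v] by simp
    then have "Cmp C B D W u t = Cmp C B D W v t"
      using se W Cmp_in_Hom[OF O(2,3) W tH u] Cmp_in_Hom[OF O(2,3) W tH v]
      unfolding epi_mor_def by blast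
    then show ?thesis using te W u v unfolding epi_mor_def by blast
  qed
  ultimately show ?thesis
    using Cmp_in_Hom[OF O sH tH] unfolding regular_maps_def mono_mor_def epi_mor_def by blast
qed

section \<open>Equivalences as fully faithful and essentially surjective functors\<close>

lemma functor_iso:
  assumes "is_functor C D F" "A \<in> Obj C" "B \<in> Obj C" "iso_mor C A B f"
  shows "iso_mor D (Fo F A) (Fo F B) (Fm F A B f)"
    "Fm F B A (inv_mor C A B f) \<in> Hom D (Fo F B) (Fo F A)"
    "Cmp D (Fo F A) (Fo F B) (Fo F A) (Fm F B A (inv_mor C A B f)) (Fm F A B f) = Idn D (Fo F A)"
    "Cmp D (Fo F B) (Fo F A) (Fo F B) (Fm F A B f) (Fm F B A (inv_mor C A B f)) = Idn D (Fo F B)"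
proof -
  note i = inv_mor[OF assms(4)] and F = is_functorD[OF assms(1)]
  show 1: "Fm F B A (inv_mor C A B f) \<in> Hom D (Fo F B) (Fo F A)"
    "Cmp D (Fo F A) (Fo F B) (Fo F A) (Fm F B A (inv_mor C A B f)) (Fm F A B f) = Idn D (Fo F A)"
    "Cmp D (Fo F B) (Fo F A) (Fo F B) (Fm F A B f) (Fm F B A (inv_mor C A B f)) = Idn D (Fo F B)"
    using assms(2,3) i F(2)[OF assms(3,2) i(2)] F(3)[OF assms(2)] F(3)[OF assms(3)]
      F(4)[OF assms(2,3,2) i(1,2)] F(4)[OF assms(3,2,3) i(2,1)] by simp_all
  show "iso_mor D (Fo F A) (Fo F B) (Fm F A B f)"
    using 1 F(2)[OF assms(2,3) i(1)] unfolding iso_mor_def by blast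
qed

text \<open>By naturality \<open>G (F f)\<close> determines the composite of \<open>f\<close> with
  the isomorphism \<open>\<alpha> A\<close>, which cancels. Applied to both functors of an
  equivalence.\<close>

lemma faithful_if_retract:
  assumes C: "category C" and F: "is_functor C D F" and G: "is_functor D C G"
    and i: "nat_isomorphic C C (comp_cfun G F) id_cfun"
  shows "faithful C D F"
  unfolding faithful_def
proof (intro ballI inj_onI)
  interpret category C by fact
  obtain \<alpha> where a: "nat_trans C C (comp_cfun G F) id_cfun \<alpha>"
    and iso: "\<And>A. A \<in> Obj C \<Longrightarrow> iso_mor C (Fo G (Fo F A)) A (\<alpha> A)"
    using i unfolding nat_isomorphic_def by (auto simp: comp_cfun_def id_cfun_def)
  fix A B f g assume h: "A \<in> Obj C" "B \<in> Obj C" "f \<in> Hom C A B" "g \<in> Hom C A B"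
    and eq: "Fm F A B f = Fm F A B g"
  have GO: "Fo G (Fo F A) \<in> Obj C" using h is_functorD(1)[OF F] is_functorD(1)[OF G] by blast
  have "Cmp C (Fo G (Fo F A)) A B u (\<alpha> A) =
      Cmp C (Fo G (Fo F A)) (Fo G (Fo F B)) B (\<alpha> B) (Fm G (Fo F A) (Fo F B) (Fm F A B u))"
    if "u \<in> Hom C A B" for u
    using a that h unfolding nat_trans_def by (simp add: comp_cfun_def id_cfun_def)
  then have "Cmp C (Fo G (Fo F A)) A B f (\<alpha> A) = Cmp C (Fo G (Fo F A)) A B g (\<alpha> A)"
    using h eq by simp
  then show "f = g"
    using iso_cancel_right[OF h(2) GO h(1) iso] h by blast
qed

text \<open>Serves the shift, which is only given as an equivalence and must later be undone on
  maps. For fullness, \<open>G h\<close> is carried to a map \<open>f\<close> along the isomorphisms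
  \<open>\<alpha>\<close>, and faithfulness of \<open>G\<close> then gives
  \<open>F f = h\<close>.\<close>

lemma equivalence_fully_faithful:
  assumes C: "category C" and D: "category D" and e: "is_equivalence C D F"
  shows "fully_faithful C D F"
proof -
  interpret C: category C by fact
  interpret D: category D by fact
  obtain G where F: "is_functor C D F" and G: "is_functor D C G"
    and i: "nat_isomorphic C C (comp_cfun G F) id_cfun"
    and j: "nat_isomorphic D D (comp_cfun F G) id_cfun"
    using e unfolding is_equivalence_def by blast
  have fF: "faithful C D F" and fG: "faithful D C G"
    using faithful_if_retract[OF C F G i] faithful_if_retract[OF D G F j] .
  obtain \<alpha> where a: "nat_trans C C (comp_cfun G F) id_cfun \<alpha>"
    and iso: "\<And>A. A \<in> Obj C \<Longrightarrow> iso_mor C (Fo G (Fo F A)) A (\<alpha> A)"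
    using i unfolding nat_isomorphic_def by (auto simp: comp_cfun_def id_cfun_def)
  show ?thesis unfolding fully_faithful_def
  proof (intro ballI bij_betw_imageI)
    fix A B assume A: "A \<in> Obj C" and B: "B \<in> Obj C"
    let ?A = "Fo G (Fo F A)" and ?B = "Fo G (Fo F B)"
    have O: "Fo F A \<in> Obj D" "Fo F B \<in> Obj D" "?A \<in> Obj C" "?B \<in> Obj C"
      using A B is_functorD(1)[OF F] is_functorD(1)[OF G] by blast+
    show "inj_on (Fm F A B) (Hom C A B)" using fF A B unfolding faithful_def by blast
    show "Fm F A B ` Hom C A B = Hom D (Fo F A) (Fo F B)"
    proof (intro equalityI subsetI)
      fix h assume "h \<in> Fm F A B ` Hom C A B"
      then show "h \<in> Hom D (Fo F A) (Fo F B)" using A B is_functorD(2)[OF F] by blast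
    next
      fix h assume h: "h \<in> Hom D (Fo F A) (Fo F B)"
      define k where "k = Fm G (Fo F A) (Fo F B) h"
      have k: "k \<in> Hom C ?A ?B" using h O is_functorD(2)[OF G] unfolding k_def by blast
      note ia = inv_mor[OF iso[OF A]] and ib = inv_mor[OF iso[OF B]]
      \<comment> \<open>The only possible preimage of \<open>h\<close>: naturality of
        \<open>\<alpha>\<close> forces \<open>f\<close> after \<open>\<alpha> A\<close> to equal
        \<open>\<alpha> B\<close> after \<open>k\<close>.\<close>
      define f where "f = Cmp C A ?A B (Cmp C ?A ?B B (\<alpha> B) k) (inv_mor C ?A A (\<alpha> A))"
      have f: "f \<in> Hom C A B" using k ia ib A B O unfolding f_def by (simp add: C.Cmp_in_Hom)
      have "Cmp C ?A A B f (\<alpha> A) = Cmp C ?A ?B B (\<alpha> B) (Fm G (Fo F A) (Fo F B) (Fm F A B f))"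
        using a f A B unfolding nat_trans_def by (simp add: comp_cfun_def id_cfun_def)
      moreover have "Cmp C ?A A B f (\<alpha> A) = Cmp C ?A ?B B (\<alpha> B) k"
        using k ia ib A B O unfolding f_def
        by (simp add: C.Cmp_assoc C.Cmp_in_Hom C.Cmp_Idn_right)
      ultimately have "Fm G (Fo F A) (Fo F B) (Fm F A B f) = k"
        using C.iso_cancel_left[OF O(3,4) B iso[OF B]] k
          is_functorD(2)[OF G O(1,2) is_functorD(2)[OF F A B f]] by simp
      then have "Fm F A B f = h"
        using fG O h is_functorD(2)[OF F A B f] unfolding faithful_def k_def inj_on_def by blast
      then show "h \<in> Fm F A B ` Hom C A B" using f by blast
    qed
  qed
qed

text \<open>The quasi-inverse sends \<open>B\<close> to a chosen preimage \<open>g B\<close>, and a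
  map to the unique preimage of its conjugate by the chosen isomorphisms \<open>e\<close>.
  Functoriality follows from uniqueness of preimages.\<close>

lemma equivalence_if_fully_faithful:
  assumes C: "category C" and D: "category D" and F: "is_functor C D F"
    and ff: "fully_faithful C D F"
    and es: "\<And>B. B \<in> Obj D \<Longrightarrow> \<exists>A\<in>Obj C. \<exists>e. iso_mor D (Fo F A) B e"
  shows "is_equivalence C D F"
proof -
  interpret C: category C by fact
  interpret D: category D by fact
  obtain g e where g: "\<And>B. B \<in> Obj D \<Longrightarrow> g B \<in> Obj C"
    and e: "\<And>B. B \<in> Obj D \<Longrightarrow> iso_mor D (Fo F (g B)) B (e B)"
    using es by metis
  note FO = is_functorD(1)[OF F] and FH = is_functorD(2)[OF F] and FI = is_functorD(3)[OF F]
    and FC = is_functorD(4)[OF F]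
  note e1 = inv_mor(1)[OF e] and e2 = inv_mor(2)[OF e] and e3 = inv_mor(3)[OF e]
    and e4 = inv_mor(4)[OF e]
  define d where "d B = inv_mor D (Fo F (g B)) B (e B)" for B
  note e2 = e2[folded d_def] and e3 = e3[folded d_def] and e4 = e4[folded d_def]
  define lift where "lift A B h = the_inv_into (Hom C A B) (Fm F A B) h" for A B h
  have bij: "bij_betw (Fm F A B) (Hom C A B) (Hom D (Fo F A) (Fo F B))"
    if "A \<in> Obj C" "B \<in> Obj C" for A B
    using that ff unfolding fully_faithful_def by blast
  have lift: "lift A B h \<in> Hom C A B" "Fm F A B (lift A B h) = h"
    if "A \<in> Obj C" "B \<in> Obj C" "h \<in> Hom D (Fo F A) (Fo F B)" for A B h
    using bij[OF that(1,2)] that(3) unfolding lift_def bij_betw_def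
    by (auto intro: the_inv_into_into f_the_inv_into_f)
  have liftI: "lift A B h = f"
    if "A \<in> Obj C" "B \<in> Obj C" "f \<in> Hom C A B" "Fm F A B f = h" for A B h f
    using bij[OF that(1,2)] that(3,4) unfolding lift_def bij_betw_def
    by (auto intro: the_inv_into_f_f)
  define conj where "conj A B h = Cmp D (Fo F (g A)) B (Fo F (g B)) (d B)
    (Cmp D (Fo F (g A)) A B h (e A))" for A B h
  have conj: "conj A B h \<in> Hom D (Fo F (g A)) (Fo F (g B))"
    "Cmp D (Fo F (g A)) (Fo F (g B)) B (e B) (conj A B h) = Cmp D (Fo F (g A)) A B h (e A)"
    if "A \<in> Obj D" "B \<in> Obj D" "h \<in> Hom D A B" for A B h
    using that e1 e2 e4 g FO unfolding conj_def
    by (simp_all add: D.Cmp_in_Hom D.Cmp_assoc[symmetric] D.Cmp_Idn_left)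
  have conj_Idn: "conj A A (Idn D A) = Idn D (Fo F (g A))" if "A \<in> Obj D" for A
    using that e1 e3 g FO unfolding conj_def by (simp add: D.Cmp_Idn_left)
  have conj_Cmp: "conj A E (Cmp D A B E k h) =
      Cmp D (Fo F (g A)) (Fo F (g B)) (Fo F (g E)) (conj B E k) (conj A B h)"
    if "A \<in> Obj D" "B \<in> Obj D" "E \<in> Obj D" "h \<in> Hom D A B" "k \<in> Hom D B E" for A B E h k
  proof -
    have "Cmp D (Fo F (g A)) (Fo F (g B)) (Fo F (g E)) (conj B E k) (conj A B h) =
      Cmp D (Fo F (g A)) E (Fo F (g E)) (d E) (Cmp D (Fo F (g A)) B E k
        (Cmp D (Fo F (g A)) (Fo F (g B)) B (e B) (conj A B h)))"
      using that e1 e2 g FO conj(1) unfolding conj_def[of B]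
      by (simp add: D.Cmp_assoc D.Cmp_in_Hom)
    also have "\<dots> = conj A E (Cmp D A B E k h)"
      using that e1 e2 g FO conj unfolding conj_def[of A E]
      by (simp add: D.Cmp_assoc D.Cmp_in_Hom)
    finally show ?thesis by simp
  qed
  define G where "G = \<lparr>Fo = g, Fm = (\<lambda>A B h. lift (g A) (g B) (conj A B h))\<rparr>"
  have G: "is_functor D C G"
    unfolding is_functor_def
  proof (intro conjI ballI)
    show "\<And>A. A \<in> Obj D \<Longrightarrow> Fo G A \<in> Obj C" using g by (simp add: G_def)
    show "\<And>A B f. A \<in> Obj D \<Longrightarrow> B \<in> Obj D \<Longrightarrow> f \<in> Hom D A B \<Longrightarrow> Fm G A B f \<in> Hom C (Fo G A) (Fo G B)"
      using g conj lift by (simp add: G_def)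
    show "Fm G A A (Idn D A) = Idn C (Fo G A)" if "A \<in> Obj D" for A
      using that g conj_Idn FI unfolding G_def by (auto intro!: liftI simp: C.Idn_in_Hom)
    show "Fm G A E (Cmp D A B E h f) = Cmp C (Fo G A) (Fo G B) (Fo G E) (Fm G B E h) (Fm G A B f)"
      if "A \<in> Obj D" "B \<in> Obj D" "E \<in> Obj D" "f \<in> Hom D A B" "h \<in> Hom D B E" for A B E f h
      using that g conj_Cmp lift conj FC unfolding G_def
      by (auto intro!: liftI simp: C.Cmp_in_Hom)
  qed
  have 1: "nat_isomorphic C C (comp_cfun G F) id_cfun"
  proof -
    \<comment> \<open>The isomorphism \<open>e\<close> at \<open>F A\<close> and its inverse
      \<open>d\<close> come from maps of \<open>C\<close>; faithfulness of \<open>F\<close> makes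
      these inverse to each other and natural already in \<open>C\<close>.\<close>
    define a where "a A = lift (g (Fo F A)) A (e (Fo F A))" for A
    have a: "a A \<in> Hom C (g (Fo F A)) A" "Fm F (g (Fo F A)) A (a A) = e (Fo F A)"
      if "A \<in> Obj C" for A
      using that lift[of "g (Fo F A)" A "e (Fo F A)"] g FO e1 unfolding a_def by auto
    define b where "b A = lift A (g (Fo F A)) (d (Fo F A))" for A
    have b: "b A \<in> Hom C A (g (Fo F A))" "Fm F A (g (Fo F A)) (b A) = d (Fo F A)"
      if "A \<in> Obj C" for A
      using that lift[of A "g (Fo F A)" "d (Fo F A)"] g FO e2 unfolding b_def by auto
    have eqI: "u = v" if "A \<in> Obj C" "B \<in> Obj C" "u \<in> Hom C A B" "v \<in> Hom C A B"
      "Fm F A B u = Fm F A B v" for A B u v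
      using bij[OF that(1,2)] that unfolding bij_betw_def inj_on_def by blast
    have "iso_mor C (g (Fo F A)) A (a A)" if A: "A \<in> Obj C" for A
      unfolding iso_mor_def
    proof (intro conjI bexI[of _ "b A"])
      have O: "g (Fo F A) \<in> Obj C" using A FO g by blast
      show "Cmp C (g (Fo F A)) A (g (Fo F A)) (b A) (a A) = Idn C (g (Fo F A))"
        by (rule eqI[OF O O]) (use A O a b e3 FO FI FC in \<open>auto simp: C.Idn_in_Hom C.Cmp_in_Hom\<close>)
      show "Cmp C A (g (Fo F A)) A (a A) (b A) = Idn C A"
        by (rule eqI[OF A A]) (use A O a b e4 FO FI FC in \<open>auto simp: C.Idn_in_Hom C.Cmp_in_Hom\<close>)
    qed (use A a b in auto)
    moreover have "nat_trans C C (comp_cfun G F) id_cfun a"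
      unfolding nat_trans_def
    proof (intro conjI ballI)
      show "\<And>A. A \<in> Obj C \<Longrightarrow> a A \<in> Hom C (Fo (comp_cfun G F) A) (Fo id_cfun A)"
        using a by (simp add: comp_cfun_def G_def id_cfun_def)
      fix A B f assume h: "A \<in> Obj C" "B \<in> Obj C" "f \<in> Hom C A B"
      let ?k = "conj (Fo F A) (Fo F B) (Fm F A B f)"
      have k: "?k \<in> Hom D (Fo F (g (Fo F A))) (Fo F (g (Fo F B)))"
        by (rule conj(1)[OF FO[OF h(1)] FO[OF h(2)] FH[OF h]])
      let ?l = "lift (g (Fo F A)) (g (Fo F B)) ?k"
      have O: "g (Fo F A) \<in> Obj C" "g (Fo F B) \<in> Obj C" using h FO g by blast+
      note l = lift[OF O k]
      have "Fm F (g (Fo F A)) B (Cmp C (g (Fo F A)) A B f (a A)) =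
          Cmp D (Fo F (g (Fo F A))) (Fo F A) (Fo F B) (Fm F A B f) (e (Fo F A))"
        using FC[OF O(1) h(1,2) a(1)[OF h(1)] h(3)] a(2)[OF h(1)] by simp
      also have "\<dots> = Fm F (g (Fo F A)) B (Cmp C (g (Fo F A)) (g (Fo F B)) B (a B) ?l)"
        using FC[OF O h(2) l(1) a(1)[OF h(2)]] a(2)[OF h(2)] l(2)
          conj(2)[OF FO[OF h(1)] FO[OF h(2)] FH[OF h]] by simp
      finally have "Cmp C (g (Fo F A)) A B f (a A) = Cmp C (g (Fo F A)) (g (Fo F B)) B (a B) ?l"
        by (intro eqI[OF O(1) h(2)] C.Cmp_in_Hom[OF O(1) h(1,2) a(1)[OF h(1)] h(3)]
            C.Cmp_in_Hom[OF O h(2) l(1) a(1)[OF h(2)]])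
      then show "Cmp C (Fo (comp_cfun G F) A) (Fo id_cfun A) (Fo id_cfun B) (Fm id_cfun A B f) (a A) =
        Cmp C (Fo (comp_cfun G F) A) (Fo (comp_cfun G F) B) (Fo id_cfun B) (a B)
          (Fm (comp_cfun G F) A B f)"
        by (simp add: comp_cfun_def G_def id_cfun_def)
    qed
    ultimately show ?thesis
      unfolding nat_isomorphic_def by (auto simp: comp_cfun_def G_def id_cfun_def)
  qed
  have 2: "nat_isomorphic D D (comp_cfun F G) id_cfun"
  proof -
    \<comment> \<open>The second clause of \<open>conj\<close> is the naturality square of
      \<open>e\<close>.\<close>
    have "nat_trans D D (comp_cfun F G) id_cfun e"
      using e1 conj lift g unfolding nat_trans_def by (simp add: comp_cfun_def G_def id_cfun_def)
    then show ?thesis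
      using e unfolding nat_isomorphic_def by (auto simp: comp_cfun_def G_def id_cfun_def)
  qed
  show ?thesis unfolding is_equivalence_def using F G 1 2 by blast
qed

section \<open>The Gabriel-Zisman localization\<close>

lemma zpath_Obj: "zpath C R A p B \<Longrightarrow> A \<in> Obj C \<and> B \<in> Obj C"
  by (induction C R A p B rule: zpath.induct) auto

lemma zpath_append: "zpath C R A (p @ q) B \<longleftrightarrow> (\<exists>D. zpath C R A p D \<and> zpath C R D q B)"
proof (induction p arbitrary: A)
  case Nil
  then show ?case using zpath_Obj[of C R A q B] by auto
next
  case (Cons a p)
  then show ?case by (cases a) auto
qed

text \<open>The action on zigzags of a functor that inverts \<open>R\<close>: a formal inverse goes
  to the inverse of the image. Paths are listed in order of traversal, so the head acts first and
  stands on the right of the composite.\<close>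

fun zeval :: "('p, 'n, 'y) cat_scheme \<Rightarrow> ('o, 'm, 'p, 'n) cfun \<Rightarrow> 'o \<Rightarrow> ('o, 'm) zarrow list \<Rightarrow> 'o \<Rightarrow> 'n"
where
  "zeval D F A [] B = Idn D (Fo F B)"
| "zeval D F A (Fwd X Y f # p) B =
     Cmp D (Fo F X) (Fo F Y) (Fo F B) (zeval D F Y p B) (Fm F X Y f)"
| "zeval D F A (Inv X Y s # p) B =
     Cmp D (Fo F Y) (Fo F X) (Fo F B) (zeval D F X p B) (inv_mor D (Fo F X) (Fo F Y) (Fm F X Y s))"

text \<open>An arbitrary class of maps: zigzags give the localization and its universal property in
  this generality, and fractions are brought in only by \<open>L_left_fraction\<close>.\<close>

locale localizing = category C
  for C :: "('o, 'm, 'x) cat_scheme" +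
  fixes R :: "'o \<Rightarrow> 'o \<Rightarrow> 'm set"
  assumes R_Hom: "\<lbrakk>A \<in> Obj C; B \<in> Obj C; s \<in> R A B\<rbrakk> \<Longrightarrow> s \<in> Hom C A B"
begin

abbreviation L where "L \<equiv> localization C R"
abbreviation P where "P \<equiv> localization_functor C R"
abbreviation cls where "cls \<equiv> zclass C R"

lemma zeq_zpath: "zeq C R A B p q \<Longrightarrow> zpath C R A p B \<and> zpath C R A q B"
proof (induction rule: zeq.induct)
  case (zeq_append A B p p' D q q')
  then show ?case by (auto simp: zpath_append)
qed (auto simp: Idn_in_Hom Cmp_in_Hom)

lemma zclass_eq: "zpath C R A p B \<Longrightarrow> cls A B p = cls A B q \<longleftrightarrow> zeq C R A B p q"
proof
  assume "zpath C R A p B" and eq: "cls A B p = cls A B q"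
  then have "p \<in> cls A B q" unfolding eq[symmetric] by (simp add: zclass_def zeq_refl)
  then show "zeq C R A B p q" unfolding zclass_def by (blast intro: zeq_sym)
next
  assume "zeq C R A B p q"
  then show "cls A B p = cls A B q"
    unfolding zclass_def by (blast intro: zeq_trans zeq_sym)
qed

lemma zclass_eqI: "zeq C R A B p q \<Longrightarrow> cls A B p = cls A B q"
  using zclass_eq zeq_zpath by blast

lemma L_Obj [simp]: "Obj L = Obj C"
  and L_Idn: "Idn L A = cls A A []"
  by (simp_all add: localization_def)

lemma L_Hom: "F \<in> Hom L A B \<longleftrightarrow> (\<exists>p. zpath C R A p B \<and> F = cls A B p)"
  by (auto simp: localization_def)

text \<open>All concatenations of representatives lie in one class by \<open>zeq_append\<close>, so
  the union that defines the composite is a union of equal sets.\<close>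

lemma L_Cmp:
  assumes "zpath C R A p B" "zpath C R B q D"
  shows "Cmp L A B D (cls B D q) (cls A B p) = cls A D (p @ q)"
proof -
  have eq: "cls A D (p' @ q') = cls A D (p @ q)" if "p' \<in> cls A B p" "q' \<in> cls B D q" for p' q'
    using that zclass_eqI[OF zeq_append, of A B p p' D q q'] by (simp add: zclass_def)
  have mem: "p \<in> cls A B p" "q \<in> cls B D q"
    using assms by (simp_all add: zclass_def zeq_refl)
  have "(\<Union>p'\<in>cls A B p. \<Union>q'\<in>cls B D q. cls A D (p' @ q')) = cls A D (p @ q)"
    using eq mem by blast
  then show ?thesis by (simp add: localization_def)
qed

lemma category_L: "category L"
proof
  show "Idn L A \<in> Hom L A A" if "A \<in> Obj L" for A
    using that by (auto simp: L_Idn L_Hom intro!: exI[of _ "[]"])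
  show "Cmp L A B D g f \<in> Hom L A D" if "f \<in> Hom L A B" "g \<in> Hom L B D" for A B D f g
  proof -
    obtain p q where p: "zpath C R A p B" "f = cls A B p" and q: "zpath C R B q D" "g = cls B D q"
      using \<open>f \<in> Hom L A B\<close> \<open>g \<in> Hom L B D\<close> unfolding L_Hom by blast
    have "zpath C R A (p @ q) D" using p q by (auto simp: zpath_append)
    then show ?thesis using p q L_Cmp L_Hom by auto
  qed
  show "Cmp L A A B f (Idn L A) = f" if "A \<in> Obj L" "f \<in> Hom L A B" for A B f
    using that L_Cmp[of A "[]" A] by (auto simp: L_Hom L_Idn)
  show "Cmp L A B B (Idn L B) f = f" if "B \<in> Obj L" "f \<in> Hom L A B" for A B f
    using that L_Cmp[of A _ B "[]"] by (auto simp: L_Hom L_Idn)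
  show "Cmp L A B E (Cmp L B D E h g) f = Cmp L A D E h (Cmp L A B D g f)"
    if "f \<in> Hom L A B" "g \<in> Hom L B D" "h \<in> Hom L D E" for A B D E f g h
  proof -
    obtain p q r where p: "zpath C R A p B" "f = cls A B p" and q: "zpath C R B q D" "g = cls B D q"
      and r: "zpath C R D r E" "h = cls D E r"
      using \<open>f \<in> Hom L A B\<close> \<open>g \<in> Hom L B D\<close> \<open>h \<in> Hom L D E\<close> unfolding L_Hom by blast
    have "zpath C R A (p @ q) D" "zpath C R B (q @ r) E" using p q r by (auto simp: zpath_append)
    then show ?thesis using p q r by (simp add: L_Cmp)
  qed
qed

sublocale L: category L by (rule category_L)

lemma P_Fo [simp]: "Fo P A = A" by (simp add: localization_functor_def)

lemma P_functor: "is_functor C L P"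
  unfolding is_functor_def
proof (intro conjI ballI)
  show "Fm P A B f \<in> Hom L (Fo P A) (Fo P B)"
    if "A \<in> Obj C" "B \<in> Obj C" "f \<in> Hom C A B" for A B f
    using that by (auto simp: localization_functor_def L_Hom intro!: exI[of _ "[Fwd A B f]"])
  show "Fm P A A (Idn C A) = Idn L (Fo P A)" if "A \<in> Obj C" for A
    using that by (simp add: localization_functor_def L_Idn zclass_eqI zeq_Idn)
  show "Fm P A E (Cmp C A B E g f) =
      Cmp L (Fo P A) (Fo P B) (Fo P E) (Fm P B E g) (Fm P A B f)"
    if "A \<in> Obj C" "B \<in> Obj C" "E \<in> Obj C" "f \<in> Hom C A B" "g \<in> Hom C B E" for A B E f g
    using that zclass_eqI[OF zeq_Cmp[OF that]]
    by (simp add: localization_functor_def L_Cmp)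
qed simp

lemmas P_Hom = is_functorD(2)[OF P_functor, simplified]
  and P_Idn = is_functorD(3)[OF P_functor, simplified]
  and P_Cmp = is_functorD(4)[OF P_functor, simplified]

lemma Fm_P: "Fm P A B f = cls A B [Fwd A B f]"
  by (simp add: localization_functor_def)

text \<open>The reversed arrow is the inverse by the last two generating relations. The second claim
  turns a letter \<open>Inv\<close> into composition with \<open>inv_mor\<close>, which removes
  paths from the cases of \<open>L_Hom_induct\<close>.\<close>

lemma P_iso: 
  assumes "A \<in> Obj C" "B \<in> Obj C" "s \<in> R A B"
  shows "iso_mor L A B (Fm P A B s)"
    and "inv_mor L A B (Fm P A B s) = cls B A [Inv A B s]"
proof -
  have s: "s \<in> Hom C A B" using R_Hom assms by blast
  have i: "cls B A [Inv A B s] \<in> Hom L B A"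
    using assms by (auto simp: L_Hom intro!: exI[of _ "[Inv A B s]"])
  have l: "Cmp L A B A (cls B A [Inv A B s]) (Fm P A B s) = Idn L A"
    using assms s by (simp add: Fm_P L_Cmp L_Idn zclass_eqI zeq_Fwd_Inv)
  have r: "Cmp L B A B (Fm P A B s) (cls B A [Inv A B s]) = Idn L B"
    using assms s by (simp add: Fm_P L_Cmp L_Idn zclass_eqI zeq_Inv_Fwd)
  show "iso_mor L A B (Fm P A B s)"
    unfolding iso_mor_def using i l r P_Hom[OF assms(1,2) s] by blast
  show "inv_mor L A B (Fm P A B s) = cls B A [Inv A B s]"
    using L.inv_mor_eqI[OF _ _ P_Hom[OF assms(1,2) s] i l r] assms by simp
qed

lemma P_inverts: "inverts C R L P"
  unfolding inverts_def using P_iso by simp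

text \<open>Paths are peeled off at their end, so a property of \<open>w\<close> has to survive
  composition on the left with each \<open>P f\<close> and with the inverse of each
  \<open>P s\<close>.\<close>

lemma L_Hom_induct [consumes 2, case_names Idn Fwd Inv]:
  assumes w: "w \<in> Hom L A B" and A: "A \<in> Obj C"
    and Idn: "K A (Idn L A)"
    and Fwd: "\<And>D E f w. \<lbrakk>D \<in> Obj C; E \<in> Obj C; w \<in> Hom L A D; f \<in> Hom C D E; K D w\<rbrakk>
      \<Longrightarrow> K E (Cmp L A D E (Fm P D E f) w)"
    and Inv: "\<And>D E s w. \<lbrakk>D \<in> Obj C; E \<in> Obj C; w \<in> Hom L A D; s \<in> R E D; K D w\<rbrakk>
      \<Longrightarrow> K E (Cmp L A D E (inv_mor L E D (Fm P E D s)) w)"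
  shows "K B w"
proof -
  have "K B (cls A B p)" if "zpath C R A p B" for p
    using that
  proof (induction p arbitrary: B rule: rev_induct)
    case Nil
    then show ?case using Idn by (auto simp: L_Idn)
  next
    case (snoc a p)
    then obtain D where p: "zpath C R A p D" and a: "zpath C R D [a] B"
      unfolding zpath_append by blast
    have w: "cls A D p \<in> Hom L A D" using p L_Hom by blast
    show ?case
    proof (cases a)
      case (Fwd D' E f)
      then have h: "a = Fwd D B f" "D \<in> Obj C" "B \<in> Obj C" "f \<in> Hom C D B" using a by auto
      show ?thesis
        using assms(4)[OF h(2,3) w h(4) snoc.IH[OF p]] L_Cmp[OF p a] h(1) by (simp add: Fm_P)
    next
      case (Inv D' E s)
      then have h: "a = Inv B D s" "D \<in> Obj C" "B \<in> Obj C" "s \<in> R B D" using a by auto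
      show ?thesis
        using assms(5)[OF h(2,3) w h(4) snoc.IH[OF p]] L_Cmp[OF p a] h(1) P_iso(2)[OF h(3,2,4)]
        by simp
    qed
  qed
  then show ?thesis using w unfolding L_Hom by blast
qed

section \<open>Universal property of the localization\<close>

context
  fixes D :: "('p, 'n, 'y) cat_scheme" and F :: "('o, 'm, 'p, 'n) cfun"
  assumes D: "category D" and F: "is_functor C D F" and inv: "inverts C R D F"
begin

interpretation D: category D by (rule D)

private lemma FO: "A \<in> Obj C \<Longrightarrow> Fo F A \<in> Obj D"
  by (rule is_functorD(1)[OF F])

private lemma FH: "\<lbrakk>A \<in> Obj C; B \<in> Obj C; f \<in> Hom C A B\<rbrakk> \<Longrightarrow> Fm F A B f \<in> Hom D (Fo F A) (Fo F B)"
  by (rule is_functorD(2)[OF F])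

private lemma Fiso: "\<lbrakk>A \<in> Obj C; B \<in> Obj C; s \<in> R A B\<rbrakk> \<Longrightarrow> iso_mor D (Fo F A) (Fo F B) (Fm F A B s)"
  using inv unfolding inverts_def by blast

private lemma zeval_Hom: "zpath C R A p B \<Longrightarrow> zeval D F A p B \<in> Hom D (Fo F A) (Fo F B)"
proof (induction p arbitrary: A)
  case Nil
  then show ?case using FO D.Idn_in_Hom by auto
next
  case (Cons a p)
  show ?case
  proof (cases a)
    case (Fwd X Y f)
    then have h: "X = A" "X \<in> Obj C" "Y \<in> Obj C" "f \<in> Hom C X Y" "zpath C R Y p B"
      using Cons.prems by auto
    have B: "B \<in> Obj C" using zpath_Obj[OF h(5)] by blast
    show ?thesis
      using D.Cmp_in_Hom[OF FO[OF h(2)] FO[OF h(3)] FO[OF B] FH[OF h(2-4)] Cons.IH[OF h(5)]] Fwd h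
      by simp
  next
    case (Inv X Y s)
    then have h: "Y = A" "X \<in> Obj C" "Y \<in> Obj C" "s \<in> R X Y" "zpath C R X p B"
      using Cons.prems by auto
    have B: "B \<in> Obj C" using zpath_Obj[OF h(5)] by blast
    show ?thesis
      using D.Cmp_in_Hom[OF FO[OF h(3)] FO[OF h(2)] FO[OF B] inv_mor(2)[OF Fiso[OF h(2-4)]]
          Cons.IH[OF h(5)]] Inv h by simp
  qed
qed

private lemma zeval_append:
  assumes "zpath C R A p B" "zpath C R B q E"
  shows "zeval D F A (p @ q) E = Cmp D (Fo F A) (Fo F B) (Fo F E) (zeval D F B q E) (zeval D F A p B)"
  using assms(1)
proof (induction p arbitrary: A)
  case Nil
  then show ?case
    using zeval_Hom[OF assms(2)] zpath_Obj[OF assms(2)] FO by (simp add: D.Cmp_Idn_right)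
next
  case (Cons a p)
  have O: "B \<in> Obj C" "E \<in> Obj C" using zpath_Obj[OF assms(2)] by blast+
  show ?case
  proof (cases a)
    case (Fwd X Y f)
    then have h: "X = A" "X \<in> Obj C" "Y \<in> Obj C" "f \<in> Hom C X Y" "zpath C R Y p B"
      using Cons.prems by auto
    show ?thesis
      using D.Cmp_assoc[OF FO[OF h(2)] FO[OF h(3)] FO[OF O(1)] FO[OF O(2)] FH[OF h(2-4)]
          zeval_Hom[OF h(5)] zeval_Hom[OF assms(2)]] Fwd h Cons.IH[OF h(5)] by simp
  next
    case (Inv X Y s)
    then have h: "Y = A" "X \<in> Obj C" "Y \<in> Obj C" "s \<in> R X Y" "zpath C R X p B"
      using Cons.prems by auto
    show ?thesis
      using D.Cmp_assoc[OF FO[OF h(3)] FO[OF h(2)] FO[OF O(1)] FO[OF O(2)]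
          inv_mor(2)[OF Fiso[OF h(2-4)]] zeval_Hom[OF h(5)] zeval_Hom[OF assms(2)]]
        Inv h Cons.IH[OF h(5)] by simp
  qed
qed

text \<open>The generating relations become functoriality of \<open>F\<close> and the equations of
  inverses; the congruence rule becomes \<open>zeval_append\<close>.\<close>

private lemma zeval_zeq: "zeq C R A B p q \<Longrightarrow> zeval D F A p B = zeval D F A q B"
proof (induction rule: zeq.induct)
  case (zeq_append A B p p' E q q')
  then show ?case
    using zeval_append[of A p B q E] zeval_append[of A p' B q' E] zeq_zpath by metis
next
  case (zeq_Idn A)
  then show ?case using is_functorD(3)[OF F] FO D.Cmp_Idn_right D.Idn_in_Hom by simp
next
  case (zeq_Cmp A B E f g)
  then show ?case
    using is_functorD(4)[OF F zeq_Cmp] FO[of A] FO[of B] FO[of E] FH[of A B f] FH[of B E g]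
    by (simp add: D.Cmp_Idn_left D.Cmp_in_Hom)
next
  case (zeq_Fwd_Inv A B s)
  note i = inv_mor[OF Fiso[OF zeq_Fwd_Inv(1,2,4)]]
  show ?case using i FO[OF zeq_Fwd_Inv(1)] FO[OF zeq_Fwd_Inv(2)] by (simp add: D.Cmp_Idn_left)
next
  case (zeq_Inv_Fwd A B s)
  note i = inv_mor[OF Fiso[OF zeq_Inv_Fwd(1,2,4)]]
  show ?case using i FO[OF zeq_Inv_Fwd(1)] FO[OF zeq_Inv_Fwd(2)] by (simp add: D.Cmp_Idn_left)
qed simp_all

lemma lift_to_L: "\<exists>G. is_functor L D G \<and> cfun_eq C (comp_cfun G P) F"
proof -
  \<comment> \<open>Any representative serves: by \<open>zeval_zeq\<close> all paths of a class have
    the same value.\<close>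
  define G where "G = \<lparr>Fo = Fo F, Fm = (\<lambda>A B w. zeval D F A (SOME p. p \<in> w) B)\<rparr>"
  have G: "Fm G A B (cls A B p) = zeval D F A p B" if "zpath C R A p B" for A B p
  proof -
    have "p \<in> cls A B p" using that by (simp add: zclass_def zeq_refl)
    then have "(SOME p'. p' \<in> cls A B p) \<in> cls A B p" by (rule someI)
    then have "zeq C R A B p (SOME p'. p' \<in> cls A B p)" by (simp add: zclass_def)
    then show ?thesis using zeval_zeq by (simp add: G_def)
  qed
  have "is_functor L D G"
    unfolding is_functor_def
  proof (intro conjI ballI)
    show "Fo G A \<in> Obj D" if "A \<in> Obj L" for A
      using that FO by (simp add: G_def)
    show "Fm G A B w \<in> Hom D (Fo G A) (Fo G B)" if "w \<in> Hom L A B" for A B w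
      using that G zeval_Hom unfolding L_Hom by (auto simp: G_def)
    show "Fm G A A (Idn L A) = Idn D (Fo G A)" if "A \<in> Obj L" for A
      using that G[of A "[]" A] by (simp add: L_Idn) (simp add: G_def)
    show "Fm G A E (Cmp L A B E v w) = Cmp D (Fo G A) (Fo G B) (Fo G E) (Fm G B E v) (Fm G A B w)"
      if "w \<in> Hom L A B" "v \<in> Hom L B E" for A B E v w
    proof -
      obtain p q where p: "zpath C R A p B" "w = cls A B p" and q: "zpath C R B q E" "v = cls B E q"
        using \<open>w \<in> Hom L A B\<close> \<open>v \<in> Hom L B E\<close> unfolding L_Hom by blast
      have "zpath C R A (p @ q) E" using p q by (auto simp: zpath_append)
      then show ?thesis
        using L_Cmp[OF p(1) q(1)] G[OF p(1)] G[OF q(1)] G[of A "p @ q" E] p q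
          zeval_append[OF p(1) q(1)] by (simp add: G_def)
    qed
  qed
  moreover have "cfun_eq C (comp_cfun G P) F"
    unfolding cfun_eq_def
  proof (intro conjI ballI)
    show "Fo (comp_cfun G P) A = Fo F A" for A by (simp add: comp_cfun_def G_def)
    show "Fm (comp_cfun G P) A B f = Fm F A B f"
      if "A \<in> Obj C" "B \<in> Obj C" "f \<in> Hom C A B" for A B f
      using that G[of A "[Fwd A B f]" B] FO[of A] FO[of B] FH[of A B f]
      by (simp add: comp_cfun_def Fm_P D.Cmp_Idn_left)
  qed
  ultimately show ?thesis by blast
qed

end

text \<open>Only the inverses of the maps \<open>P s\<close> need thought: a functor sends such an
  inverse to an inverse of the image of \<open>P s\<close>, on which \<open>G\<close> and
  \<open>G'\<close> agree, and inverses are unique.\<close>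

lemma L_functors_eqI:
  assumes D: "category D" and G: "is_functor L D G" and G': "is_functor L D G'"
    and eq: "cfun_eq C (comp_cfun G P) (comp_cfun G' P)"
  shows "cfun_eq L G G'"
proof -
  interpret D: category D by (rule D)
  have O: "Fo G A = Fo G' A" if "A \<in> Obj C" for A
    using eq that by (simp add: cfun_eq_def comp_cfun_def)
  have M: "Fm G A B (Fm P A B f) = Fm G' A B (Fm P A B f)"
    if "A \<in> Obj C" "B \<in> Obj C" "f \<in> Hom C A B" for A B f
    using eq that by (simp add: cfun_eq_def comp_cfun_def)
  have "Fm G A B w = Fm G' A B w" if "A \<in> Obj C" "B \<in> Obj C" "w \<in> Hom L A B" for A B w
    using that(3,1)
  proof (induction rule: L_Hom_induct)
    case Idn
    then show ?case using O is_functorD(3)[OF G] is_functorD(3)[OF G'] that by simp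
  next
    case (Fwd E E' f w)
    then show ?case
      using O[of A] O[of E] O[of E'] M[of E E' f] P_Hom[of E E' f] that
        is_functorD(4)[OF G, of A E E' w "Fm P E E' f"]
        is_functorD(4)[OF G', of A E E' w "Fm P E E' f"] by simp
  next
    case (Inv E E' s w)
    let ?s = "Fm P E' E s" and ?i = "inv_mor L E' E (Fm P E' E s)"
    have s: "s \<in> Hom C E' E" and i: "iso_mor L E' E ?s" using Inv R_Hom P_iso by blast+
    have OL: "E' \<in> Obj L" "E \<in> Obj L" "A \<in> Obj L" using Inv that by simp_all
    note g = functor_iso[OF G OL(1,2) i] and g' = functor_iso[OF G' OL(1,2) i]
    have "Fm G E E' ?i = Fm G' E E' ?i"
      using D.inv_mor_eqI[OF _ _ inv_mor(1)[OF g(1)] g(2-4)]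
        D.inv_mor_eqI[OF _ _ inv_mor(1)[OF g'(1)] g'(2-4)]
        is_functorD(1)[OF G OL(1)] is_functorD(1)[OF G OL(2)] O[OF Inv(1)] O[OF Inv(2)]
        M[OF Inv(2,1) s] by simp
    then show ?case
      using O[OF that(1)] O[OF Inv(1)] O[OF Inv(2)] Inv.IH
        is_functorD(4)[OF G OL(3,2,1) Inv(3) inv_mor(2)[OF i]]
        is_functorD(4)[OF G' OL(3,2,1) Inv(3) inv_mor(2)[OF i]] by simp
  qed
  then show ?thesis using O by (simp add: cfun_eq_def)
qed

lemma universal_property:
  assumes D: "category D"
  shows "universally_inverts C R L P D"
  unfolding universally_inverts_def
proof (intro allI impI)
  fix F assume "is_functor C D F \<and> inverts C R D F"
  then obtain G where G: "is_functor L D G" "cfun_eq C (comp_cfun G P) F"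
    using lift_to_L[OF D] by blast
  moreover have "cfun_eq L G G'" if "is_functor L D G'" "cfun_eq C (comp_cfun G' P) F" for G'
    using L_functors_eqI[OF D G(1) that(1)] G(2) that(2) unfolding cfun_eq_def by simp
  ultimately show "\<exists>G. is_functor L D G \<and> cfun_eq C (comp_cfun G P) F \<and>
      (\<forall>G'. is_functor L D G' \<and> cfun_eq C (comp_cfun G' P) F \<longrightarrow> cfun_eq L G G')" by blast
qed

end

section \<open>Localizations with enough colocal objects\<close>

text \<open>A target for \<open>Hom C W\<close> as a functor, so that the universal property of the
  localization can be applied to it.\<close>

definition hom_set_cat :: "('a set, 'a \<Rightarrow> 'a) cat" where
  "hom_set_cat = \<lparr>Obj = UNIV, Hom = (\<lambda>A B. A \<rightarrow>\<^sub>E B), Idn = (\<lambda>A. \<lambda>x\<in>A. x),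
                  Cmp = (\<lambda>A B D g f. compose A g f)\<rparr>"

lemma category_hom_set_cat: "category hom_set_cat"
proof
  show "Idn hom_set_cat A \<in> Hom hom_set_cat A A" for A :: "'a set"
    by (simp add: hom_set_cat_def)
  show "Cmp hom_set_cat A B D g f \<in> Hom hom_set_cat A D"
    if "f \<in> Hom hom_set_cat A B" "g \<in> Hom hom_set_cat B D" for A B D and f g :: "'a \<Rightarrow> 'a"
    using that PiE_mem by (fastforce simp: hom_set_cat_def compose_def)
  show "Cmp hom_set_cat A A B f (Idn hom_set_cat A) = f"
    if "f \<in> Hom hom_set_cat A B" for A B and f :: "'a \<Rightarrow> 'a"
    using that PiE_arb[of f A] by (force simp: hom_set_cat_def compose_def)
  show "Cmp hom_set_cat A B B (Idn hom_set_cat B) f = f"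
    if "f \<in> Hom hom_set_cat A B" for A B and f :: "'a \<Rightarrow> 'a"
    using that PiE_arb[of f A] PiE_mem[of f A] by (force simp: hom_set_cat_def compose_def)
  show "Cmp hom_set_cat A B E (Cmp hom_set_cat B D E h g) f =
      Cmp hom_set_cat A D E h (Cmp hom_set_cat A B D g f)"
    if "f \<in> Hom hom_set_cat A B" for A B D E and f g h :: "'a \<Rightarrow> 'a"
    using that PiE_mem[of f A] by (force simp: hom_set_cat_def compose_def)
qed

lemma iso_hom_set_catI:
  assumes "bij_betw f A B"
  shows "iso_mor hom_set_cat A B (restrict f A)"
proof -
  let ?g = "restrict (the_inv_into A f) B"
  have i: "inj_on f A" "f ` A = B" using assms by (auto simp: bij_betw_def)
  have 1: "restrict f A \<in> A \<rightarrow>\<^sub>E B" using i by auto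
  have 2: "?g \<in> B \<rightarrow>\<^sub>E A" using i by (auto intro: the_inv_into_into)
  have 3: "compose A ?g (restrict f A) = (\<lambda>x\<in>A. x)"
    using i by (auto simp: compose_def fun_eq_iff the_inv_into_f_f)
  have 4: "compose B (restrict f A) ?g = (\<lambda>x\<in>B. x)"
    using i by (auto simp: compose_def fun_eq_iff f_the_inv_into_f the_inv_into_into)
  have "restrict f A \<in> Hom hom_set_cat A B" "?g \<in> Hom hom_set_cat B A"
    "Cmp hom_set_cat A B A ?g (restrict f A) = Idn hom_set_cat A"
    "Cmp hom_set_cat B A B (restrict f A) ?g = Idn hom_set_cat B"
    unfolding hom_set_cat_def cat.simps by (fact 1 2 3 4)+
  then show ?thesis unfolding iso_mor_def by blast
qed

section \<open>Zero objects, zero maps and kernels in categories without addition\<close>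

lemma zero_object_iff:
  "zero_object C Z \<longleftrightarrow>
     Z \<in> Obj C \<and> (\<forall>A\<in>Obj C. (\<exists>x. Hom C A Z = {x}) \<and> (\<exists>x. Hom C Z A = {x}))"
proof -
  have "(\<exists>!f. f \<in> Hom C A B) \<longleftrightarrow> (\<exists>x. Hom C A B = {x})" for A B
    by (auto simp: Ex1_def)
  then show ?thesis unfolding zero_object_def by simp
qed

text \<open>A map \<open>t\<close> between the two zero objects carries one factorization into the
  other. This makes the zero map well defined in the factor category and its localization, whose
  records carry no \<open>Zero\<close>.\<close>

lemma zero_mor_unique:
  assumes "category C" "A \<in> Obj C" "B \<in> Obj C" "zero_mor C A B f" "zero_mor C A B f'"
  shows "f = f'"
proof -
  interpret category C by fact
  obtain Z g h Z' g' h' where Z: "zero_object C Z" "g \<in> Hom C A Z" "h \<in> Hom C Z B" "f = Cmp C A Z B h g"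
    and Z': "zero_object C Z'" "g' \<in> Hom C A Z'" "h' \<in> Hom C Z' B" "f' = Cmp C A Z' B h' g'"
    using assms(4,5) unfolding zero_mor_def by blast
  have O: "Z \<in> Obj C" "Z' \<in> Obj C" using Z Z' unfolding zero_object_def by blast+
  obtain t where t: "t \<in> Hom C Z Z'" using Z(1) O unfolding zero_object_def by blast
  have "Cmp C A Z Z' t g = g'"
    using Z'(1,2) Cmp_in_Hom[OF assms(2) O Z(2) t] assms(2) unfolding zero_object_def by blast
  moreover have "Cmp C Z Z' B h' t = h"
    using Z(1,3) Cmp_in_Hom[OF O assms(3) t Z'(3)] assms(3) unfolding zero_object_def by blast
  ultimately show ?thesis
    using Z(4) Z'(4) Cmp_assoc[OF assms(2) O assms(3) Z(2) t Z'(3)] by simp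
qed

lemma zero_mor_Cmp:
  assumes "category C" "A \<in> Obj C" "B \<in> Obj C" "D \<in> Obj C"
  shows "zero_mor C A B f \<Longrightarrow> g \<in> Hom C B D \<Longrightarrow> zero_mor C A D (Cmp C A B D g f)"
    and "zero_mor C B D g \<Longrightarrow> f \<in> Hom C A B \<Longrightarrow> zero_mor C A D (Cmp C A B D g f)"
proof -
  interpret category C by fact
  show "zero_mor C A D (Cmp C A B D g f)" if "zero_mor C A B f" "g \<in> Hom C B D"
  proof -
    obtain Z u v where Z: "zero_object C Z" "u \<in> Hom C A Z" "v \<in> Hom C Z B" "f = Cmp C A Z B v u"
      using \<open>zero_mor C A B f\<close> unfolding zero_mor_def by blast
    have O: "Z \<in> Obj C" using Z unfolding zero_object_def by blast
    show ?thesis unfolding zero_mor_def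
      using Z(1,2) Cmp_in_Hom[OF O assms(3,4) Z(3) \<open>g \<in> Hom C B D\<close>]
        Cmp_assoc[OF assms(2) O assms(3,4) Z(2,3) \<open>g \<in> Hom C B D\<close>] Z(4) by metis
  qed
  show "zero_mor C A D (Cmp C A B D g f)" if "zero_mor C B D g" "f \<in> Hom C A B"
  proof -
    obtain Z u v where Z: "zero_object C Z" "u \<in> Hom C B Z" "v \<in> Hom C Z D" "g = Cmp C B Z D v u"
      using \<open>zero_mor C B D g\<close> unfolding zero_mor_def by blast
    have O: "Z \<in> Obj C" using Z unfolding zero_object_def by blast
    show ?thesis unfolding zero_mor_def
      using Z(1,3) Cmp_in_Hom[OF assms(2,3) O \<open>f \<in> Hom C A B\<close> Z(2)]
        Cmp_assoc[OF assms(2,3) O assms(4) \<open>f \<in> Hom C A B\<close> Z(2,3)] Z(4) by metis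
  qed
qed

lemma zero_mor_exists:
  assumes "zero_object C Z" "A \<in> Obj C" "B \<in> Obj C"
  obtains g h where "g \<in> Hom C A Z" "h \<in> Hom C Z B" "zero_mor C A B (Cmp C A Z B h g)"
  using assms unfolding zero_object_def zero_mor_def by metis

lemma zero_object_op: "zero_object (op_cat C) Z \<longleftrightarrow> zero_object C Z"
  by (auto simp: zero_object_def op_cat_def)

lemma zero_mor_op: "zero_mor (op_cat C) B A f \<longleftrightarrow> zero_mor C A B f"
  unfolding zero_mor_def zero_object_op by (auto simp: op_cat_def)

lemma is_cokernel_iff:
  "is_cokernel C A B f Q q \<longleftrightarrow>
     A \<in> Obj C \<and> B \<in> Obj C \<and> f \<in> Hom C A B \<and> Q \<in> Obj C \<and> q \<in> Hom C B Q \<and>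
     zero_mor C A Q (Cmp C A B Q q f) \<and>
     (\<forall>W\<in>Obj C. \<forall>w\<in>Hom C B W. zero_mor C A W (Cmp C A B W w f) \<longrightarrow>
        (\<exists>!u. u \<in> Hom C Q W \<and> Cmp C B Q W u q = w))"
  unfolding is_cokernel_def is_kernel_def zero_mor_op by (auto simp: op_cat_def)

section \<open>Colocal objects and the maps out of them in the localization\<close>

context localizing
begin

text \<open>The objects that see every map in \<open>R\<close> as an isomorphism; the coreflection
  \<open>r\<close> below takes values in them.\<close>

definition colocal :: "'o \<Rightarrow> bool" where
  "colocal W \<longleftrightarrow> W \<in> Obj C \<and> (\<forall>A\<in>Obj C. \<forall>B\<in>Obj C. \<forall>s\<in>R A B.
     bij_betw (\<lambda>u. Cmp C W A B s u) (Hom C W A) (Hom C W B))"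

text \<open>A Yoneda argument: \<open>Hom C W\<close> inverts \<open>R\<close>, hence factors
  through \<open>P\<close>. If \<open>P f = P g\<close>, then \<open>f\<close> and \<open>g\<close>
  act alike on \<open>Hom C W W\<close>, and applying them to the identity gives
  \<open>f = g\<close>.\<close>

lemma P_inj_on_colocal:
  assumes W: "colocal W" and B: "B \<in> Obj C"
  shows "inj_on (Fm P W B) (Hom C W B)"
proof -
  have WO: "W \<in> Obj C" using W by (simp add: colocal_def)
  define F where "F = \<lparr>Fo = Hom C W, Fm = (\<lambda>A B f. \<lambda>u\<in>Hom C W A. Cmp C W A B f u)\<rparr>"
  have F: "is_functor C hom_set_cat F"
    unfolding is_functor_def
  proof (intro conjI ballI)
    fix A B E f g assume h: "A \<in> Obj C" "B \<in> Obj C" "E \<in> Obj C" "f \<in> Hom C A B" "g \<in> Hom C B E"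
    have "Cmp C W A E (Cmp C A B E g f) u = Cmp C W B E g (Cmp C W A B f u)"
      if "u \<in> Hom C W A" for u
      using Cmp_assoc[OF WO h(1-3) that h(4,5)] .
    then show "Fm F A E (Cmp C A B E g f) =
        Cmp hom_set_cat (Fo F A) (Fo F B) (Fo F E) (Fm F B E g) (Fm F A B f)"
      using Cmp_in_Hom[OF WO h(1,2) _ h(4)]
      by (auto simp: F_def hom_set_cat_def compose_def fun_eq_iff)
  qed (use WO in \<open>auto simp: F_def hom_set_cat_def Cmp_in_Hom Cmp_Idn_left fun_eq_iff\<close>)
  have "inverts C R hom_set_cat F"
    unfolding inverts_def F_def cfun.simps
    by (intro ballI iso_hom_set_catI) (use W in \<open>simp add: colocal_def\<close>)
  then obtain G where G: "cfun_eq C (comp_cfun G P) F"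
    using lift_to_L[OF category_hom_set_cat F] by blast
  show ?thesis
  proof (rule inj_onI)
    fix f g assume h: "f \<in> Hom C W B" "g \<in> Hom C W B" "Fm P W B f = Fm P W B g"
    then have "Fm F W B f = Fm F W B g"
      using G WO B unfolding cfun_eq_def comp_cfun_def by simp (metis h)
    then have "Cmp C W W B f (Idn C W) = Cmp C W W B g (Idn C W)"
      using Idn_in_Hom[OF WO] by (simp add: F_def restrict_def fun_eq_iff) metis
    then show "f = g" using h WO B by (simp add: Cmp_Idn_right)
  qed
qed

text \<open>Induction on zigzags: the lift \<open>g\<close> is composed with a forward arrow, and at
  a formal inverse of \<open>s\<close> it is divided by \<open>s\<close>, which colocality
  allows.\<close>

lemma P_surj_colocal:
  assumes W: "colocal W" and w: "w \<in> Hom L W B"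
  shows "\<exists>g\<in>Hom C W B. w = Fm P W B g"
proof -
  have WO: "W \<in> Obj C" using W by (simp add: colocal_def)
  show ?thesis
    using w WO
  proof (induction rule: L_Hom_induct)
    case Idn
    then show ?case using P_Idn WO Idn_in_Hom by metis
  next
    case (Fwd D E f w)
    then obtain g where g: "g \<in> Hom C W D" "w = Fm P W D g" by blast
    show ?case
      using P_Cmp[OF WO Fwd(1,2) g(1) Fwd(4)] Cmp_in_Hom[OF WO Fwd(1,2) g(1) Fwd(4)] g(2) by metis
  next
    case (Inv D E s w)
    then obtain g where g: "g \<in> Hom C W D" "w = Fm P W D g" by blast
    have "g \<in> (\<lambda>u. Cmp C W E D s u) ` Hom C W E"
      using W g(1) Inv(1,2,4) unfolding colocal_def bij_betw_def by blast
    then obtain u where u: "u \<in> Hom C W E" "g = Cmp C W E D s u" by blast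
    have s: "s \<in> Hom C E D" using R_Hom[OF Inv(2,1,4)] .
    have "Cmp L W D E (inv_mor L E D (Fm P E D s)) w = Fm P W E u"
      using L.inv_mor_Cmp_cancel(1)[OF P_iso(1)[OF Inv(2,1,4)], of W "Fm P W E u"]
        P_Cmp[OF WO Inv(2,1) u(1) s] P_Hom[OF WO Inv(2) u(1)] u g WO Inv by simp
    then show ?case using u(1) by metis
  qed
qed

text \<open>The Ore square moves a new forward arrow past the old denominator, and a formal inverse
  is absorbed by composing denominators. This serves the cokernel argument, where the test object is
  the target.\<close>

lemma L_left_fraction:
  assumes lf: "left_fractions C R" and w: "w \<in> Hom L A B" and A: "A \<in> Obj C"
  shows "\<exists>B'\<in>Obj C. \<exists>s\<in>R B B'. \<exists>g\<in>Hom C A B'. Cmp L A B B' (Fm P B B' s) w = Fm P A B' g"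
proof -
  have comp: "\<And>A B D s t. \<lbrakk>A \<in> Obj C; B \<in> Obj C; D \<in> Obj C; s \<in> R A B; t \<in> R B D\<rbrakk>
      \<Longrightarrow> Cmp C A B D t s \<in> R A D"
    and ore: "\<And>A A' B s u. \<lbrakk>A \<in> Obj C; A' \<in> Obj C; B \<in> Obj C; s \<in> R A A'; u \<in> Hom C A B\<rbrakk> \<Longrightarrow>
        \<exists>B'\<in>Obj C. \<exists>s'\<in>R B B'. \<exists>u'\<in>Hom C A' B'. Cmp C A A' B' u' s = Cmp C A B B' s' u"
    and idn: "\<And>A. A \<in> Obj C \<Longrightarrow> Idn C A \<in> R A A"
    using lf unfolding left_fractions_def by blast+
  show ?thesis
    using w A
  proof (induction rule: L_Hom_induct)
    case Idn
    have i: "Idn C A \<in> Hom C A A" using A by (rule Idn_in_Hom)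
    have "Cmp L A A A (Fm P A A (Idn C A)) (Idn L A) = Fm P A A (Idn C A)"
      using A P_Hom[OF A A i] by (simp add: L.Cmp_Idn_right)
    then show ?case using A i idn by blast
  next
    case (Fwd D E f w)
    then obtain D' s g where s: "D' \<in> Obj C" "s \<in> R D D'" "g \<in> Hom C A D'"
      "Cmp L A D D' (Fm P D D' s) w = Fm P A D' g" by blast
    \<comment> \<open>From \<open>h s = t f\<close>: the new denominator is \<open>t\<close>, the
      new numerator is \<open>h g\<close>.\<close>
    obtain E' t h where t: "E' \<in> Obj C" "t \<in> R E E'" "h \<in> Hom C D' E'"
      "Cmp C D D' E' h s = Cmp C D E E' t f"
      using ore[OF Fwd(1) s(1) Fwd(2) s(2) Fwd(4)] by blast
    have sh: "s \<in> Hom C D D'" and th: "t \<in> Hom C E E'" using R_Hom s t Fwd by blast+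
    note P1 = P_Hom[OF Fwd(1) s(1) sh] and P2 = P_Hom[OF Fwd(2) t(1) th]
      and P3 = P_Hom[OF s(1) t(1,3)] and P4 = P_Hom[OF Fwd(1,2,4)]
    have "Cmp L A E E' (Fm P E E' t) (Cmp L A D E (Fm P D E f) w) =
        Cmp L A D E' (Cmp L D E E' (Fm P E E' t) (Fm P D E f)) w"
      using L.Cmp_assoc[of A D E E'] Fwd P2 P4 t A by simp
    also have "\<dots> = Cmp L A D E' (Cmp L D D' E' (Fm P D' E' h) (Fm P D D' s)) w"
      using P_Cmp[OF Fwd(1,2) t(1) Fwd(4) th] P_Cmp[OF Fwd(1) s(1) t(1) sh t(3)] t(4) by simp
    also have "\<dots> = Cmp L A D' E' (Fm P D' E' h) (Fm P A D' g)"
      using L.Cmp_assoc[of A D D' E'] Fwd P1 P3 t(1) s A by simp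
    also have "\<dots> = Fm P A E' (Cmp C A D' E' h g)"
      using P_Cmp[OF A s(1) t(1) s(3) t(3)] by simp
    finally show ?case using t(1,2) Cmp_in_Hom[OF A s(1) t(1) s(3) t(3)] by blast
  next
    case (Inv D E s w)
    then obtain D' t g where t: "D' \<in> Obj C" "t \<in> R D D'" "g \<in> Hom C A D'"
      "Cmp L A D D' (Fm P D D' t) w = Fm P A D' g" by blast
    have sh: "s \<in> Hom C E D" and th: "t \<in> Hom C D D'" using R_Hom Inv t by blast+
    note i = P_iso(1)[OF Inv(2,1,4)]
    note iH = inv_mor(2)[OF i] and P1 = P_Hom[OF Inv(2,1) sh] and P2 = P_Hom[OF Inv(1) t(1) th]
    have "Cmp L A E D' (Fm P E D' (Cmp C E D D' t s))
          (Cmp L A D E (inv_mor L E D (Fm P E D s)) w) = Fm P A D' g"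
      using P_Cmp[OF Inv(2,1) t(1) sh th] L.Cmp_assoc[of A E D D' _ "Fm P E D s" "Fm P D D' t"]
        L.inv_mor_Cmp_cancel(2)[OF i _ _ _ Inv(3)] L.Cmp_in_Hom[of A D E w] iH P1 P2 Inv t A by simp
    then show ?case using comp[OF Inv(2,1) t(1) Inv(4) t(2)] t(1,3) by blast
  qed
qed

end

text \<open>Since \<open>\<gamma> A\<close> lies in \<open>R\<close>, the replacement
  \<open>r A\<close> is isomorphic to \<open>A\<close> in the localization. Here \<open>r\<close> is
  a function on objects only; \<open>left_adjoint_P\<close> extends it to the maps of
  \<open>L\<close>.\<close>

locale enough_colocals = localizing +
  fixes r :: "'a \<Rightarrow> 'a" and \<gamma> :: "'a \<Rightarrow> 'b"
  assumes colocal_r: "A \<in> Obj C \<Longrightarrow> colocal (r A)"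
    and \<gamma>_R: "A \<in> Obj C \<Longrightarrow> \<gamma> A \<in> R (r A) A"
begin

lemma r_Obj: "A \<in> Obj C \<Longrightarrow> r A \<in> Obj C"
  using colocal_r unfolding colocal_def by blast

lemma \<gamma>_Hom: "A \<in> Obj C \<Longrightarrow> \<gamma> A \<in> Hom C (r A) A"
  using R_Hom r_Obj \<gamma>_R by blast

abbreviation P\<gamma> where "P\<gamma> A \<equiv> Fm P (r A) A (\<gamma> A)"
abbreviation P\<gamma>_inv where "P\<gamma>_inv A \<equiv> inv_mor L (r A) A (P\<gamma> A)"

lemma P\<gamma>_iso: "A \<in> Obj C \<Longrightarrow> iso_mor L (r A) A (P\<gamma> A)"
  using P_iso r_Obj \<gamma>_R by blast

lemma P\<gamma>_Hom: "A \<in> Obj C \<Longrightarrow> P\<gamma> A \<in> Hom L (r A) A"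
  and P\<gamma>_inv_Hom: "A \<in> Obj C \<Longrightarrow> P\<gamma>_inv A \<in> Hom L A (r A)"
  using inv_mor[OF P\<gamma>_iso] by blast+

lemma P_bij_colocal:
  assumes "colocal W" "B \<in> Obj C"
  shows "bij_betw (Fm P W B) (Hom C W B) (Hom L W B)"
  unfolding bij_betw_def
proof (intro conjI equalityI subsetI)
  show "inj_on (Fm P W B) (Hom C W B)" by (rule P_inj_on_colocal[OF assms])
  show "w \<in> Hom L W B" if "w \<in> Fm P W B ` Hom C W B" for w
    using that P_Hom assms unfolding colocal_def by blast
  show "w \<in> Fm P W B ` Hom C W B" if "w \<in> Hom L W B" for w
    using P_surj_colocal[OF assms(1) that] by blast
qed

text \<open>\<open>A\<close> is isomorphic to \<open>r A\<close> in \<open>L\<close>, and maps of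
  \<open>L\<close> out of \<open>r A\<close> are those of \<open>C\<close>. Both smallness and the
  adjunction come from this formula.\<close>

lemma L_Hom_bij:
  assumes "A \<in> Obj C" "B \<in> Obj C"
  shows "bij_betw (\<lambda>g. Cmp L A (r A) B (Fm P (r A) B g) (P\<gamma>_inv A)) (Hom C (r A) B) (Hom L A B)"
  using bij_betw_trans[OF P_bij_colocal[OF colocal_r[OF assms(1)] assms(2)]
      L.iso_comp_bij_right[OF _ _ _ L.iso_mor_inv[OF P\<gamma>_iso[OF assms(1)]], of B]]
    assms r_Obj by (simp add: o_def)

text \<open>Zigzags run through arbitrary objects and have any length, but each class is given by a
  single map of \<open>C\<close> out of \<open>r A\<close>.\<close>

lemma has_small_homs_L:
  assumes "has_small_homs TYPE('h) C"
  shows "has_small_homs TYPE('h) L"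
  unfolding has_small_homs_def
proof (intro ballI)
  fix A B assume "A \<in> Obj L" "B \<in> Obj L"
  then have h: "A \<in> Obj C" "B \<in> Obj C" by simp_all
  obtain \<iota> :: "'b \<Rightarrow> 'h" where i: "inj_on \<iota> (Hom C (r A) B)"
    using assms h r_Obj unfolding has_small_homs_def by blast
  note b = bij_betw_the_inv_into[OF L_Hom_bij[OF h]]
  show "\<exists>\<iota> :: ('a, 'b) zarrow list set \<Rightarrow> 'h. inj_on \<iota> (Hom L A B)"
    using comp_inj_on[OF bij_betw_imp_inj_on[OF b]] i bij_betw_imp_surj_on[OF b] by metis
qed

text \<open>On objects the adjoint is \<open>r\<close>. A map is conjugated by
  \<open>P\<gamma>\<close> and then lifted along \<open>P\<close>; both operations are bijections,
  whence full faithfulness. The adjunction is the bijection \<open>L_Hom_bij\<close>.\<close>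

lemma left_adjoint_P: "\<exists>G. left_adjoint L C G P \<and> fully_faithful L C G"
proof -
  define c where "c A B a = Cmp L (r A) A (r B) (Cmp L A B (r B) (P\<gamma>_inv B) a) (P\<gamma> A)" for A B a
  have c_bij: "bij_betw (c A B) (Hom L A B) (Hom L (r A) (r B))" if "A \<in> Obj C" "B \<in> Obj C" for A B
    using bij_betw_trans[OF L.iso_comp_bij_left[OF _ _ _ L.iso_mor_inv[OF P\<gamma>_iso[OF that(2)]], of A]
        L.iso_comp_bij_right[OF _ _ _ P\<gamma>_iso[OF that(1)], of "r B"]] that r_Obj
    unfolding c_def by (simp add: o_def)
  have c_Hom: "c A B a \<in> Hom L (r A) (r B)" if "A \<in> Obj C" "B \<in> Obj C" "a \<in> Hom L A B" for A B a
    by (rule bij_betw_apply[OF c_bij[OF that(1,2)] that(3)])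
  have c_eq: "Cmp L (r A) (r B) B (P\<gamma> B) (c A B a) = Cmp L (r A) A B a (P\<gamma> A)"
    if "A \<in> Obj C" "B \<in> Obj C" "a \<in> Hom L A B" for A B a
    using that r_Obj P\<gamma>_Hom P\<gamma>_inv_Hom L.Cmp_in_Hom[of "r A" A B "P\<gamma> A" a]
      L.inv_mor_Cmp_cancel(2)[OF P\<gamma>_iso[of B], of "r A" "Cmp L (r A) A B a (P\<gamma> A)"]
    unfolding c_def by (simp add: L.Cmp_assoc)
  \<comment> \<open>\<open>c A B a\<close> is characterized by its square with
    \<open>P\<gamma>\<close>, so functoriality is proved by comparing squares.\<close>
  have c_unique: "b = c A B a"
    if "A \<in> Obj C" "B \<in> Obj C" "a \<in> Hom L A B" "b \<in> Hom L (r A) (r B)"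
      "Cmp L (r A) (r B) B (P\<gamma> B) b = Cmp L (r A) A B a (P\<gamma> A)" for A B a b
    using L.iso_cancel_left[OF _ _ _ P\<gamma>_iso[OF that(2)] that(4) c_Hom[OF that(1-3)]]
      c_eq[OF that(1-3)] that r_Obj by simp
  define l where "l A B = the_inv_into (Hom C (r A) (r B)) (Fm P (r A) (r B))" for A B
  have Pb: "bij_betw (Fm P (r A) (r B)) (Hom C (r A) (r B)) (Hom L (r A) (r B))"
    if "A \<in> Obj C" "B \<in> Obj C" for A B
    using P_bij_colocal[OF colocal_r[OF that(1)] r_Obj[OF that(2)]] .
  have l_bij: "bij_betw (l A B) (Hom L (r A) (r B)) (Hom C (r A) (r B))"
    if "A \<in> Obj C" "B \<in> Obj C" for A B
    using bij_betw_the_inv_into[OF Pb[OF that]] unfolding l_def .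
  have Pl: "Fm P (r A) (r B) (l A B a) = a" if "A \<in> Obj C" "B \<in> Obj C" "a \<in> Hom L (r A) (r B)" for A B a
    using f_the_inv_into_f_bij_betw[OF Pb[OF that(1,2)]] that(3) unfolding l_def by blast
  define G where "G = \<lparr>Fo = r, Fm = (\<lambda>A B a. l A B (c A B a))\<rparr>"
  have G_bij: "bij_betw (Fm G A B) (Hom L A B) (Hom C (r A) (r B))" if "A \<in> Obj C" "B \<in> Obj C" for A B
    using bij_betw_trans[OF c_bij[OF that] l_bij[OF that]] by (simp add: G_def o_def)
  have G_Hom: "Fm G A B a \<in> Hom C (r A) (r B)" if "A \<in> Obj C" "B \<in> Obj C" "a \<in> Hom L A B" for A B a
    by (rule bij_betw_apply[OF G_bij[OF that(1,2)] that(3)])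
  have PG: "Fm P (r A) (r B) (Fm G A B a) = c A B a" if "A \<in> Obj C" "B \<in> Obj C" "a \<in> Hom L A B" for A B a
    using Pl[OF that(1,2) c_Hom[OF that]] by (simp add: G_def)
  have P_inj: "f = g" if "A \<in> Obj C" "B \<in> Obj C" "f \<in> Hom C (r A) (r B)" "g \<in> Hom C (r A) (r B)"
    "Fm P (r A) (r B) f = Fm P (r A) (r B) g" for A B f g
    using Pb[OF that(1,2)] that(3-5) unfolding bij_betw_def inj_on_def by blast
  have G: "is_functor L C G"
    unfolding is_functor_def
  proof (intro conjI ballI)
    show "Fo G A \<in> Obj C" if "A \<in> Obj L" for A using that r_Obj by (simp add: G_def)
    show "Fm G A B a \<in> Hom C (Fo G A) (Fo G B)" if "A \<in> Obj L" "B \<in> Obj L" "a \<in> Hom L A B" for A B a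
      using that G_Hom by (simp add: G_def)
    show "Fm G A A (Idn L A) = Idn C (Fo G A)" if "A \<in> Obj L" for A
    proof -
      have A: "A \<in> Obj C" "r A \<in> Obj C" using that r_Obj by simp_all
      have i: "Idn L A \<in> Hom L A A" "Idn L (r A) \<in> Hom L (r A) (r A)"
        "Idn C (r A) \<in> Hom C (r A) (r A)" using A L.Idn_in_Hom Idn_in_Hom by simp_all
      have "Idn L (r A) = c A A (Idn L A)"
        by (rule c_unique[OF A(1,1) i(1,2)])
           (use A P\<gamma>_Hom in \<open>simp add: L.Cmp_Idn_left L.Cmp_Idn_right\<close>)
      then show ?thesis
        using P_inj[OF A(1,1) G_Hom[OF A(1,1) i(1)] i(3)] PG[OF A(1,1) i(1)] P_Idn[OF A(2)]
        by (simp add: G_def)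
    qed
    show "Fm G A E (Cmp L A B E b a) = Cmp C (Fo G A) (Fo G B) (Fo G E) (Fm G B E b) (Fm G A B a)"
      if h': "A \<in> Obj L" "B \<in> Obj L" "E \<in> Obj L" "a \<in> Hom L A B" "b \<in> Hom L B E" for A B E a b
    proof -
      have h: "A \<in> Obj C" "B \<in> Obj C" "E \<in> Obj C" using h' by simp_all
      note rO = r_Obj[OF h(1)] r_Obj[OF h(2)] r_Obj[OF h(3)]
      have ba: "Cmp L A B E b a \<in> Hom L A E" using L.Cmp_in_Hom[OF h'] .
      note ca = c_Hom[OF h(1,2) h'(4)] and cb = c_Hom[OF h(2,3) h'(5)]
      have cc: "Cmp L (r A) (r B) (r E) (c B E b) (c A B a) \<in> Hom L (r A) (r E)"
        using L.Cmp_in_Hom[OF _ _ _ ca cb] rO by simp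
      have "Cmp L (r A) (r E) E (P\<gamma> E) (Cmp L (r A) (r B) (r E) (c B E b) (c A B a)) =
          Cmp L (r A) (r B) E (Cmp L (r B) (r E) E (P\<gamma> E) (c B E b)) (c A B a)"
        using L.Cmp_assoc[OF _ _ _ _ ca cb P\<gamma>_Hom[OF h(3)]] rO h by simp
      also have "\<dots> = Cmp L (r A) B E b (Cmp L (r A) (r B) B (P\<gamma> B) (c A B a))"
        using L.Cmp_assoc[OF _ _ _ _ ca P\<gamma>_Hom[OF h(2)] h'(5)] rO h c_eq[OF h(2,3) h'(5)] by simp
      also have "\<dots> = Cmp L (r A) A E (Cmp L A B E b a) (P\<gamma> A)"
        using L.Cmp_assoc[OF _ _ _ _ P\<gamma>_Hom[OF h(1)] h'(4,5)] rO h c_eq[OF h(1,2) h'(4)] by simp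
      finally have "Cmp L (r A) (r B) (r E) (c B E b) (c A B a) = c A E (Cmp L A B E b a)"
        by (rule c_unique[OF h(1,3) ba cc])
      moreover note g1 = G_Hom[OF h(1,2) h'(4)] and g2 = G_Hom[OF h(2,3) h'(5)]
      ultimately have "Fm P (r A) (r E) (Fm G A E (Cmp L A B E b a)) =
          Fm P (r A) (r E) (Cmp C (r A) (r B) (r E) (Fm G B E b) (Fm G A B a))"
        using PG[OF h(1,3) ba] PG[OF h(1,2) h'(4)] PG[OF h(2,3) h'(5)] P_Cmp[OF rO g1 g2] by simp
      then have "Fm G A E (Cmp L A B E b a) = Cmp C (r A) (r B) (r E) (Fm G B E b) (Fm G A B a)"
        by (rule P_inj[OF h(1,3) G_Hom[OF h(1,3) ba] Cmp_in_Hom[OF rO g1 g2]])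
      then show ?thesis by (simp add: G_def)
    qed
  qed
  define \<phi> where "\<phi> A B g = Cmp L A (r A) B (Fm P (r A) B g) (P\<gamma>_inv A)" for A B g
  have "left_adjoint L C G P"
    unfolding left_adjoint_def
  proof (intro conjI exI[of _ \<phi>] ballI)
    show "bij_betw (\<phi> A B) (Hom C (Fo G A) B) (Hom L A (Fo P B))" if "A \<in> Obj L" "B \<in> Obj C" for A B
      using L_Hom_bij[of A B] that unfolding \<phi>_def[abs_def] by (simp add: G_def)
    fix A A' B B' a b h
    assume H: "A \<in> Obj L" "A' \<in> Obj L" "B \<in> Obj C" "B' \<in> Obj C" "a \<in> Hom L A' A"
      "b \<in> Hom C B B'" "h \<in> Hom C (Fo G A) B"
    have O: "A \<in> Obj C" "A' \<in> Obj C" "r A \<in> Obj C" "r A' \<in> Obj C" using H r_Obj by simp_all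
    have h: "h \<in> Hom C (r A) B" using H by (simp add: G_def)
    note bh = Cmp_in_Hom[OF O(3) H(3,4) h H(6)] and g = G_Hom[OF O(2,1) H(5)]
    note Pb = P_Hom[OF H(3,4,6)] and Ph = P_Hom[OF O(3) H(3) h]
      and i = P\<gamma>_inv_Hom[OF O(1)] and i' = P\<gamma>_inv_Hom[OF O(2)] and ca = c_Hom[OF O(2,1) H(5)]
    have "Cmp L A' (r A') (r A) (c A' A a) (P\<gamma>_inv A') = Cmp L A' A (r A) (P\<gamma>_inv A) a"
      using L.Cmp_inv_mor_cancel(2)[OF P\<gamma>_iso[OF O(2)], of "r A"] O L.Cmp_in_Hom[of A' A "r A" a "P\<gamma>_inv A"] i H
      unfolding c_def by simp
    then show "\<phi> A' B' (Cmp C (Fo G A') (Fo G A) B' (Cmp C (Fo G A) B B' b h) (Fm G A' A a)) =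
        Cmp L A' A (Fo P B') (Cmp L A (Fo P B) (Fo P B') (Fm P B B' b) (\<phi> A B h)) a"
      using P_Cmp[OF O(4,3) H(4) g bh] P_Cmp[OF O(3) H(3,4) h H(6)] PG[OF O(2,1) H(5)]
        O H Pb Ph i i' ca L.Cmp_in_Hom
      by (simp add: \<phi>_def G_def L.Cmp_assoc)
  qed (use G P_functor in auto)
  moreover have "fully_faithful L C G"
    using G_bij unfolding fully_faithful_def by (simp add: G_def)
  ultimately show ?thesis by blast
qed

text \<open>Equal images give equal composites with \<open>\<gamma> A\<close>, by injectivity of
  \<open>P\<close> on maps out of \<open>r A\<close>, and \<open>\<gamma> A\<close> is epic.\<close>

lemma faithful_P:
  assumes epi: "\<And>A B s. \<lbrakk>A \<in> Obj C; B \<in> Obj C; s \<in> R A B\<rbrakk> \<Longrightarrow> epi_mor C A B s"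
  shows "faithful C L P"
  unfolding faithful_def
proof (intro ballI inj_onI)
  fix A B f g assume h: "A \<in> Obj C" "B \<in> Obj C" "f \<in> Hom C A B" "g \<in> Hom C A B"
    and eq: "Fm P A B f = Fm P A B g"
  note rA = r_Obj[OF h(1)] and ga = \<gamma>_Hom[OF h(1)]
  have "Fm P (r A) B (Cmp C (r A) A B f (\<gamma> A)) = Fm P (r A) B (Cmp C (r A) A B g (\<gamma> A))"
    using P_Cmp[OF rA h(1,2) ga h(3)] P_Cmp[OF rA h(1,2) ga h(4)] eq by simp
  then have "Cmp C (r A) A B f (\<gamma> A) = Cmp C (r A) A B g (\<gamma> A)"
    using P_inj_on_colocal[OF colocal_r[OF h(1)] h(2)] Cmp_in_Hom[OF rA h(1,2) ga h(3)]
      Cmp_in_Hom[OF rA h(1,2) ga h(4)] unfolding inj_on_def by blast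
  then show "f = g"
    using epi[OF rA h(1) \<gamma>_R[OF h(1)]] h unfolding epi_mor_def by blast
qed

text \<open>A zero object is colocal because a map between singletons is bijective; hence its
  hom-sets in \<open>L\<close>, on either side, are in bijection with singletons of
  \<open>C\<close>.\<close>

lemma zero_object_L:
  assumes Z: "zero_object C Z"
  shows "zero_object L Z"
proof -
  have ZO: "Z \<in> Obj C" using Z unfolding zero_object_def by blast
  have single: "\<exists>y. Y = {y}" if "bij_betw F X Y" "\<exists>x. X = {x}" for F X Y
    using that unfolding bij_betw_def by auto
  have ZC: "\<exists>x. Hom C A Z = {x}" "\<exists>x. Hom C Z A = {x}" if "A \<in> Obj C" for A
    using Z that unfolding zero_object_iff by blast+
  have "colocal Z"
    unfolding colocal_def
  proof (intro conjI ballI)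
    fix A B s assume h: "A \<in> Obj C" "B \<in> Obj C" "s \<in> R A B"
    obtain x y where x: "Hom C Z A = {x}" and y: "Hom C Z B = {y}"
      using ZC(2)[OF h(1)] ZC(2)[OF h(2)] by blast
    have "Cmp C Z A B s x = y" using Cmp_in_Hom[OF ZO h(1,2) _ R_Hom[OF h]] x y by blast
    then show "bij_betw (\<lambda>u. Cmp C Z A B s u) (Hom C Z A) (Hom C Z B)"
      unfolding x y by (simp add: bij_betw_def)
  qed (rule ZO)
  note Zc = this
  have "\<exists>x. Hom L Z A = {x}" if "A \<in> Obj C" for A
    by (rule single[OF P_bij_colocal[OF Zc that] ZC(2)[OF that]])
  moreover have "\<exists>x. Hom L A Z = {x}" if "A \<in> Obj C" for A
    by (rule single[OF L_Hom_bij[OF that ZO] ZC(1)[OF r_Obj[OF that]]])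
  ultimately show ?thesis unfolding zero_object_iff using ZO by simp
qed

lemma zero_mor_P:
  assumes "zero_mor C A B f" "A \<in> Obj C" "B \<in> Obj C"
  shows "zero_mor L A B (Fm P A B f)"
proof -
  obtain Z g h where Z: "zero_object C Z" "g \<in> Hom C A Z" "h \<in> Hom C Z B" "f = Cmp C A Z B h g"
    using assms(1) unfolding zero_mor_def by blast
  have ZO: "Z \<in> Obj C" using Z unfolding zero_object_def by blast
  show ?thesis
    unfolding zero_mor_def
    using zero_object_L[OF Z(1)] P_Hom[OF assms(2) ZO Z(2)] P_Hom[OF ZO assms(3) Z(3)]
      P_Cmp[OF assms(2) ZO assms(3) Z(2,3)] Z(4) by blast
qed

text \<open>The zero map through \<open>Z\<close> goes to a zero map of \<open>L\<close>, and those
  are unique, so injectivity identifies \<open>f\<close> with it.\<close>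

lemma zero_mor_P_reflect:
  assumes Z: "\<exists>Z. zero_object C Z" and h: "A \<in> Obj C" "B \<in> Obj C" "f \<in> Hom C A B"
    and inj: "inj_on (Fm P A B) (Hom C A B)" and z: "zero_mor L A B (Fm P A B f)"
  shows "zero_mor C A B f"
proof -
  obtain Z where Z: "zero_object C Z" using assms(1) by blast
  have ZO: "Z \<in> Obj C" using Z unfolding zero_object_def by blast
  obtain u v where o: "u \<in> Hom C A Z" "v \<in> Hom C Z B" "zero_mor C A B (Cmp C A Z B v u)"
    using zero_mor_exists[OF Z h(1,2)] by blast
  have "Fm P A B f = Fm P A B (Cmp C A Z B v u)"
    using zero_mor_unique[OF category_L _ _ z zero_mor_P[OF o(3) h(1,2)]] h by simp
  then have "f = Cmp C A Z B v u"
    using inj h(3) Cmp_in_Hom[OF h(1) ZO h(2) o(1,2)] unfolding inj_on_def by blast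
  then show ?thesis using o(3) by simp
qed

text \<open>Testing with maps out of \<open>W\<close> amounts to testing with maps out of
  \<open>r W\<close>; these are maps of \<open>C\<close>, where the given kernel applies.\<close>

lemma preserves_kernels_P:
  assumes Z: "\<exists>Z. zero_object C Z"
  shows "preserves_kernels C L P"
  unfolding preserves_kernels_def
proof (intro allI impI)
  fix A B f K k assume "is_kernel C A B f K k"
  then have h: "A \<in> Obj C" "B \<in> Obj C" "f \<in> Hom C A B" "K \<in> Obj C" "k \<in> Hom C K A"
    and fk: "zero_mor C K B (Cmp C K A B f k)"
    and univ: "\<And>W w. \<lbrakk>W \<in> Obj C; w \<in> Hom C W A; zero_mor C W B (Cmp C W A B f w)\<rbrakk>
        \<Longrightarrow> \<exists>!u. u \<in> Hom C W K \<and> Cmp C W K A k u = w"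
    unfolding is_kernel_def by blast+
  note Pf = P_Hom[OF h(1-3)] and Pk = P_Hom[OF h(4,1,5)]
  have hL: "A \<in> Obj L" "B \<in> Obj L" "K \<in> Obj L" using h by simp_all
  have "zero_mor L K B (Cmp L K A B (Fm P A B f) (Fm P K A k))"
    using zero_mor_P[OF fk h(4,2)] P_Cmp[OF h(4,1,2,5,3)] by simp
  moreover have "\<exists>!u. u \<in> Hom L W K \<and> Cmp L W K A (Fm P K A k) u = w"
    if W: "W \<in> Obj L" and w: "w \<in> Hom L W A" and z: "zero_mor L W B (Cmp L W A B (Fm P A B f) w)" for W w
  proof -
    have WO: "W \<in> Obj C" "r W \<in> Obj C" and WL: "W \<in> Obj L" "r W \<in> Obj L"
      using W r_Obj by simp_all
    note co = colocal_r[OF WO(1)] and g = P\<gamma>_Hom[OF WO(1)] and gi = P\<gamma>_inv_Hom[OF WO(1)]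
    note can = L.Cmp_inv_mor_cancel[OF P\<gamma>_iso[OF WO(1)] _ WL(2,1)]
    \<comment> \<open>Composition with the isomorphism \<open>P\<gamma> W\<close> turns maps of
      \<open>L\<close> out of \<open>W\<close> into images of maps of \<open>C\<close>.\<close>
    have lift: "\<exists>v\<in>Hom C (r W) D. Fm P (r W) D v = Cmp L (r W) W D x (P\<gamma> W)"
      if "x \<in> Hom L W D" "D \<in> Obj C" for x D
      using P_surj_colocal[OF co] L.Cmp_in_Hom[OF WL(2,1) _ g that(1)] that(2) by (metis L_Obj)
    obtain w' where w': "w' \<in> Hom C (r W) A" "Fm P (r W) A w' = Cmp L (r W) W A w (P\<gamma> W)"
      using lift[OF w h(1)] by blast
    have "Fm P (r W) B (Cmp C (r W) A B f w') = Cmp L (r W) W B (Cmp L W A B (Fm P A B f) w) (P\<gamma> W)"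
      using P_Cmp[OF WO(2) h(1,2) w'(1) h(3)] w'(2) L.Cmp_assoc[OF WL(2,1) hL(1,2) g w Pf] by simp
    then have "zero_mor L (r W) B (Fm P (r W) B (Cmp C (r W) A B f w'))"
      using zero_mor_Cmp(2)[OF category_L WL(2,1) hL(2) z g] by simp
    then have "zero_mor C (r W) B (Cmp C (r W) A B f w')"
      by (rule zero_mor_P_reflect[OF Z WO(2) h(2) Cmp_in_Hom[OF WO(2) h(1,2) w'(1) h(3)]
            P_inj_on_colocal[OF co h(2)]])
    note u' = univ[OF WO(2) w'(1) this]
    obtain u where u: "u \<in> Hom C (r W) K" "Cmp C (r W) K A k u = w'" using u' by blast
    note Pu = P_Hom[OF WO(2) h(4) u(1)]
    let ?u = "Cmp L W (r W) K (Fm P (r W) K u) (P\<gamma>_inv W)"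
    show ?thesis
    proof (rule ex1I[of _ ?u])
      have "Cmp L W K A (Fm P K A k) ?u = Cmp L W (r W) A (Fm P (r W) A w') (P\<gamma>_inv W)"
        using L.Cmp_assoc[OF WL hL(3,1) gi Pu Pk] P_Cmp[OF WO(2) h(4,1) u(1) h(5)] u(2) by simp
      also have "\<dots> = w" using can(2)[OF hL(1) w] w'(2) by simp
      finally show "?u \<in> Hom L W K \<and> Cmp L W K A (Fm P K A k) ?u = w"
        using L.Cmp_in_Hom[OF WL hL(3) gi Pu] by blast
      fix v assume v: "v \<in> Hom L W K \<and> Cmp L W K A (Fm P K A k) v = w"
      obtain v' where v': "v' \<in> Hom C (r W) K" "Fm P (r W) K v' = Cmp L (r W) W K v (P\<gamma> W)"
        using lift v h(4) by blast
      have "Fm P (r W) A (Cmp C (r W) K A k v') = Fm P (r W) A w'"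
        using P_Cmp[OF WO(2) h(4,1) v'(1) h(5)] v' w'(2) v
          L.Cmp_assoc[OF WL(2,1) hL(3,1) g _ Pk, of v] by simp
      then have "Cmp C (r W) K A k v' = w'"
        using P_inj_on_colocal[OF co h(1)] w'(1) Cmp_in_Hom[OF WO(2) h(4,1) v'(1) h(5)]
        unfolding inj_on_def by blast
      then have "v' = u" using u' u v'(1) by blast
      then show "v = ?u" using can(2)[OF hL(3), of v] v v'(2) by simp
    qed
  qed
  ultimately have "is_kernel L A B (Fm P A B f) K (Fm P K A k)"
    unfolding is_kernel_def using hL Pf Pk by blast
  then show "is_kernel L (Fo P A) (Fo P B) (Fm P A B f) (Fo P K) (Fm P K A k)" by simp
qed

text \<open>The test object is now the target, where \<open>r\<close> is of no help. A test map is
  written as a left fraction and the given cokernel is applied to its numerator; faithfulness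
  reflects vanishing and equality back to \<open>C\<close>.\<close>

lemma preserves_cokernels_P:
  assumes Z: "\<exists>Z. zero_object C Z" and lf: "left_fractions C R" and faith: "faithful C L P"
  shows "preserves_cokernels C L P"
  unfolding preserves_cokernels_def
proof (intro allI impI)
  fix A B f Q q assume "is_cokernel C A B f Q q"
  then have h: "A \<in> Obj C" "B \<in> Obj C" "f \<in> Hom C A B" "Q \<in> Obj C" "q \<in> Hom C B Q"
    and qf: "zero_mor C A Q (Cmp C A B Q q f)"
    and univ: "\<And>W w. \<lbrakk>W \<in> Obj C; w \<in> Hom C B W; zero_mor C A W (Cmp C A B W w f)\<rbrakk>
        \<Longrightarrow> \<exists>!u. u \<in> Hom C Q W \<and> Cmp C B Q W u q = w"
    unfolding is_cokernel_iff by blast+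
  note Pf = P_Hom[OF h(1-3)] and Pq = P_Hom[OF h(2,4,5)]
  have hL: "A \<in> Obj L" "B \<in> Obj L" "Q \<in> Obj L" using h by simp_all
  have inj: "inj_on (Fm P D E) (Hom C D E)" if "D \<in> Obj C" "E \<in> Obj C" for D E
    using faith that unfolding faithful_def by blast
  \<comment> \<open>A cokernel is epic: both maps solve the universal problem for the same composite
    with \<open>q\<close>.\<close>
  have q_epi: "u = v" if "W \<in> Obj C" "u \<in> Hom C Q W" "v \<in> Hom C Q W"
    "Cmp C B Q W u q = Cmp C B Q W v q" for W u v
  proof -
    have "zero_mor C A W (Cmp C A B W (Cmp C B Q W u q) f)"
      using zero_mor_Cmp(1)[OF category_axioms h(1,4) that(1) qf that(2)]
        Cmp_assoc[OF h(1,2,4) that(1) h(3,5) that(2)] by simp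
    from univ[OF that(1) Cmp_in_Hom[OF h(2,4) that(1) h(5) that(2)] this]
    show ?thesis using that by metis
  qed
  have fr: "\<exists>W'\<in>Obj C. \<exists>s\<in>R W W'. \<exists>g\<in>Hom C D W'. Cmp L D W W' (Fm P W W' s) w = Fm P D W' g"
    if "w \<in> Hom L D W" "D \<in> Obj C" for D W w
    by (rule L_left_fraction[OF lf that])
  have "zero_mor L A Q (Cmp L A B Q (Fm P B Q q) (Fm P A B f))"
    using zero_mor_P[OF qf h(1,4)] P_Cmp[OF h(1,2,4,3,5)] by simp
  moreover have "\<exists>!u. u \<in> Hom L Q W \<and> Cmp L B Q W u (Fm P B Q q) = w"
    if W: "W \<in> Obj L" and w: "w \<in> Hom L B W" and z: "zero_mor L A W (Cmp L A B W w (Fm P A B f))" for W w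
  proof -
    have WO: "W \<in> Obj C" using W by simp
    obtain V s g where V: "V \<in> Obj C" "s \<in> R W V" "g \<in> Hom C B V"
      and sg: "Cmp L B W V (Fm P W V s) w = Fm P B V g"
      using fr[OF w h(2)] by blast
    have VL: "V \<in> Obj L" using V by simp
    note i = P_iso(1)[OF WO V(1,2)]
    note Ps = inv_mor(1)[OF i] and Pi = inv_mor(2)[OF i]
    have "Fm P A V (Cmp C A B V g f) = Cmp L A W V (Fm P W V s) (Cmp L A B W w (Fm P A B f))"
      using P_Cmp[OF h(1,2) V(1) h(3) V(3)] sg L.Cmp_assoc[OF hL(1,2) W VL Pf w Ps] by simp
    then have "zero_mor L A V (Fm P A V (Cmp C A B V g f))"
      using zero_mor_Cmp(1)[OF category_L hL(1) W VL z Ps] by simp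
    then have "zero_mor C A V (Cmp C A B V g f)"
      by (rule zero_mor_P_reflect[OF Z h(1) V(1) Cmp_in_Hom[OF h(1,2) V(1) h(3) V(3)] inj[OF h(1) V(1)]])
    from univ[OF V(1,3) this]
    obtain u where u: "u \<in> Hom C Q V" "Cmp C B Q V u q = g" by blast
    note Pu = P_Hom[OF h(4) V(1) u(1)]
    let ?u = "Cmp L Q V W (inv_mor L W V (Fm P W V s)) (Fm P Q V u)"
    have u1: "?u \<in> Hom L Q W" using L.Cmp_in_Hom[OF hL(3) VL W Pu Pi] .
    have "Cmp L B Q W ?u (Fm P B Q q) = Cmp L B V W (inv_mor L W V (Fm P W V s)) (Fm P B V g)"
      using L.Cmp_assoc[OF hL(2,3) VL W Pq Pu Pi] P_Cmp[OF h(2,4) V(1) h(5) u(1)] u(2) by simp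
    also have "\<dots> = w"
      using L.inv_mor_Cmp_cancel(1)[OF i hL(2) W VL w] sg by simp
    finally have u2: "Cmp L B Q W ?u (Fm P B Q q) = w" .
    have uniq: "v = v'" if v: "v \<in> Hom L Q W" and v': "v' \<in> Hom L Q W"
      and eq: "Cmp L B Q W v (Fm P B Q q) = Cmp L B Q W v' (Fm P B Q q)" for v v'
    proof -
      obtain V1 s1 g1 where V1: "V1 \<in> Obj C" "s1 \<in> R W V1" "g1 \<in> Hom C Q V1"
        and sg1: "Cmp L Q W V1 (Fm P W V1 s1) v = Fm P Q V1 g1"
        using fr[OF v h(4)] by blast
      have V1L: "V1 \<in> Obj L" using V1 by simp
      note i1 = P_iso(1)[OF WO V1(1,2)]
      note Ps1 = inv_mor(1)[OF i1]
      \<comment> \<open>Clearing the denominator of \<open>s1 v'\<close> puts \<open>v\<close> and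
        \<open>v'\<close> over the common denominator \<open>s2 s1\<close>, with numerators
        \<open>s2 g1\<close> and \<open>g2\<close>.\<close>
      obtain V2 s2 g2 where V2: "V2 \<in> Obj C" "s2 \<in> R V1 V2" "g2 \<in> Hom C Q V2"
        and sg2: "Cmp L Q V1 V2 (Fm P V1 V2 s2) (Cmp L Q W V1 (Fm P W V1 s1) v') = Fm P Q V2 g2"
        using fr[OF L.Cmp_in_Hom[OF hL(3) W V1L v' Ps1] h(4)] by blast
      have V2L: "V2 \<in> Obj L" using V2 by simp
      note i2 = P_iso(1)[OF V1(1) V2(1,2)]
      note Ps2 = inv_mor(1)[OF i2] and s2 = R_Hom[OF V1(1) V2(1,2)]
      have sg1': "Cmp L Q V1 V2 (Fm P V1 V2 s2) (Cmp L Q W V1 (Fm P W V1 s1) v) =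
          Fm P Q V2 (Cmp C Q V1 V2 s2 g1)"
        using sg1 P_Cmp[OF h(4) V1(1) V2(1) V1(3) s2] by simp
      note g1' = Cmp_in_Hom[OF h(4) V1(1) V2(1) V1(3) s2]
      have push: "Cmp L B Q V2 (Cmp L Q V1 V2 (Fm P V1 V2 s2) (Cmp L Q W V1 (Fm P W V1 s1) x)) (Fm P B Q q) =
          Cmp L B V1 V2 (Fm P V1 V2 s2) (Cmp L B W V1 (Fm P W V1 s1) (Cmp L B Q W x (Fm P B Q q)))"
        if "x \<in> Hom L Q W" for x
        using L.Cmp_assoc[OF hL(2,3) V1L V2L Pq L.Cmp_in_Hom[OF hL(3) W V1L that Ps1] Ps2]
          L.Cmp_assoc[OF hL(2,3) W V1L Pq that Ps1] by simp
      have "Fm P B V2 (Cmp C B Q V2 (Cmp C Q V1 V2 s2 g1) q) = Fm P B V2 (Cmp C B Q V2 g2 q)"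
        using push[OF v] push[OF v'] eq sg1' sg2
          P_Cmp[OF h(2,4) V2(1) h(5) g1'] P_Cmp[OF h(2,4) V2(1) h(5) V2(3)] by simp
      then have "Cmp C B Q V2 (Cmp C Q V1 V2 s2 g1) q = Cmp C B Q V2 g2 q"
        using inj[OF h(2) V2(1)] Cmp_in_Hom[OF h(2,4) V2(1) h(5) g1']
          Cmp_in_Hom[OF h(2,4) V2(1) h(5) V2(3)] unfolding inj_on_def by blast
      then have "Cmp C Q V1 V2 s2 g1 = g2" by (rule q_epi[OF V2(1) g1' V2(3)])
      then have "Cmp L Q V1 V2 (Fm P V1 V2 s2) (Cmp L Q W V1 (Fm P W V1 s1) v) =
          Cmp L Q V1 V2 (Fm P V1 V2 s2) (Cmp L Q W V1 (Fm P W V1 s1) v')"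
        using sg1' sg2 by simp
      then have "Cmp L Q W V1 (Fm P W V1 s1) v = Cmp L Q W V1 (Fm P W V1 s1) v'"
        by (rule L.iso_cancel_left[OF hL(3) V1L V2L i2 L.Cmp_in_Hom[OF hL(3) W V1L v Ps1]
              L.Cmp_in_Hom[OF hL(3) W V1L v' Ps1]])
      then show "v = v'" by (rule L.iso_cancel_left[OF hL(3) W V1L i1 v v'])
    qed
    show ?thesis using u1 u2 uniq by metis
  qed
  ultimately have "is_cokernel L A B (Fm P A B f) Q (Fm P B Q q)"
    unfolding is_cokernel_iff using hL Pf Pq by blast
  then show "is_cokernel L (Fo P A) (Fo P B) (Fm P A B f) (Fo P Q) (Fm P B Q q)" by simp
qed

text \<open>The induced functor on \<open>L\<close> agrees with \<open>F\<close> on the maps of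
  \<open>C\<close> out of \<open>r A\<close>; the isomorphism \<open>P\<gamma> A\<close> then
  carries full faithfulness over to maps out of \<open>A\<close>.\<close>

lemma induced_equivalence:
  assumes D: "category D" and F: "is_functor C D F" and inv: "inverts C R D F"
    and bij: "\<And>A B. \<lbrakk>A \<in> Obj C; B \<in> Obj C\<rbrakk> \<Longrightarrow>
      bij_betw (Fm F (r A) B) (Hom C (r A) B) (Hom D (Fo F (r A)) (Fo F B))"
    and es: "\<And>B. B \<in> Obj D \<Longrightarrow> \<exists>A\<in>Obj C. \<exists>e. iso_mor D (Fo F A) B e"
  shows "equivalent_cats L D"
proof -
  interpret D: category D by (rule D)
  obtain G where G: "is_functor L D G" and GP: "cfun_eq C (comp_cfun G P) F"
    using lift_to_L[OF D F inv] by blast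
  have GO: "Fo G A = Fo F A" if "A \<in> Obj C" for A
    using GP that by (simp add: cfun_eq_def comp_cfun_def)
  have GM: "Fm G A B (Fm P A B f) = Fm F A B f" if "A \<in> Obj C" "B \<in> Obj C" "f \<in> Hom C A B" for A B f
    using GP that by (simp add: cfun_eq_def comp_cfun_def)
  have "bij_betw (Fm G A B) (Hom L A B) (Hom D (Fo G A) (Fo G B))" if A: "A \<in> Obj C" and B: "B \<in> Obj C" for A B
  proof -
    note rA = r_Obj[OF A]
    have OL: "A \<in> Obj L" "B \<in> Obj L" "r A \<in> Obj L" using A B rA by simp_all
    note OD = is_functorD(1)[OF G OL(1)] is_functorD(1)[OF G OL(2)] is_functorD(1)[OF G OL(3)]
    note Pg = P\<gamma>_iso[OF A]
    note Gg = functor_iso(1)[OF G OL(3,1) Pg]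
    have 1: "bij_betw (\<lambda>w. Cmp L (r A) A B w (P\<gamma> A)) (Hom L A B) (Hom L (r A) B)"
      by (rule L.iso_comp_bij_right[OF OL(2,3,1) Pg])
    have "bij_betw (Fm G (r A) B \<circ> Fm P (r A) B) (Hom C (r A) B) (Hom D (Fo G (r A)) (Fo G B))"
      using bij[OF A B] GO[OF rA] GO[OF B] GM[OF rA B]
        bij_betw_cong[of "Hom C (r A) B" "Fm G (r A) B \<circ> Fm P (r A) B" "Fm F (r A) B"] by simp
    then have 2: "bij_betw (Fm G (r A) B) (Hom L (r A) B) (Hom D (Fo G (r A)) (Fo G B))"
      using bij_betw_comp_iff[OF P_bij_colocal[OF colocal_r[OF A] B]] by blast
    let ?k = "\<lambda>v. Cmp D (Fo G (r A)) (Fo G A) (Fo G B) v (Fm G (r A) A (P\<gamma> A))"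
    have 3: "bij_betw ?k (Hom D (Fo G A) (Fo G B)) (Hom D (Fo G (r A)) (Fo G B))"
      by (rule D.iso_comp_bij_right[OF OD(2,3,1) Gg])
    have eq: "?k (Fm G A B w) = Fm G (r A) B (Cmp L (r A) A B w (P\<gamma> A))" if "w \<in> Hom L A B" for w
      using is_functorD(4)[OF G OL(3,1,2) P\<gamma>_Hom[OF A] that] by simp
    have "bij_betw (?k \<circ> Fm G A B) (Hom L A B) (Hom D (Fo G (r A)) (Fo G B))"
      using bij_betw_trans[OF 1 2] eq
        bij_betw_cong[of "Hom L A B" "?k \<circ> Fm G A B" "Fm G (r A) B \<circ> (\<lambda>w. Cmp L (r A) A B w (P\<gamma> A))"]
      by simp
    moreover have "Fm G A B ` Hom L A B \<subseteq> Hom D (Fo G A) (Fo G B)"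
      using is_functorD(2)[OF G OL(1,2)] by blast
    ultimately show ?thesis using bij_betw_comp_iff2[OF 3] by blast
  qed
  then have "fully_faithful L D G" unfolding fully_faithful_def by simp
  moreover have "\<exists>A\<in>Obj L. \<exists>e. iso_mor D (Fo G A) B e" if "B \<in> Obj D" for B
    using es[OF that] GO by auto
  ultimately have "is_equivalence L D G"
    by (rule equivalence_if_fully_faithful[OF category_L D G])
  then show ?thesis unfolding equivalent_cats_def by blast
qed

end

section \<open>Exactness in triangulated categories\<close>

lemma equivalence_ess_surj:
  assumes "is_equivalence C D F" "B \<in> Obj D"
  obtains A e where "A \<in> Obj C" "iso_mor D (Fo F A) B e"
proof -
  obtain G where G: "is_functor D C G" "nat_isomorphic D D (comp_cfun F G) id_cfun"
    using assms(1) unfolding is_equivalence_def by blast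
  obtain \<alpha> where "\<And>B. B \<in> Obj D \<Longrightarrow> iso_mor D (Fo F (Fo G B)) B (\<alpha> B)"
    using G(2) unfolding nat_isomorphic_def by (auto simp: comp_cfun_def id_cfun_def)
  then show ?thesis using that is_functorD(1)[OF G(1)] assms(2) by blast
qed

lemma (in group) mult_inv_eq_one_iff:
  assumes "x \<in> carrier G" "y \<in> carrier G"
  shows "x \<otimes> inv y = \<one> \<longleftrightarrow> x = y"
proof
  assume "x \<otimes> inv y = \<one>"
  then have "inv (inv y) = x" by (rule inv_equality) (use assms in simp_all)
  then show "x = y" using assms by simp
qed (use assms in simp)

section \<open>Additive calculus on hom-groups\<close>

context additive_category
begin

abbreviation Neg where
  "Neg A B f \<equiv> inv\<^bsub>hom_group C A B\<^esub> f"

lemma hom_group_simps [simp]: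
  "carrier (hom_group C A B) = Hom C A B"
  "mult (hom_group C A B) = Add C A B"
  "one (hom_group C A B) = Zero C A B"
  by (simp_all add: hom_group_def)

lemma hom_group_group: "\<lbrakk>A \<in> Obj C; B \<in> Obj C\<rbrakk> \<Longrightarrow> group (hom_group C A B)"
  using hom_comm_group comm_group.axioms(2) by blast

context
  fixes A B assumes AB: "A \<in> Obj C" "B \<in> Obj C"
begin

interpretation G: comm_group "hom_group C A B" using hom_comm_group AB by blast

lemma Zero_Hom: "Zero C A B \<in> Hom C A B"
  using G.one_closed by simp

lemma Add_Hom: "\<lbrakk>f \<in> Hom C A B; g \<in> Hom C A B\<rbrakk> \<Longrightarrow> Add C A B f g \<in> Hom C A B"
  using G.m_closed by simp

lemma Neg_Hom: "f \<in> Hom C A B \<Longrightarrow> Neg A B f \<in> Hom C A B"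
  using G.inv_closed by simp

lemma Add_Zero:
  "f \<in> Hom C A B \<Longrightarrow> Add C A B f (Zero C A B) = f"
  "f \<in> Hom C A B \<Longrightarrow> Add C A B (Zero C A B) f = f"
  using G.r_one G.l_one by simp_all

lemma Add_Neg:
  "f \<in> Hom C A B \<Longrightarrow> Add C A B f (Neg A B f) = Zero C A B"
  "f \<in> Hom C A B \<Longrightarrow> Add C A B (Neg A B f) f = Zero C A B"
  using G.r_inv G.l_inv by simp_all

lemma Add_eq_selfD: "\<lbrakk>f \<in> Hom C A B; Add C A B f f = f\<rbrakk> \<Longrightarrow> f = Zero C A B"
  using G.r_cancel_one' by fastforce

lemma Neg_unique:
  "\<lbrakk>f \<in> Hom C A B; g \<in> Hom C A B; Add C A B g f = Zero C A B\<rbrakk> \<Longrightarrow> Neg A B f = g"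
  using G.inv_equality by simp

lemma Neg_Neg: "f \<in> Hom C A B \<Longrightarrow> Neg A B (Neg A B f) = f"
  using G.inv_inv by simp

lemma Neg_Zero: "Neg A B (Zero C A B) = Zero C A B"
  using G.inv_one by simp

lemma Neg_eq_Zero: "f \<in> Hom C A B \<Longrightarrow> Neg A B f = Zero C A B \<longleftrightarrow> f = Zero C A B"
  using Neg_Neg[of f] Neg_Zero by metis

lemma Add_Neg_eq_Zero:
  "\<lbrakk>f \<in> Hom C A B; g \<in> Hom C A B\<rbrakk> \<Longrightarrow> Add C A B f (Neg A B g) = Zero C A B \<longleftrightarrow> f = g"
  using G.mult_inv_eq_one_iff by simp

end

context
  fixes A B D assumes ABD: "A \<in> Obj C" "B \<in> Obj C" "D \<in> Obj C"
begin

lemma Cmp_Zero_right: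
  assumes g: "g \<in> Hom C B D"
  shows "Cmp C A B D g (Zero C A B) = Zero C A D"
proof -
  note z = Zero_Hom[OF ABD(1,2)]
  show ?thesis
    using Cmp_Add_right[OF ABD z z g] Add_Zero(1)[OF ABD(1,2) z]
      Add_eq_selfD[OF ABD(1,3) Cmp_in_Hom[OF ABD z g]] by simp
qed

lemma Cmp_Zero_left:
  assumes f: "f \<in> Hom C A B"
  shows "Cmp C A B D (Zero C B D) f = Zero C A D"
proof -
  note z = Zero_Hom[OF ABD(2,3)]
  show ?thesis
    using Cmp_Add_left[OF ABD f z z] Add_Zero(1)[OF ABD(2,3) z]
      Add_eq_selfD[OF ABD(1,3) Cmp_in_Hom[OF ABD f z]] by simp
qed

lemma Cmp_Neg_left:
  assumes "f \<in> Hom C A B" "g \<in> Hom C B D"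
  shows "Cmp C A B D (Neg B D g) f = Neg A D (Cmp C A B D g f)"
  using Cmp_Add_left[OF ABD assms(1) Neg_Hom[OF ABD(2,3) assms(2)] assms(2)]
    Add_Neg(2)[OF ABD(2,3) assms(2)] Cmp_Zero_left[OF assms(1)]
    Neg_unique[OF ABD(1,3) Cmp_in_Hom[OF ABD assms]
      Cmp_in_Hom[OF ABD assms(1) Neg_Hom[OF ABD(2,3) assms(2)]]] by simp

lemma Cmp_Neg_right:
  assumes "f \<in> Hom C A B" "g \<in> Hom C B D"
  shows "Cmp C A B D g (Neg A B f) = Neg A D (Cmp C A B D g f)"
  using Cmp_Add_right[OF ABD Neg_Hom[OF ABD(1,2) assms(1)] assms(1,2)]
    Add_Neg(2)[OF ABD(1,2) assms(1)] Cmp_Zero_right[OF assms(2)]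
    Neg_unique[OF ABD(1,3) Cmp_in_Hom[OF ABD assms]
      Cmp_in_Hom[OF ABD Neg_Hom[OF ABD(1,2) assms(1)] assms(2)]] by simp

end

lemma Cmp_inj_onI:
  assumes "W \<in> Obj C" "A \<in> Obj C" "B \<in> Obj C" "s \<in> Hom C A B"
    and ker: "\<And>x. \<lbrakk>x \<in> Hom C W A; Cmp C W A B s x = Zero C W B\<rbrakk> \<Longrightarrow> x = Zero C W A"
  shows "inj_on (\<lambda>x. Cmp C W A B s x) (Hom C W A)"
proof (rule inj_onI)
  fix x y assume x: "x \<in> Hom C W A" "y \<in> Hom C W A" and eq: "Cmp C W A B s x = Cmp C W A B s y"
  note n = Neg_Hom[OF assms(1,2) x(2)]
  have "Cmp C W A B s (Add C W A x (Neg W A y)) = Zero C W B"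
    using Cmp_Add_right[OF assms(1-3) x(1) n assms(4)] Cmp_Neg_right[OF assms(1-3) x(2) assms(4)] eq
      Add_Neg(1)[OF assms(1,3) Cmp_in_Hom[OF assms(1-3) x(2) assms(4)]] by simp
  then have "Add C W A x (Neg W A y) = Zero C W A"
    by (rule ker[OF Add_Hom[OF assms(1,2) x(1) n]])
  then show "x = y" using Add_Neg_eq_Zero[OF assms(1,2) x] by blast
qed

text \<open>An equational form of being zero, which an additive functor such as the shift
  preserves.\<close>

lemma zero_object_Idn_iff:
  assumes A: "A \<in> Obj C"
  shows "zero_object C A \<longleftrightarrow> Idn C A = Zero C A A"
proof
  assume "zero_object C A"
  then obtain x where "Hom C A A = {x}" using A unfolding zero_object_iff by blast
  then show "Idn C A = Zero C A A" using Idn_in_Hom[OF A] Zero_Hom[OF A A] by auto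
next
  assume z: "Idn C A = Zero C A A"
  have "Hom C B A = {Zero C B A}" if B: "B \<in> Obj C" for B
  proof -
    have "f = Zero C B A" if "f \<in> Hom C B A" for f
      using Cmp_Idn_left[OF B A that] Cmp_Zero_left[OF B A A that] z by simp
    then show ?thesis using Zero_Hom[OF B A] by blast
  qed
  moreover have "Hom C A B = {Zero C A B}" if B: "B \<in> Obj C" for B
  proof -
    have "f = Zero C A B" if "f \<in> Hom C A B" for f
      using Cmp_Idn_right[OF A B that] Cmp_Zero_right[OF A A B that] z by simp
    then show ?thesis using Zero_Hom[OF A B] by blast
  qed
  ultimately show "zero_object C A" unfolding zero_object_iff using A by blast
qed

end

section \<open>Weak kernels and weak cokernels from triangles\<close>

context triangulated_category
begin

abbreviation Sh where "Sh A \<equiv> Fo (Shift T) A"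
abbreviation Shm where "Shm A B f \<equiv> Fm (Shift T) A B f"

lemma Shift_functor: "is_functor T T (Shift T)"
  using Shift_equivalence unfolding is_equivalence_def by blast

lemmas Sh_Obj = is_functorD(1)[OF Shift_functor]
  and Sh_Hom = is_functorD(2)[OF Shift_functor]
  and Sh_Idn = is_functorD(3)[OF Shift_functor]
  and Sh_Cmp = is_functorD(4)[OF Shift_functor]

lemma Sh_bij:
  "\<lbrakk>A \<in> Obj T; B \<in> Obj T\<rbrakk> \<Longrightarrow> bij_betw (Shm A B) (Hom T A B) (Hom T (Sh A) (Sh B))"
  using equivalence_fully_faithful[OF category_axioms category_axioms Shift_equivalence]
  unfolding fully_faithful_def by blast

lemma Sh_full:
  assumes "A \<in> Obj T" "B \<in> Obj T" "h \<in> Hom T (Sh A) (Sh B)"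
  obtains f where "f \<in> Hom T A B" "h = Shm A B f"
  using Sh_bij[OF assms(1,2)] assms(3) unfolding bij_betw_def by blast

lemma Sh_faithful:
  assumes "A \<in> Obj T" "B \<in> Obj T" "f \<in> Hom T A B" "g \<in> Hom T A B" "Shm A B f = Shm A B g"
  shows "f = g"
  using Sh_bij[OF assms(1,2)] assms(3-5) unfolding bij_betw_def inj_on_def by blast

lemma Sh_Zero:
  assumes "A \<in> Obj T" "B \<in> Obj T"
  shows "Shm A B (Zero T A B) = Zero T (Sh A) (Sh B)"
  using Shift_Add[OF assms Zero_Hom[OF assms] Zero_Hom[OF assms]]
    Add_Zero(1)[OF assms Zero_Hom[OF assms]]
    Add_eq_selfD[OF Sh_Obj[OF assms(1)] Sh_Obj[OF assms(2)] Sh_Hom[OF assms Zero_Hom[OF assms]]]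
  by simp

lemma Sh_zero_object:
  assumes "zero_object T Z"
  shows "zero_object T (Sh Z)"
proof -
  have Z: "Z \<in> Obj T" using assms unfolding zero_object_def by blast
  show ?thesis
    using assms zero_object_Idn_iff[OF Z] zero_object_Idn_iff[OF Sh_Obj[OF Z]] Sh_Idn[OF Z]
      Sh_Zero[OF Z Z] by simp
qed

lemma TriD:
  assumes "Tri T A B D f g h"
  shows "A \<in> Obj T" "B \<in> Obj T" "D \<in> Obj T" "f \<in> Hom T A B" "g \<in> Hom T B D" "h \<in> Hom T D (Sh A)"
  using Tri_triangle[OF assms] unfolding triangle_def by blast+

lemma Tri_rotate:
  "Tri T A B D f g h \<Longrightarrow> Tri T B D (Sh A) g h (Neg (Sh A) (Sh B) (Shm A B f))"
  using TR2[OF Tri_triangle] by blast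

text \<open>TR3 maps the trivial triangle on \<open>A\<close> to the given one, starting from
  \<open>Idn T A\<close> and \<open>f\<close>; the next square shows that \<open>g f\<close> factors
  through a zero map.\<close>

lemma Tri_Cmp_zero:
  assumes t: "Tri T A B D f g h"
  shows "Cmp T A B D g f = Zero T A D"
proof -
  obtain Z where Z: "zero_object T Z" using zero_object_exists by blast
  then have ZO: "Z \<in> Obj T" unfolding zero_object_def by blast
  note d = TriD[OF t]
  obtain e where e: "triangle_morphism T A A Z (Idn T A) (Zero T A Z) (Zero T Z (Sh A)) A B D f g h (Idn T A) f e"
    using TR3[OF TR1_Idn[OF d(1) Z] t Idn_in_Hom[OF d(1)] d(4)] by blast
  then have "e \<in> Hom T Z D" "Cmp T A Z D e (Zero T A Z) = Cmp T A B D g f"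
    unfolding triangle_morphism_def by blast+
  then show ?thesis using Cmp_Zero_right[OF d(1) ZO d(3)] by simp
qed

text \<open>Since \<open>v\<close> kills \<open>f\<close>, the maps \<open>0\<close> and
  \<open>v\<close> start a morphism to the triangle
  \<open>0 \<rightarrow> W \<rightarrow> W\<close>, and its third component from TR3 is the
  factorization.\<close>

lemma Tri_weak_cokernel:
  assumes t: "Tri T A B D f g h" and W: "W \<in> Obj T" and v: "v \<in> Hom T B W"
    and z: "Cmp T A B W v f = Zero T A W"
  obtains u where "u \<in> Hom T D W" "v = Cmp T B D W u g"
proof -
  obtain Z where Z: "zero_object T Z" using zero_object_exists by blast
  then have ZO: "Z \<in> Obj T" unfolding zero_object_def by blast
  note d = TriD[OF t] and SZ = Sh_zero_object[OF Z]
  have zz: "Zero T Z W \<in> Hom T Z W" "Zero T W (Sh Z) \<in> Hom T W (Sh Z)"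
    using Zero_Hom ZO W Sh_Obj by blast+
  have "Neg (Sh Z) (Sh W) (Shm Z W (Zero T Z W)) = Zero T (Sh Z) (Sh W)"
    using Sh_Zero[OF ZO W] Neg_Zero[OF Sh_Obj[OF ZO] Sh_Obj[OF W]] by simp
  \<comment> \<open>The triangle \<open>0 \<rightarrow> W \<rightarrow> W\<close> is obtained by
    rotating \<open>W \<rightarrow> W \<rightarrow> 0\<close> backwards. For this the last zero
    object has to be the shift of \<open>Z\<close>.\<close>
  then have r: "Tri T W W (Sh Z) (Idn T W) (Zero T W (Sh Z))
      (Neg (Sh Z) (Sh W) (Shm Z W (Zero T Z W)))"
    using TR1_Idn[OF W SZ] by simp
  have "triangle T Z W W (Zero T Z W) (Idn T W) (Zero T W (Sh Z))"
    unfolding triangle_def using zz ZO W Idn_in_Hom by blast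
  then have t': "Tri T Z W W (Zero T Z W) (Idn T W) (Zero T W (Sh Z))"
    using TR2 r by blast
  have "Cmp T A B W v f = Cmp T A Z W (Zero T Z W) (Zero T A Z)"
    using z Cmp_Zero_left[OF d(1) ZO W Zero_Hom[OF d(1) ZO]] by simp
  then obtain e where "triangle_morphism T A B D f g h Z W W (Zero T Z W) (Idn T W) (Zero T W (Sh Z))
      (Zero T A Z) v e"
    using TR3[OF t t' Zero_Hom[OF d(1) ZO] v] by blast
  then have "e \<in> Hom T D W" "Cmp T B D W e g = Cmp T B W W (Idn T W) v"
    unfolding triangle_morphism_def by blast+
  then show ?thesis using that[of e] Cmp_Idn_left[OF d(2) W v] by simp
qed

text \<open>TR3 produces third components, so both triangles are rotated and \<open>a\<close>
  appears as a map \<open>W[1] \<rightarrow> A[1]\<close>. Fullness of the shift brings it back, and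
  the signs of the two rotations cancel.\<close>

lemma Tri_weak_kernel:
  assumes t: "Tri T A B D f g h" and W: "W \<in> Obj T" and b: "b \<in> Hom T W B"
    and z: "Cmp T W B D g b = Zero T W D"
  obtains a where "a \<in> Hom T W A" "b = Cmp T W A B f a"
proof -
  obtain Z where Z: "zero_object T Z" using zero_object_exists by blast
  then have ZO: "Z \<in> Obj T" unfolding zero_object_def by blast
  note d = TriD[OF t]
  note SW = Sh_Obj[OF W] and SA = Sh_Obj[OF d(1)] and SB = Sh_Obj[OF d(2)]
  note t1 = Tri_rotate[OF TR1_Idn[OF W Z]] and t2 = Tri_rotate[OF t]
  have "Cmp T W B D g b = Cmp T W Z D (Zero T Z D) (Zero T W Z)"
    using z Cmp_Zero_left[OF W ZO d(3) Zero_Hom[OF W ZO]] by simp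
  then obtain e where "triangle_morphism T W Z (Sh W) (Zero T W Z) (Zero T Z (Sh W))
      (Neg (Sh W) (Sh W) (Shm W W (Idn T W))) B D (Sh A) g h (Neg (Sh A) (Sh B) (Shm A B f))
      b (Zero T Z D) e"
    using TR3[OF t1 t2 b Zero_Hom[OF ZO d(3)]] by metis
  then have e: "e \<in> Hom T (Sh W) (Sh A)"
    and "Cmp T (Sh W) (Sh W) (Sh B) (Shm W B b) (Neg (Sh W) (Sh W) (Shm W W (Idn T W))) =
      Cmp T (Sh W) (Sh A) (Sh B) (Neg (Sh A) (Sh B) (Shm A B f)) e"
    unfolding triangle_morphism_def by blast+
  moreover obtain a where a: "a \<in> Hom T W A" "e = Shm W A a"
    using Sh_full[OF W d(1) e] by blast
  ultimately have "Neg (Sh W) (Sh B) (Shm W B b) = Neg (Sh W) (Sh B) (Shm W B (Cmp T W A B f a))"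
    using Cmp_Neg_right[OF SW SW SB Idn_in_Hom[OF SW] Sh_Hom[OF W d(2) b]]
      Cmp_Neg_left[OF SW SA SB e Sh_Hom[OF d(1,2,4)]] Sh_Idn[OF W] Sh_Cmp[OF W d(1,2) a(1) d(4)]
      Cmp_Idn_right[OF SW SB Sh_Hom[OF W d(2) b]] by simp
  then have "Shm W B b = Shm W B (Cmp T W A B f a)"
    using Neg_Neg[OF SW SB Sh_Hom[OF W d(2) b]]
      Neg_Neg[OF SW SB Sh_Hom[OF W d(2) Cmp_in_Hom[OF W d(1,2) a(1) d(4)]]] by metis
  then have "b = Cmp T W A B f a"
    by (rule Sh_faithful[OF W d(2) b Cmp_in_Hom[OF W d(1,2) a(1) d(4)]])
  then show ?thesis using that a(1) by blast
qed

text \<open>\<open>K\<close> is the cocone of \<open>p\<close>. The shift need not be surjective on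
  objects, so \<open>K\<close> is a preimage of the cone \<open>U\<close> up to an isomorphism
  \<open>i\<close>; maps come back by full faithfulness.\<close>

lemma weak_kernel_exists:
  assumes A: "A \<in> Obj T" and B: "B \<in> Obj T" and p: "p \<in> Hom T A B"
  obtains K k where "K \<in> Obj T" "k \<in> Hom T K A" "Cmp T K A B p k = Zero T K B"
    "\<And>W y. \<lbrakk>W \<in> Obj T; y \<in> Hom T W A; Cmp T W A B p y = Zero T W B\<rbrakk>
      \<Longrightarrow> \<exists>z\<in>Hom T W K. y = Cmp T W K A k z"
proof -
  obtain U q w where t: "Tri T A B U p q w" using TR1_cone[OF A B p] by blast
  note t' = Tri_rotate[OF Tri_rotate[OF t]]
  note d = TriD[OF t] and SA = Sh_Obj[OF A] and SB = Sh_Obj[OF B]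
  obtain K i where K: "K \<in> Obj T" and i: "iso_mor T (Sh K) U i"
    using equivalence_ess_surj[OF Shift_equivalence d(3)] by blast
  note i1 = inv_mor(1)[OF i] and i2 = inv_mor(2)[OF i] and SK = Sh_Obj[OF K]
  have wi: "Cmp T (Sh K) U (Sh A) w i \<in> Hom T (Sh K) (Sh A)"
    by (rule Cmp_in_Hom[OF SK d(3) SA i1 d(6)])
  obtain k where k: "k \<in> Hom T K A" "Cmp T (Sh K) U (Sh A) w i = Shm K A k"
    using Sh_full[OF K A wi] by metis
  have Sp: "Shm A B p \<in> Hom T (Sh A) (Sh B)" using Sh_Hom[OF A B p] .
  \<comment> \<open>Two rotations put a sign on the shifted \<open>p\<close>, which does not affect
    vanishing.\<close>
  have Spw: "Cmp T U (Sh A) (Sh B) (Shm A B p) w = Zero T U (Sh B)"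
    using Tri_Cmp_zero[OF t'] Cmp_Neg_left[OF d(3) SA SB d(6) Sp]
      Neg_eq_Zero[OF d(3) SB Cmp_in_Hom[OF d(3) SA SB d(6) Sp]]
      Tri_Cmp_zero[OF Tri_rotate[OF Tri_rotate[OF t]]] by simp
  have "Shm K B (Cmp T K A B p k) = Shm K B (Zero T K B)"
    using Sh_Cmp[OF K A B k(1) p] k(2) Cmp_assoc[OF SK d(3) SA SB i1 d(6) Sp] Spw
      Cmp_Zero_left[OF SK d(3) SB i1] Sh_Zero[OF K B] by simp
  then have pk: "Cmp T K A B p k = Zero T K B"
    by (rule Sh_faithful[OF K B Cmp_in_Hom[OF K A B k(1) p] Zero_Hom[OF K B]])
  have "\<exists>z\<in>Hom T W K. y = Cmp T W K A k z"
    if W: "W \<in> Obj T" and y: "y \<in> Hom T W A" and z: "Cmp T W A B p y = Zero T W B" for W y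
  proof -
    note SW = Sh_Obj[OF W] and Sy = Sh_Hom[OF W A y]
    have "Cmp T (Sh W) (Sh A) (Sh B) (Neg (Sh A) (Sh B) (Shm A B p)) (Shm W A y) = Zero T (Sh W) (Sh B)"
      using Cmp_Neg_left[OF SW SA SB Sy Sp] Sh_Cmp[OF W A B y p] z Sh_Zero[OF W B]
        Neg_Zero[OF SW SB] by simp
    then obtain u where u: "u \<in> Hom T (Sh W) U" "Shm W A y = Cmp T (Sh W) U (Sh A) w u"
      using Tri_weak_kernel[OF t' SW Sy] by blast
    have u': "Cmp T (Sh W) U (Sh K) (inv_mor T (Sh K) U i) u \<in> Hom T (Sh W) (Sh K)"
      by (rule Cmp_in_Hom[OF SW d(3) SK u(1) i2])
    obtain v where v: "v \<in> Hom T W K" "Cmp T (Sh W) U (Sh K) (inv_mor T (Sh K) U i) u = Shm W K v"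
      using Sh_full[OF W K u'] by metis
    have "Shm W A (Cmp T W K A k v) = Cmp T (Sh W) U (Sh A) w u"
      using Sh_Cmp[OF W K A v(1) k(1)] v(2) k(2) Cmp_assoc[OF SW SK d(3) SA u' i1 d(6)]
        inv_mor_Cmp_cancel(2)[OF i SW SK d(3) u(1)] by simp
    then have "y = Cmp T W K A k v"
      using u(2) Sh_faithful[OF W A y Cmp_in_Hom[OF W K A v(1) k(1)]] by simp
    then show ?thesis using v(1) by blast
  qed
  then show ?thesis using that K k(1) pk by blast
qed

end

section \<open>The factor category by the perpendicular of a rigid subcategory\<close>

locale rigid_subcategory = triangulated_category T
  for T :: "('o, 'h, 'x) tricat_scheme" +
  fixes X :: "'o set"
  assumes X_subset: "X \<subseteq> Obj T"
    and contravariantly_finite_X: "contravariantly_finite T X"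
    and rigid_X: "rigid T X"
begin

lemma X_Obj: "Y \<in> X \<Longrightarrow> Y \<in> Obj T"
  using X_subset by blast

lemma approximation:
  assumes "A \<in> Obj T"
  obtains X0 p where "X0 \<in> X" "p \<in> Hom T X0 A"
    "\<And>Y y. \<lbrakk>Y \<in> X; y \<in> Hom T Y A\<rbrakk> \<Longrightarrow> \<exists>z\<in>Hom T Y X0. y = Cmp T Y X0 A p z"
proof -
  obtain X0 p where p: "X0 \<in> X" "p \<in> Hom T X0 A"
    "\<forall>Y\<in>X. (\<lambda>f. Cmp T Y X0 A p f) ` Hom T Y X0 = Hom T Y A"
    using contravariantly_finite_X assms unfolding contravariantly_finite_def by blast
  have "\<exists>z\<in>Hom T Y X0. y = Cmp T Y X0 A p z" if "Y \<in> X" "y \<in> Hom T Y A" for Y y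
  proof -
    have "y \<in> (\<lambda>f. Cmp T Y X0 A p f) ` Hom T Y X0" using p(3) that by simp
    then show ?thesis by blast
  qed
  then show ?thesis using that p by blast
qed

text \<open>\<open>X0\<close> approximates \<open>A\<close>, and \<open>X1\<close> approximates a
  weak kernel of that approximation. Tested on \<open>X\<close>, this is an exact sequence
  \<open>X1 \<rightarrow> X0 \<rightarrow> A \<rightarrow> 0\<close>.\<close>

lemma X_presentation:
  assumes A: "A \<in> Obj T"
  obtains X1 X0 m p where "X1 \<in> X" "X0 \<in> X" "m \<in> Hom T X1 X0" "p \<in> Hom T X0 A"
    "Cmp T X1 X0 A p m = Zero T X1 A"
    "\<And>Y y. \<lbrakk>Y \<in> X; y \<in> Hom T Y A\<rbrakk> \<Longrightarrow> \<exists>z\<in>Hom T Y X0. y = Cmp T Y X0 A p z"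
    "\<And>Y y. \<lbrakk>Y \<in> X; y \<in> Hom T Y X0; Cmp T Y X0 A p y = Zero T Y A\<rbrakk>
      \<Longrightarrow> \<exists>z\<in>Hom T Y X1. y = Cmp T Y X1 X0 m z"
proof -
  obtain X0 p where p: "X0 \<in> X" "p \<in> Hom T X0 A"
    "\<And>Y y. \<lbrakk>Y \<in> X; y \<in> Hom T Y A\<rbrakk> \<Longrightarrow> \<exists>z\<in>Hom T Y X0. y = Cmp T Y X0 A p z"
    using approximation[OF A] by metis
  note X0 = X_Obj[OF p(1)]
  obtain K k where k: "K \<in> Obj T" "k \<in> Hom T K X0" "Cmp T K X0 A p k = Zero T K A"
    "\<And>W y. \<lbrakk>W \<in> Obj T; y \<in> Hom T W X0; Cmp T W X0 A p y = Zero T W A\<rbrakk>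
      \<Longrightarrow> \<exists>z\<in>Hom T W K. y = Cmp T W K X0 k z"
    using weak_kernel_exists[OF X0 A p(2)] by metis
  obtain X1 q where q: "X1 \<in> X" "q \<in> Hom T X1 K"
    "\<And>Y y. \<lbrakk>Y \<in> X; y \<in> Hom T Y K\<rbrakk> \<Longrightarrow> \<exists>z\<in>Hom T Y X1. y = Cmp T Y X1 K q z"
    using approximation[OF k(1)] by metis
  note X1 = X_Obj[OF q(1)]
  let ?m = "Cmp T X1 K X0 k q"
  have m: "?m \<in> Hom T X1 X0" by (rule Cmp_in_Hom[OF X1 k(1) X0 q(2) k(2)])
  have pm: "Cmp T X1 X0 A p ?m = Zero T X1 A"
    using Cmp_assoc[OF X1 k(1) X0 A q(2) k(2) p(2)] k(3) Cmp_Zero_left[OF X1 k(1) A q(2)] by simp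
  have ex: "\<exists>z\<in>Hom T Y X1. y = Cmp T Y X1 X0 ?m z"
    if Y: "Y \<in> X" and y: "y \<in> Hom T Y X0" and z: "Cmp T Y X0 A p y = Zero T Y A" for Y y
  proof -
    obtain v where v: "v \<in> Hom T Y K" "y = Cmp T Y K X0 k v" using k(4)[OF X_Obj[OF Y] y z] by blast
    obtain w where w: "w \<in> Hom T Y X1" "v = Cmp T Y X1 K q w" using q(3)[OF Y v(1)] by blast
    have "y = Cmp T Y X1 X0 ?m w"
      using v(2) w(2) Cmp_assoc[OF X_Obj[OF Y] X1 k(1) X0 w(1) q(2) k(2)] by simp
    then show ?thesis using w(1) by blast
  qed
  show ?thesis by (rule that[OF q(1) p(1) m p(2) pm p(3) ex])
qed

text \<open>The obstruction \<open>h y\<close> lies in \<open>T(Y, X1[1])\<close>, which vanishes by rigidity.\<close>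

lemma cone_lift:
  assumes t: "Tri T X1 A B m c h" and X1: "X1 \<in> X" and Y: "Y \<in> X" and y: "y \<in> Hom T Y B"
  obtains z where "z \<in> Hom T Y A" "y = Cmp T Y A B c z"
proof -
  note d = TriD[OF t] and YO = X_Obj[OF Y]
  have "Cmp T Y B (Sh X1) h y \<in> Hom T Y (Sh X1)"
    by (rule Cmp_in_Hom[OF YO d(3) Sh_Obj[OF d(1)] y d(6)])
  then have "Cmp T Y B (Sh X1) h y = Zero T Y (Sh X1)"
    using rigid_X X1 Y unfolding rigid_def by blast
  then show ?thesis using Tri_weak_kernel[OF Tri_rotate[OF t] YO y] that by blast
qed

abbreviation same_action where
  "same_action A B f g \<equiv> \<forall>Y\<in>X. \<forall>x\<in>Hom T Y A. Cmp T Y A B f x = Cmp T Y A B g x"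

abbreviation X_bijective where
  "X_bijective A B s \<equiv> \<forall>Y\<in>X. bij_betw (\<lambda>x. Cmp T Y A B s x) (Hom T Y A) (Hom T Y B)"

lemma maps_through_perp:
  assumes A: "A \<in> Obj T" and B: "B \<in> Obj T"
  shows "maps_through T (perp T X) A B = {f \<in> Hom T A B. same_action A B f (Zero T A B)}"
proof (intro equalityI subsetI)
  fix f assume "f \<in> maps_through T (perp T X) A B"
  then obtain W g h where W: "W \<in> perp T X" and g: "g \<in> Hom T A W" and h: "h \<in> Hom T W B"
    and f: "f = Cmp T A W B h g"
    unfolding maps_through_def by blast
  have WO: "W \<in> Obj T" using W unfolding perp_def by blast
  have "Cmp T Y A B f x = Cmp T Y A B (Zero T A B) x" if Y: "Y \<in> X" and x: "x \<in> Hom T Y A" for Y x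
  proof -
    note YO = X_Obj[OF Y]
    have "Cmp T Y A W g x = Zero T Y W"
      using W Y Cmp_in_Hom[OF YO A WO x g] unfolding perp_def by blast
    then show ?thesis
      using f Cmp_assoc[OF YO A WO B x g h] Cmp_Zero_right[OF YO WO B h] Cmp_Zero_left[OF YO A B x]
      by simp
  qed
  then show "f \<in> {f \<in> Hom T A B. same_action A B f (Zero T A B)}"
    using f Cmp_in_Hom[OF A WO B g h] by simp
next
  fix f assume "f \<in> {f \<in> Hom T A B. same_action A B f (Zero T A B)}"
  then have f: "f \<in> Hom T A B" and z: "same_action A B f (Zero T A B)" by blast+
  obtain X0 p where p: "X0 \<in> X" "p \<in> Hom T X0 A"
    "\<And>Y y. \<lbrakk>Y \<in> X; y \<in> Hom T Y A\<rbrakk> \<Longrightarrow> \<exists>z\<in>Hom T Y X0. y = Cmp T Y X0 A p z"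
    using approximation[OF A] by metis
  note X0 = X_Obj[OF p(1)]
  obtain U q w where t: "Tri T X0 A U p q w" using TR1_cone[OF X0 A p(2)] by blast
  note d = TriD[OF t]
  have "Cmp T X0 A B f p = Zero T X0 B"
    using z p(1,2) Cmp_Zero_left[OF X0 A B p(2)] by simp
  \<comment> \<open>\<open>f\<close> kills the approximation \<open>p\<close>, so it factors through
    the cone \<open>U\<close> of \<open>p\<close>.\<close>
  then obtain g where g: "g \<in> Hom T U B" "f = Cmp T A U B g q"
    using Tri_weak_cokernel[OF t B f] by blast
  \<comment> \<open>\<open>y\<close> lifts to \<open>A\<close> by \<open>cone_lift\<close> and from
    there to \<open>X0\<close> by the approximation, and \<open>q p = 0\<close>.\<close>
  have "y = Zero T Y U" if Y: "Y \<in> X" and y: "y \<in> Hom T Y U" for Y y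
  proof -
    note YO = X_Obj[OF Y]
    obtain a where a: "a \<in> Hom T Y A" "y = Cmp T Y A U q a"
      using cone_lift[OF t p(1) Y y] by blast
    obtain b where b: "b \<in> Hom T Y X0" "a = Cmp T Y X0 A p b"
      using p(3)[OF Y a(1)] by blast
    show ?thesis
      using a(2) b(2) Cmp_assoc[OF YO X0 A d(3) b(1) p(2) d(5)] Tri_Cmp_zero[OF t]
        Cmp_Zero_left[OF YO X0 d(3) b(1)] by simp
  qed
  then have "U \<in> perp T X"
    unfolding perp_def using d(3) Zero_Hom[OF X_Obj d(3)] by blast
  then show "f \<in> maps_through T (perp T X) A B"
    unfolding maps_through_def using d(5) g by blast
qed

abbreviation cls where
  "cls A B f \<equiv> maps_through T (perp T X) A B #>\<^bsub>hom_group T A B\<^esub> f"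

text \<open>The subgroup divided out is the kernel of the action on \<open>X\<close>, so its cosets
  are the fibres of the action. From here on equality in the quotient is tested on maps from
  \<open>X\<close>.\<close>

lemma cls_eq:
  assumes A: "A \<in> Obj T" and B: "B \<in> Obj T" and f: "f \<in> Hom T A B"
  shows "cls A B f = {g \<in> Hom T A B. same_action A B g f}"
proof -
  let ?N = "maps_through T (perp T X) A B"
  interpret G: comm_group "hom_group T A B" using hom_comm_group[OF A B] .
  have N: "g \<in> ?N \<longleftrightarrow> g \<in> Hom T A B \<and> (\<forall>Y\<in>X. \<forall>x\<in>Hom T Y A. Cmp T Y A B g x = Zero T Y B)" for g
    unfolding maps_through_perp[OF A B] using Cmp_Zero_left[OF X_Obj A B] by simp
  have sub: "subgroup ?N (hom_group T A B)"
  proof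
    show "?N \<subseteq> carrier (hom_group T A B)" using N by auto
    show "\<one>\<^bsub>hom_group T A B\<^esub> \<in> ?N"
      using N Zero_Hom[OF A B] Cmp_Zero_left[OF X_Obj A B] by simp
    show "g \<otimes>\<^bsub>hom_group T A B\<^esub> g' \<in> ?N" if "g \<in> ?N" "g' \<in> ?N" for g g'
    proof -
      have g: "g \<in> Hom T A B" "g' \<in> Hom T A B" using that N by blast+
      have "Cmp T Y A B (Add T A B g g') x = Zero T Y B" if "Y \<in> X" "x \<in> Hom T Y A" for Y x
        using Cmp_Add_left[OF X_Obj[OF that(1)] A B that(2) g] \<open>g \<in> ?N\<close> \<open>g' \<in> ?N\<close> that N
          Add_Zero(1)[OF X_Obj[OF that(1)] B Zero_Hom[OF X_Obj[OF that(1)] B]] by simp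
      then show ?thesis using N Add_Hom[OF A B g] by simp
    qed
    show "Neg A B g \<in> ?N" if "g \<in> ?N" for g
    proof -
      have g: "g \<in> Hom T A B" using that N by blast
      have "Cmp T Y A B (Neg A B g) x = Zero T Y B" if "Y \<in> X" "x \<in> Hom T Y A" for Y x
        using Cmp_Neg_left[OF X_Obj[OF that(1)] A B that(2) g] \<open>g \<in> ?N\<close> that N
          Neg_Zero[OF X_Obj[OF that(1)] B] by simp
      then show ?thesis using N Neg_Hom[OF A B g] by simp
    qed
  qed
  have "g \<in> cls A B f \<longleftrightarrow> same_action A B g f" if g: "g \<in> Hom T A B" for g
  proof -
    have "g \<in> cls A B f \<longleftrightarrow> Add T A B g (Neg A B f) \<in> ?N"
      using subgroup.rcos_module[OF sub G.is_group, of f g] f g by simp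
    also have "\<dots> \<longleftrightarrow> (\<forall>Y\<in>X. \<forall>x\<in>Hom T Y A. Cmp T Y A B (Add T A B g (Neg A B f)) x = Zero T Y B)"
      unfolding N using Add_Hom[OF A B g Neg_Hom[OF A B f]] by simp
    also have "\<dots> \<longleftrightarrow> same_action A B g f"
    proof (intro ball_cong refl)
      fix Y x assume Y: "Y \<in> X" and x: "x \<in> Hom T Y A"
      note YO = X_Obj[OF Y]
      show "Cmp T Y A B (Add T A B g (Neg A B f)) x = Zero T Y B \<longleftrightarrow>
          Cmp T Y A B g x = Cmp T Y A B f x"
        using Cmp_Add_left[OF YO A B x g Neg_Hom[OF A B f]] Cmp_Neg_left[OF YO A B x f]
          Add_Neg_eq_Zero[OF YO B Cmp_in_Hom[OF YO A B x g] Cmp_in_Hom[OF YO A B x f]] by simp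
    qed
    finally show ?thesis .
  qed
  moreover have "cls A B f \<subseteq> Hom T A B"
    using G.r_coset_subset_G[of ?N f] f N by auto
  ultimately show ?thesis by blast
qed

lemma cls_self: "\<lbrakk>A \<in> Obj T; B \<in> Obj T; f \<in> Hom T A B\<rbrakk> \<Longrightarrow> f \<in> cls A B f"
  by (simp add: cls_eq)

lemma cls_eq_iff:
  assumes "A \<in> Obj T" "B \<in> Obj T" "f \<in> Hom T A B" "g \<in> Hom T A B"
  shows "cls A B f = cls A B g \<longleftrightarrow> same_action A B f g"
  using assms by (auto simp: cls_eq)

text \<open>For a source in \<open>X\<close>, its identity is itself one of the test maps.\<close>

lemma cls_eq_from_X_iff:
  assumes "Y \<in> X" "B \<in> Obj T" "f \<in> Hom T Y B" "g \<in> Hom T Y B"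
  shows "cls Y B f = cls Y B g \<longleftrightarrow> f = g"
proof -
  have "f = g" if "same_action Y B f g"
    using that assms X_Obj[OF assms(1)] Idn_in_Hom[OF X_Obj[OF assms(1)]]
      Cmp_Idn_right[OF X_Obj[OF assms(1)] assms(2)] by metis
  then show ?thesis using cls_eq_iff[OF X_Obj[OF assms(1)] assms(2-4)] by blast
qed

section \<open>The factor category and its regular maps\<close>

abbreviation Q where "Q \<equiv> factor_category T (perp T X)"

lemma Q_Obj [simp]: "Obj Q = Obj T"
  and Q_Idn: "Idn Q A = cls A A (Idn T A)"
  by (simp_all add: factor_category_def)

lemma Q_Hom: "Hom Q A B = cls A B ` Hom T A B"
  by (auto simp: factor_category_def FactGroup_def RCOSETS_def)

lemma cls_in_Q: "f \<in> Hom T A B \<Longrightarrow> cls A B f \<in> Hom Q A B"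
  unfolding Q_Hom by blast

text \<open>Equal actions compose to equal actions, so the union in the definition of the composite
  is a single coset.\<close>

lemma Q_Cmp:
  assumes O: "A \<in> Obj T" "B \<in> Obj T" "D \<in> Obj T" and f: "f \<in> Hom T A B" and g: "g \<in> Hom T B D"
  shows "Cmp Q A B D (cls B D g) (cls A B f) = cls A D (Cmp T A B D g f)"
proof -
  have eq: "cls A D (Cmp T A B D g' f') = cls A D (Cmp T A B D g f)"
    if f': "f' \<in> cls A B f" and g': "g' \<in> cls B D g" for f' g'
  proof -
    have f'H: "f' \<in> Hom T A B" and fs: "same_action A B f' f"
      using f' unfolding cls_eq[OF O(1,2) f] by blast+
    have g'H: "g' \<in> Hom T B D" and gs: "same_action B D g' g"
      using g' unfolding cls_eq[OF O(2,3) g] by blast+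
    have "Cmp T Y A D (Cmp T A B D g' f') x = Cmp T Y A D (Cmp T A B D g f) x"
      if Y: "Y \<in> X" and x: "x \<in> Hom T Y A" for Y x
      using Cmp_assoc[OF X_Obj[OF Y] O x f'H g'H] Cmp_assoc[OF X_Obj[OF Y] O x f g] fs gs Y x
        Cmp_in_Hom[OF X_Obj[OF Y] O(1,2) x f] by simp
    then show ?thesis
      using cls_eq_iff[OF O(1,3) Cmp_in_Hom[OF O f'H g'H] Cmp_in_Hom[OF O f g]] by simp
  qed
  have "(\<Union>f'\<in>cls A B f. \<Union>g'\<in>cls B D g. cls A D (Cmp T A B D g' f')) = cls A D (Cmp T A B D g f)"
    using eq cls_self[OF O(1,2) f] cls_self[OF O(2,3) g] by blast
  then show ?thesis by (simp add: factor_category_def)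
qed

lemma category_Q: "category Q"
proof
  show "Idn Q A \<in> Hom Q A A" if "A \<in> Obj Q" for A
    using that Idn_in_Hom cls_in_Q by (simp add: Q_Idn)
  show "Cmp Q A B D g f \<in> Hom Q A D"
    if "A \<in> Obj Q" "B \<in> Obj Q" "D \<in> Obj Q" "f \<in> Hom Q A B" "g \<in> Hom Q B D" for A B D f g
    using that Q_Cmp Cmp_in_Hom by (auto simp: Q_Hom)
  show "Cmp Q A A B f (Idn Q A) = f" if "A \<in> Obj Q" "B \<in> Obj Q" "f \<in> Hom Q A B" for A B f
    using that Q_Cmp Idn_in_Hom Cmp_Idn_right by (auto simp: Q_Hom Q_Idn)
  show "Cmp Q A B B (Idn Q B) f = f" if "A \<in> Obj Q" "B \<in> Obj Q" "f \<in> Hom Q A B" for A B f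
    using that Q_Cmp Idn_in_Hom Cmp_Idn_left by (auto simp: Q_Hom Q_Idn)
  show "Cmp Q A B E (Cmp Q B D E h g) f = Cmp Q A D E h (Cmp Q A B D g f)"
    if O: "A \<in> Obj Q" "B \<in> Obj Q" "D \<in> Obj Q" "E \<in> Obj Q"
      and m: "f \<in> Hom Q A B" "g \<in> Hom Q B D" "h \<in> Hom Q D E" for A B D E f g h
  proof -
    obtain f' g' h' where r: "f' \<in> Hom T A B" "g' \<in> Hom T B D" "h' \<in> Hom T D E"
      "f = cls A B f'" "g = cls B D g'" "h = cls D E h'"
      using m unfolding Q_Hom by blast
    have O': "A \<in> Obj T" "B \<in> Obj T" "D \<in> Obj T" "E \<in> Obj T" using O by simp_all
    show ?thesis
      unfolding r(4-6) using Q_Cmp[OF O'(1-3) r(1,2)] Q_Cmp[OF O'(2-4) r(2,3)]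
        Q_Cmp[OF O'(1,2,4) r(1) Cmp_in_Hom[OF O'(2-4) r(2,3)]]
        Q_Cmp[OF O'(1,3,4) Cmp_in_Hom[OF O'(1-3) r(1,2)] r(3)] Cmp_assoc[OF O' r(1-3)] by simp
  qed
qed

lemma zero_object_Q: "\<exists>Z. zero_object Q Z"
proof -
  obtain Z where Z: "zero_object T Z" using zero_object_exists by blast
  have "zero_object Q Z"
    unfolding zero_object_iff Q_Hom
  proof (intro conjI ballI)
    show "Z \<in> Obj Q" using Z unfolding zero_object_def by simp
    fix A assume "A \<in> Obj Q"
    then have "A \<in> Obj T" by simp
    then obtain x y where "Hom T A Z = {x}" "Hom T Z A = {y}"
      using Z unfolding zero_object_iff by blast
    then show "\<exists>x. cls A Z ` Hom T A Z = {x}" "\<exists>x. cls Z A ` Hom T Z A = {x}" by simp_all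
  qed
  then show ?thesis by blast
qed

text \<open>Morphisms of the quotient are sets of elements of \<open>'h\<close>, so smallness is not
  automatic; choosing representatives injects each hom-set back into \<open>'h\<close>.\<close>

lemma has_small_homs_Q: "has_small_homs TYPE('h) Q"
  unfolding has_small_homs_def
proof (intro ballI exI)
  fix A B assume "A \<in> Obj Q" "B \<in> Obj Q"
  then have O: "A \<in> Obj T" "B \<in> Obj T" by simp_all
  have ch: "(SOME f. f \<in> F) \<in> Hom T A B \<and> cls A B (SOME f. f \<in> F) = F" if F: "F \<in> Hom Q A B" for F
  proof -
    obtain f where f: "f \<in> Hom T A B" "F = cls A B f" using F unfolding Q_Hom by blast
    then have "(SOME f. f \<in> F) \<in> F" using cls_self[OF O f(1)] someI[of "\<lambda>f. f \<in> F"] by blast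
    then have "(SOME f. f \<in> F) \<in> Hom T A B" "same_action A B (SOME f. f \<in> F) f"
      using f(2) cls_eq[OF O f(1)] by blast+
    then show ?thesis using cls_eq_iff[OF O _ f(1)] f(2) by blast
  qed
  show "inj_on (\<lambda>F. SOME f. f \<in> F) (Hom Q A B)"
    by (rule inj_on_inverseI[of _ "cls A B"]) (use ch in blast)
qed

text \<open>For monicity, injectivity of \<open>s\<close> on maps from \<open>X\<close> cancels it
  in every action. For epicness, every map from \<open>X\<close> to \<open>B\<close> has the form
  \<open>s x\<close>.\<close>

lemma X_bijective_regular:
  assumes O: "A \<in> Obj T" "B \<in> Obj T" and s: "s \<in> Hom T A B" and bij: "X_bijective A B s"
  shows "cls A B s \<in> regular_maps Q A B"
proof -
  have "mono_mor Q A B (cls A B s)"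
    unfolding mono_mor_def
  proof (intro conjI ballI impI)
    fix W u v assume W: "W \<in> Obj Q" and "u \<in> Hom Q W A" "v \<in> Hom Q W A"
      and eq: "Cmp Q W A B (cls A B s) u = Cmp Q W A B (cls A B s) v"
    then obtain u' v' where u: "u' \<in> Hom T W A" "u = cls W A u'" and v: "v' \<in> Hom T W A" "v = cls W A v'"
      unfolding Q_Hom by blast
    have WO: "W \<in> Obj T" using W by simp
    have sa: "same_action W B (Cmp T W A B s u') (Cmp T W A B s v')"
      using eq Q_Cmp[OF WO O u(1) s] Q_Cmp[OF WO O v(1) s] u(2) v(2)
        cls_eq_iff[OF WO O(2) Cmp_in_Hom[OF WO O u(1) s] Cmp_in_Hom[OF WO O v(1) s]] by simp
    have "Cmp T Y W A u' x = Cmp T Y W A v' x" if Y: "Y \<in> X" and x: "x \<in> Hom T Y W" for Y x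
    proof -
      note YO = X_Obj[OF Y]
      have "Cmp T Y A B s (Cmp T Y W A u' x) = Cmp T Y A B s (Cmp T Y W A v' x)"
        using sa Y x Cmp_assoc[OF YO WO O x u(1) s] Cmp_assoc[OF YO WO O x v(1) s] by simp
      moreover have "inj_on (\<lambda>x. Cmp T Y A B s x) (Hom T Y A)" using bij Y unfolding bij_betw_def by blast
      ultimately show ?thesis
        using Cmp_in_Hom[OF YO WO O(1) x u(1)] Cmp_in_Hom[OF YO WO O(1) x v(1)]
        unfolding inj_on_def by blast
    qed
    then show "u = v" using cls_eq_iff[OF WO O(1) u(1) v(1)] u(2) v(2) by simp
  qed (rule cls_in_Q[OF s])
  moreover have "epi_mor Q A B (cls A B s)"
    unfolding epi_mor_def
  proof (intro conjI ballI impI)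
    fix W u v assume W: "W \<in> Obj Q" and "u \<in> Hom Q B W" "v \<in> Hom Q B W"
      and eq: "Cmp Q A B W u (cls A B s) = Cmp Q A B W v (cls A B s)"
    then obtain u' v' where u: "u' \<in> Hom T B W" "u = cls B W u'" and v: "v' \<in> Hom T B W" "v = cls B W v'"
      unfolding Q_Hom by blast
    have WO: "W \<in> Obj T" using W by simp
    have sa: "same_action A W (Cmp T A B W u' s) (Cmp T A B W v' s)"
      using eq Q_Cmp[OF O WO s u(1)] Q_Cmp[OF O WO s v(1)] u(2) v(2)
        cls_eq_iff[OF O(1) WO Cmp_in_Hom[OF O WO s u(1)] Cmp_in_Hom[OF O WO s v(1)]] by simp
    have "Cmp T Y B W u' y = Cmp T Y B W v' y" if Y: "Y \<in> X" and y: "y \<in> Hom T Y B" for Y y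
    proof -
      note YO = X_Obj[OF Y]
      have "y \<in> (\<lambda>x. Cmp T Y A B s x) ` Hom T Y A" using bij Y y unfolding bij_betw_def by blast
      then obtain x where x: "x \<in> Hom T Y A" "y = Cmp T Y A B s x" by blast
      show ?thesis
        using sa Y x Cmp_assoc[OF YO O WO x(1) s u(1)] Cmp_assoc[OF YO O WO x(1) s v(1)] by simp
    qed
    then show "u = v" using cls_eq_iff[OF O(2) WO u(1) v(1)] u(2) v(2) by simp
  qed (rule cls_in_Q[OF s])
  ultimately show ?thesis using cls_in_Q[OF s] unfolding regular_maps_def by blast
qed

text \<open>Injectivity is monicity tested on objects of \<open>X\<close>, where classes are single
  maps. For surjectivity, epicness forces the map \<open>g\<close> to the cone to act as zero, so
  every \<open>y\<close> lifts along \<open>s\<close> by the weak kernel property.\<close>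

lemma regular_X_bijective:
  assumes O: "A \<in> Obj T" "B \<in> Obj T" and s: "s \<in> Hom T A B" and reg: "cls A B s \<in> regular_maps Q A B"
  shows "X_bijective A B s"
proof (intro ballI bij_betw_imageI equalityI subsetI inj_onI)
  fix Y assume Y: "Y \<in> X"
  note YO = X_Obj[OF Y]
  have mono: "mono_mor Q A B (cls A B s)" and epi: "epi_mor Q A B (cls A B s)"
    using reg unfolding regular_maps_def by blast+
  show "x = x'" if x: "x \<in> Hom T Y A" and x': "x' \<in> Hom T Y A"
    and eq: "Cmp T Y A B s x = Cmp T Y A B s x'" for x x'
  proof -
    have "Cmp Q Y A B (cls A B s) (cls Y A x) = Cmp Q Y A B (cls A B s) (cls Y A x')"
      using Q_Cmp[OF YO O x s] Q_Cmp[OF YO O x' s] eq by simp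
    then have "cls Y A x = cls Y A x'"
      using mono cls_in_Q[OF x] cls_in_Q[OF x'] YO unfolding mono_mor_def by simp
    then show ?thesis using cls_eq_from_X_iff[OF Y O(1) x x'] by blast
  qed
  show "y \<in> Hom T Y B" if "y \<in> (\<lambda>x. Cmp T Y A B s x) ` Hom T Y A" for y
    using that Cmp_in_Hom[OF YO O _ s] by blast
  show "y \<in> (\<lambda>x. Cmp T Y A B s x) ` Hom T Y A" if y: "y \<in> Hom T Y B" for y
  proof -
    obtain D g h where t: "Tri T A B D s g h" using TR1_cone[OF O s] by blast
    note d = TriD[OF t]
    note z = Zero_Hom[OF O(2) d(3)]
    have "Cmp Q A B D (cls B D g) (cls A B s) = Cmp Q A B D (cls B D (Zero T B D)) (cls A B s)"
      using Q_Cmp[OF O d(3) s d(5)] Q_Cmp[OF O d(3) s z] Tri_Cmp_zero[OF t]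
        Cmp_Zero_left[OF O d(3) s] by simp
    then have "cls B D g = cls B D (Zero T B D)"
      using epi cls_in_Q[OF d(5)] cls_in_Q[OF z] d(3) unfolding epi_mor_def by simp
    then have "Cmp T Y B D g y = Zero T Y D"
      using cls_eq_iff[OF O(2) d(3,5) z] Y y Cmp_Zero_left[OF YO O(2) d(3) y] by simp
    then show ?thesis using Tri_weak_kernel[OF t YO y] by blast
  qed
qed

section \<open>Presented objects as colocal coreflections\<close>

abbreviation R where "R \<equiv> regular_maps Q"

lemma R_iff:
  assumes "A \<in> Obj T" "B \<in> Obj T"
  shows "S \<in> R A B \<longleftrightarrow> (\<exists>s\<in>Hom T A B. S = cls A B s \<and> X_bijective A B s)"
proof
  assume S: "S \<in> R A B"
  then have "S \<in> Hom Q A B" unfolding regular_maps_def by blast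
  then obtain s where "s \<in> Hom T A B" "S = cls A B s" unfolding Q_Hom by blast
  then show "\<exists>s\<in>Hom T A B. S = cls A B s \<and> X_bijective A B s"
    using regular_X_bijective[OF assms] S by blast
qed (use X_bijective_regular[OF assms] in blast)

sublocale Q: localizing Q R
proof -
  interpret category Q by (rule category_Q)
  show "localizing Q R" by standard (simp add: regular_maps_def)
qed

text \<open>On \<open>X0\<close> the map \<open>u c\<close> lifts to \<open>v0\<close>; injectivity
  of \<open>s\<close> on maps from \<open>X1\<close> gives \<open>v0 m = 0\<close>, so
  \<open>v0\<close> descends along \<open>c\<close>. The result agrees with \<open>u\<close> on
  \<open>c\<close>, through which every map from \<open>X\<close> to \<open>W\<close>
  factors.\<close>

lemma presented_lift:
  assumes t: "Tri T X1 X0 W m c h" and X1: "X1 \<in> X" and X0: "X0 \<in> X"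
    and O: "A \<in> Obj T" "B \<in> Obj T" and s: "s \<in> Hom T A B" and bij: "X_bijective A B s"
    and u: "u \<in> Hom T W B"
  shows "\<exists>v\<in>Hom T W A. same_action W B (Cmp T W A B s v) u"
proof -
  note d = TriD[OF t]
  have cu: "Cmp T X0 W B u c \<in> Hom T X0 B" by (rule Cmp_in_Hom[OF d(2,3) O(2) d(5) u])
  then have "Cmp T X0 W B u c \<in> (\<lambda>x. Cmp T X0 A B s x) ` Hom T X0 A"
    using bij X0 unfolding bij_betw_def by blast
  then obtain v0 where v0: "v0 \<in> Hom T X0 A" "Cmp T X0 W B u c = Cmp T X0 A B s v0" by blast
  note v0m = Cmp_in_Hom[OF d(1,2) O(1) d(4) v0(1)]
  have "Cmp T X1 A B s (Cmp T X1 X0 A v0 m) = Cmp T X1 W B u (Cmp T X1 X0 W c m)"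
    using Cmp_assoc[OF d(1,2) O d(4) v0(1) s] Cmp_assoc[OF d(1,2,3) O(2) d(4,5) u] v0(2) by simp
  also have "\<dots> = Cmp T X1 A B s (Zero T X1 A)"
    using Tri_Cmp_zero[OF t] Cmp_Zero_right[OF d(1,3) O(2) u] Cmp_Zero_right[OF d(1) O s] by simp
  finally have "Cmp T X1 X0 A v0 m = Zero T X1 A"
    using bij X1 v0m Zero_Hom[OF d(1) O(1)] unfolding bij_betw_def inj_on_def by blast
  then obtain v where v: "v \<in> Hom T W A" "v0 = Cmp T X0 W A v c"
    using Tri_weak_cokernel[OF t O(1) v0(1)] by blast
  have "Cmp T Y W B (Cmp T W A B s v) y = Cmp T Y W B u y" if Y: "Y \<in> X" and y: "y \<in> Hom T Y W" for Y y
  proof -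
    note YO = X_Obj[OF Y]
    obtain z where z: "z \<in> Hom T Y X0" "y = Cmp T Y X0 W c z" using cone_lift[OF t X1 Y y] by blast
    note sv = Cmp_in_Hom[OF d(3) O v(1) s]
    have "Cmp T X0 W B (Cmp T W A B s v) c = Cmp T X0 W B u c"
      using Cmp_assoc[OF d(2,3) O d(5) v(1) s] v(2) v0(2) by simp
    then show ?thesis
      using z(2) Cmp_assoc[OF YO d(2,3) O(2) z(1) d(5) sv] Cmp_assoc[OF YO d(2,3) O(2) z(1) d(5) u]
      by simp
  qed
  then show ?thesis using v(1) by blast
qed

text \<open>Injectivity is monicity of \<open>S\<close>; surjectivity is
  \<open>presented_lift\<close>.\<close>

lemma presented_colocal:
  assumes t: "Tri T X1 X0 W m c h" and X1: "X1 \<in> X" and X0: "X0 \<in> X"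
  shows "Q.colocal W"
  unfolding Q.colocal_def
proof (intro conjI ballI bij_betw_imageI inj_onI)
  note d = TriD[OF t]
  show "W \<in> Obj Q" using d(3) by simp
  fix A B S assume "A \<in> Obj Q" "B \<in> Obj Q" and S: "S \<in> R A B"
  then have O: "A \<in> Obj T" "B \<in> Obj T" and OQ: "A \<in> Obj Q" "B \<in> Obj Q" "W \<in> Obj Q"
    using d(3) by simp_all
  show "u = v" if "u \<in> Hom Q W A" "v \<in> Hom Q W A" "Cmp Q W A B S u = Cmp Q W A B S v" for u v
    using S that OQ unfolding regular_maps_def mono_mor_def by blast
  show "(\<lambda>v. Cmp Q W A B S v) ` Hom Q W A = Hom Q W B"
  proof (intro equalityI subsetI)
    show "u \<in> Hom Q W B" if "u \<in> (\<lambda>v. Cmp Q W A B S v) ` Hom Q W A" for u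
      using that Q.Cmp_in_Hom[OF OQ(3,1,2) _ Q.R_Hom[OF OQ(1,2) S]] by blast
    fix F assume "F \<in> Hom Q W B"
    then obtain u where u: "u \<in> Hom T W B" "F = cls W B u" unfolding Q_Hom by blast
    obtain s where s: "s \<in> Hom T A B" "S = cls A B s" "X_bijective A B s"
      using S R_iff[OF O] by blast
    obtain v where v: "v \<in> Hom T W A" "same_action W B (Cmp T W A B s v) u"
      using presented_lift[OF t X1 X0 O s(1,3) u(1)] by blast
    have "Cmp Q W A B S (cls W A v) = F"
      using Q_Cmp[OF d(3) O v(1) s(1)] cls_eq_iff[OF d(3) O(2) Cmp_in_Hom[OF d(3) O v(1) s(1)] u(1)]
        v(2) s(2) u(2) by simp
    then show "F \<in> (\<lambda>v. Cmp Q W A B S v) ` Hom Q W A" using cls_in_Q[OF v(1)] by blast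
  qed
qed

text \<open>\<open>W\<close> is the cone of the presentation \<open>m\<close>, and \<open>p\<close>
  descends to \<open>g\<close> on it. On maps from \<open>X\<close>, both \<open>c\<close> and
  \<open>p\<close> are surjective with the image of \<open>m\<close> as kernel, so \<open>g\<close>
  is bijective.\<close>

lemma coreflection:
  assumes A: "A \<in> Obj T"
  obtains X1 X0 W m c h g where "X1 \<in> X" "X0 \<in> X" "Tri T X1 X0 W m c h" "g \<in> Hom T W A" "X_bijective W A g"
proof -
  obtain X1 X0 m p where p: "X1 \<in> X" "X0 \<in> X" "m \<in> Hom T X1 X0" "p \<in> Hom T X0 A"
    "Cmp T X1 X0 A p m = Zero T X1 A"
    "\<And>Y y. \<lbrakk>Y \<in> X; y \<in> Hom T Y A\<rbrakk> \<Longrightarrow> \<exists>z\<in>Hom T Y X0. y = Cmp T Y X0 A p z"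
    "\<And>Y y. \<lbrakk>Y \<in> X; y \<in> Hom T Y X0; Cmp T Y X0 A p y = Zero T Y A\<rbrakk>
      \<Longrightarrow> \<exists>z\<in>Hom T Y X1. y = Cmp T Y X1 X0 m z"
    using X_presentation[OF A] by metis
  obtain W c h where t: "Tri T X1 X0 W m c h" using TR1_cone[OF X_Obj[OF p(1)] X_Obj[OF p(2)] p(3)] by blast
  note d = TriD[OF t]
  obtain g where g: "g \<in> Hom T W A" "p = Cmp T X0 W A g c"
    using Tri_weak_cokernel[OF t A p(4,5)] by blast
  have "X_bijective W A g"
  proof (intro ballI bij_betw_imageI equalityI subsetI)
    fix Y assume Y: "Y \<in> X"
    note YO = X_Obj[OF Y]
    have cz: "Cmp T Y W A g (Cmp T Y X0 W c z) = Cmp T Y X0 A p z" if "z \<in> Hom T Y X0" for z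
      using Cmp_assoc[OF YO d(2,3) A that d(5) g(1)] g(2) by simp
    have ker: "y = Zero T Y W" if y: "y \<in> Hom T Y W" and z: "Cmp T Y W A g y = Zero T Y A" for y
    proof -
      obtain z where z': "z \<in> Hom T Y X0" "y = Cmp T Y X0 W c z" using cone_lift[OF t p(1) Y y] by blast
      then have "Cmp T Y X0 A p z = Zero T Y A" using cz[OF z'(1)] z by simp
      then obtain w where w: "w \<in> Hom T Y X1" "z = Cmp T Y X1 X0 m w" using p(7)[OF Y z'(1)] by blast
      show ?thesis
        using z'(2) w(2) Cmp_assoc[OF YO d(1,2,3) w(1) d(4,5)] Tri_Cmp_zero[OF t]
          Cmp_Zero_left[OF YO d(1,3) w(1)] by simp
    qed
    show "inj_on (\<lambda>x. Cmp T Y W A g x) (Hom T Y W)"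
      by (rule Cmp_inj_onI[OF YO d(3) A g(1) ker])
    show "y \<in> Hom T Y A" if "y \<in> (\<lambda>x. Cmp T Y W A g x) ` Hom T Y W" for y
      using that Cmp_in_Hom[OF YO d(3) A _ g(1)] by blast
    show "y \<in> (\<lambda>x. Cmp T Y W A g x) ` Hom T Y W" if y: "y \<in> Hom T Y A" for y
    proof -
      obtain z where z: "z \<in> Hom T Y X0" "y = Cmp T Y X0 A p z" using p(6)[OF Y y] by blast
      show ?thesis
        using cz[OF z(1)] z(2) Cmp_in_Hom[OF YO d(2,3) z(1) d(5)] by (metis imageI)
    qed
  qed
  then show ?thesis using that p(1,2) t g(1) by blast
qed

end

section \<open>Calculus of fractions\<close>

context rigid_subcategory
begin

text \<open>A presented \<open>W\<close> over \<open>B\<close> is colocal, so the composite of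
  \<open>U\<close> with the regular map \<open>W \<rightarrow> B\<close> lifts along
  \<open>S\<close>.\<close>

lemma right_Ore:
  assumes O: "A \<in> Obj T" "A' \<in> Obj T" "B \<in> Obj T" and S: "S \<in> R A' A" and U: "U \<in> Hom Q B A"
  shows "\<exists>W\<in>Obj Q. \<exists>G\<in>R W B. \<exists>V\<in>Hom Q W A'. Cmp Q W A' A S V = Cmp Q W B A U G"
proof -
  obtain X1 X0 W m c h g where w: "X1 \<in> X" "X0 \<in> X" "Tri T X1 X0 W m c h" "g \<in> Hom T W B" "X_bijective W B g"
    using coreflection[OF O(3)] by metis
  have W: "W \<in> Obj T" using TriD[OF w(3)] by blast
  have G: "cls W B g \<in> R W B" by (rule X_bijective_regular[OF W O(3) w(4,5)])
  have OQ: "A \<in> Obj Q" "A' \<in> Obj Q" "B \<in> Obj Q" "W \<in> Obj Q" using O W by simp_all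
  have "Cmp Q W B A U (cls W B g) \<in> Hom Q W A"
    by (rule Q.Cmp_in_Hom[OF OQ(4,3,1) cls_in_Q[OF w(4)] U])
  then have "Cmp Q W B A U (cls W B g) \<in> (\<lambda>v. Cmp Q W A' A S v) ` Hom Q W A'"
    using presented_colocal[OF w(3,1,2)] OQ S unfolding Q.colocal_def bij_betw_def by blast
  then show ?thesis using G OQ(4) by blast
qed

text \<open>The square is completed by the cone of \<open>(s p, -u p) : X0 \<rightarrow> A' \<oplus> B\<close>, where
  \<open>p : X0 \<rightarrow> A\<close> is a right approximation: \<open>T(X,-)\<close> need not send homotopy pushouts to pushouts, but
  it is right exact on triangles that start in \<open>X\<close>.\<close>

lemma left_Ore:
  assumes O: "A \<in> Obj T" "A' \<in> Obj T" "B \<in> Obj T" and S: "S \<in> R A A'" and U: "U \<in> Hom Q A B"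
  shows "\<exists>B'\<in>Obj Q. \<exists>S'\<in>R B B'. \<exists>U'\<in>Hom Q A' B'. Cmp Q A A' B' U' S = Cmp Q A B B' S' U"
proof -
  obtain s where s: "s \<in> Hom T A A'" "S = cls A A' s" "X_bijective A A' s" using S R_iff[OF O(1,2)] by blast
  obtain u where u: "u \<in> Hom T A B" "U = cls A B u" using U unfolding Q_Hom by blast
  obtain X0 p where p: "X0 \<in> X" "p \<in> Hom T X0 A"
    "\<And>Y y. \<lbrakk>Y \<in> X; y \<in> Hom T Y A\<rbrakk> \<Longrightarrow> \<exists>z\<in>Hom T Y X0. y = Cmp T Y X0 A p z"
    using approximation[OF O(1)] by metis
  note X0 = X_Obj[OF p(1)]
  obtain D i j a b where bi: "is_biproduct T A' B D i j a b"
    using direct_sum_exists[OF O(2,3)] unfolding is_direct_sum_def by blast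
  have D: "D \<in> Obj T" and i: "i \<in> Hom T A' D" and j: "j \<in> Hom T B D"
    and a: "a \<in> Hom T D A'" and b: "b \<in> Hom T D B"
    and ai: "Cmp T A' D A' a i = Idn T A'" and bj: "Cmp T B D B b j = Idn T B"
    and bi0: "Cmp T A' D B b i = Zero T A' B" and aj0: "Cmp T B D A' a j = Zero T B A'"
    and sum: "Add T D D (Cmp T D A' D i a) (Cmp T D B D j b) = Idn T D"
    using bi unfolding is_biproduct_def by blast+
  let ?sp = "Cmp T X0 A A' s p" and ?up = "Cmp T X0 A B u p"
  have sp: "?sp \<in> Hom T X0 A'" by (rule Cmp_in_Hom[OF X0 O(1,2) p(2) s(1)])
  have up: "?up \<in> Hom T X0 B" by (rule Cmp_in_Hom[OF X0 O(1,3) p(2) u(1)])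
  note nup = Neg_Hom[OF X0 O(3) up]
  define x where "x = Add T X0 D (Cmp T X0 A' D i ?sp) (Cmp T X0 B D j (Neg X0 B ?up))"
  note isp = Cmp_in_Hom[OF X0 O(2) D sp i] and jup = Cmp_in_Hom[OF X0 O(3) D nup j]
  have x: "x \<in> Hom T X0 D" unfolding x_def by (rule Add_Hom[OF X0 D isp jup])
  have ax: "Cmp T X0 D A' a x = ?sp"
    unfolding x_def
    using Cmp_Add_right[OF X0 D O(2) isp jup a] Cmp_assoc[OF X0 O(2) D O(2) sp i a]
      Cmp_assoc[OF X0 O(3) D O(2) nup j a] ai aj0 Cmp_Idn_left[OF X0 O(2) sp]
      Cmp_Zero_left[OF X0 O(3,2) nup] Add_Zero(1)[OF X0 O(2) sp] by simp
  have bx: "Cmp T X0 D B b x = Neg X0 B ?up"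
    unfolding x_def
    using Cmp_Add_right[OF X0 D O(3) isp jup b] Cmp_assoc[OF X0 O(2) D O(3) sp i b]
      Cmp_assoc[OF X0 O(3) D O(3) nup j b] bj bi0 Cmp_Idn_left[OF X0 O(3) nup]
      Cmp_Zero_left[OF X0 O(2,3) sp] Add_Zero(2)[OF X0 O(3) nup] by simp
  obtain B' g h where t: "Tri T X0 D B' x g h" using TR1_cone[OF X0 D x] by blast
  note B' = TriD(3)[OF t] and g = TriD(5)[OF t]
  let ?u' = "Cmp T A' D B' g i" and ?s' = "Cmp T B D B' g j"
  have u': "?u' \<in> Hom T A' B'" by (rule Cmp_in_Hom[OF O(2) D B' i g])
  have s': "?s' \<in> Hom T B B'" by (rule Cmp_in_Hom[OF O(3) D B' j g])
  have square: "Cmp T X0 A' B' ?u' ?sp = Cmp T X0 B B' ?s' ?up"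
  proof -
    have "Add T X0 B' (Cmp T X0 A' B' ?u' ?sp) (Neg X0 B' (Cmp T X0 B B' ?s' ?up)) = Zero T X0 B'"
      using Tri_Cmp_zero[OF t] unfolding x_def
      using Cmp_Add_right[OF X0 D B' isp jup g] Cmp_assoc[OF X0 O(2) D B' sp i g]
        Cmp_assoc[OF X0 O(3) D B' nup j g] Cmp_Neg_right[OF X0 O(3) B' up s'] by simp
    then show ?thesis
      using Add_Neg_eq_Zero[OF X0 B' Cmp_in_Hom[OF X0 O(2) B' sp u'] Cmp_in_Hom[OF X0 O(3) B' up s']]
      by blast
  qed
  \<comment> \<open>\<open>square\<close> gives commutativity only after \<open>p\<close>. Every map
    from \<open>X\<close> to \<open>A\<close> factors through \<open>p\<close>, so the square
    commutes in the quotient.\<close>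
  have "same_action A B' (Cmp T A A' B' ?u' s) (Cmp T A B B' ?s' u)"
  proof (intro ballI)
    fix Y y assume Y: "Y \<in> X" and y: "y \<in> Hom T Y A"
    note YO = X_Obj[OF Y]
    obtain z where z: "z \<in> Hom T Y X0" "y = Cmp T Y X0 A p z" using p(3)[OF Y y] by blast
    note us = Cmp_in_Hom[OF O(1,2) B' s(1) u'] and su = Cmp_in_Hom[OF O(1,3) B' u(1) s']
    have "Cmp T X0 A B' (Cmp T A A' B' ?u' s) p = Cmp T X0 A B' (Cmp T A B B' ?s' u) p"
      using square Cmp_assoc[OF X0 O(1,2) B' p(2) s(1) u'] Cmp_assoc[OF X0 O(1,3) B' p(2) u(1) s'] by simp
    then show "Cmp T Y A B' (Cmp T A A' B' ?u' s) y = Cmp T Y A B' (Cmp T A B B' ?s' u) y"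
      using z(2) Cmp_assoc[OF YO X0 O(1) B' z(1) p(2) us] Cmp_assoc[OF YO X0 O(1) B' z(1) p(2) su] by simp
  qed
  then have "Cmp Q A A' B' (cls A' B' ?u') S = Cmp Q A B B' (cls B B' ?s') U"
    using Q_Cmp[OF O(1,2) B' s(1) u'] Q_Cmp[OF O(1,3) B' u(1) s'] s(2) u(2)
      cls_eq_iff[OF O(1) B' Cmp_in_Hom[OF O(1,2) B' s(1) u'] Cmp_in_Hom[OF O(1,3) B' u(1) s']] by simp
  moreover have "X_bijective B B' ?s'"
  proof (intro ballI bij_betw_imageI equalityI subsetI)
    fix Y assume Y: "Y \<in> X"
    note YO = X_Obj[OF Y]
    have s_surj: "\<exists>v\<in>Hom T Y A. y = Cmp T Y A A' s v" if "y \<in> Hom T Y A'" for y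
      using s(3) Y that unfolding bij_betw_def by blast
    have s_ker: "v = Zero T Y A" if "v \<in> Hom T Y A" "Cmp T Y A A' s v = Zero T Y A'" for v
    proof -
      have "Cmp T Y A A' s v = Cmp T Y A A' s (Zero T Y A)"
        using that(2) Cmp_Zero_right[OF YO O(1,2) s(1)] by simp
      then show ?thesis
        using s(3) Y that(1) Zero_Hom[OF YO O(1)] unfolding bij_betw_def inj_on_def by blast
    qed
    \<comment> \<open>If \<open>s' y = 0\<close>, then \<open>j y = x v\<close> for some
      \<open>v\<close>. The component in \<open>A'\<close> gives \<open>s p v = 0\<close>, hence
      \<open>p v = 0\<close>, and the component in \<open>B\<close> then gives
      \<open>y = - u p v = 0\<close>.\<close>
    show "inj_on (\<lambda>y. Cmp T Y B B' ?s' y) (Hom T Y B)"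
    proof (rule Cmp_inj_onI[OF YO O(3) B' s'])
      fix y assume y: "y \<in> Hom T Y B" and z: "Cmp T Y B B' ?s' y = Zero T Y B'"
      note jy = Cmp_in_Hom[OF YO O(3) D y j]
      have "Cmp T Y D B' g (Cmp T Y B D j y) = Zero T Y B'"
        using z Cmp_assoc[OF YO O(3) D B' y j g] by simp
      then obtain v where v: "v \<in> Hom T Y X0" "Cmp T Y B D j y = Cmp T Y X0 D x v"
        using Tri_weak_kernel[OF t YO jy] by blast
      note pv = Cmp_in_Hom[OF YO X0 O(1) v(1) p(2)]
      have "Cmp T Y A A' s (Cmp T Y X0 A p v) = Cmp T Y X0 A' ?sp v"
        using Cmp_assoc[OF YO X0 O(1,2) v(1) p(2) s(1)] by simp
      also have "\<dots> = Cmp T Y D A' a (Cmp T Y B D j y)"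
        using Cmp_assoc[OF YO X0 D O(2) v(1) x a] ax v(2) by simp
      also have "\<dots> = Zero T Y A'"
        using Cmp_assoc[OF YO O(3) D O(2) y j a] aj0 Cmp_Zero_left[OF YO O(3,2) y] by simp
      finally have pv0: "Cmp T Y X0 A p v = Zero T Y A" by (rule s_ker[OF pv])
      have "y = Cmp T Y D B b (Cmp T Y B D j y)"
        using Cmp_assoc[OF YO O(3) D O(3) y j b] bj Cmp_Idn_left[OF YO O(3) y] by simp
      also have "\<dots> = Neg Y B (Cmp T Y A B u (Cmp T Y X0 A p v))"
        using Cmp_assoc[OF YO X0 D O(3) v(1) x b] bx v(2) Cmp_Neg_left[OF YO X0 O(3) v(1) up]
          Cmp_assoc[OF YO X0 O(1,3) v(1) p(2) u(1)] by simp
      also have "\<dots> = Zero T Y B"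
        using pv0 Cmp_Zero_right[OF YO O(1,3) u(1)] Neg_Zero[OF YO O(3)] by simp
      finally show "y = Zero T Y B" .
    qed
    show "y \<in> Hom T Y B'" if "y \<in> (\<lambda>y. Cmp T Y B B' ?s' y) ` Hom T Y B" for y
      using that Cmp_in_Hom[OF YO O(3) B' _ s'] by blast
    \<comment> \<open>\<open>y\<close> lifts to \<open>d : Y \<rightarrow> D\<close>. The component
      of \<open>d\<close> in \<open>A'\<close> has the form \<open>s p z\<close>, and the square
      trades \<open>u' s p z\<close> for \<open>s' u p z\<close>, so that \<open>y\<close> becomes a
      value of \<open>s'\<close>.\<close>
    show "y \<in> (\<lambda>y. Cmp T Y B B' ?s' y) ` Hom T Y B" if y: "y \<in> Hom T Y B'" for y
    proof -
      obtain d where d: "d \<in> Hom T Y D" "y = Cmp T Y D B' g d" using cone_lift[OF t p(1) Y y] by blast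
      note ad = Cmp_in_Hom[OF YO D O(2) d(1) a] and bd = Cmp_in_Hom[OF YO D O(3) d(1) b]
      obtain v where v: "v \<in> Hom T Y A" "Cmp T Y D A' a d = Cmp T Y A A' s v" using s_surj[OF ad] by blast
      obtain z where z: "z \<in> Hom T Y X0" "v = Cmp T Y X0 A p z" using p(3)[OF Y v(1)] by blast
      note iad = Cmp_in_Hom[OF YO O(2) D ad i] and jbd = Cmp_in_Hom[OF YO O(3) D bd j]
        and upz = Cmp_in_Hom[OF YO X0 O(3) z(1) up]
      have "d = Add T Y D (Cmp T Y A' D i (Cmp T Y D A' a d)) (Cmp T Y B D j (Cmp T Y D B b d))"
        using Cmp_Add_left[OF YO D D d(1) Cmp_in_Hom[OF D O(2) D a i] Cmp_in_Hom[OF D O(3) D b j]] sum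
          Cmp_assoc[OF YO D O(2) D d(1) a i] Cmp_assoc[OF YO D O(3) D d(1) b j] Cmp_Idn_left[OF YO D d(1)]
        by simp
      then have "y = Add T Y B' (Cmp T Y A' B' ?u' (Cmp T Y D A' a d)) (Cmp T Y B B' ?s' (Cmp T Y D B b d))"
        using d(2) Cmp_Add_right[OF YO D B' iad jbd g] Cmp_assoc[OF YO O(2) D B' ad i g]
          Cmp_assoc[OF YO O(3) D B' bd j g] by simp
      also have "Cmp T Y A' B' ?u' (Cmp T Y D A' a d) = Cmp T Y X0 B' (Cmp T X0 A' B' ?u' ?sp) z"
        using v(2) z(2) Cmp_assoc[OF YO X0 O(1,2) z(1) p(2) s(1)] Cmp_assoc[OF YO X0 O(2) B' z(1) sp u'] by simp
      also have "\<dots> = Cmp T Y B B' ?s' (Cmp T Y X0 B ?up z)"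
        using square Cmp_assoc[OF YO X0 O(3) B' z(1) up s'] by simp
      finally have "y = Cmp T Y B B' ?s' (Add T Y B (Cmp T Y X0 B ?up z) (Cmp T Y D B b d))"
        using Cmp_Add_right[OF YO O(3) B' upz bd s'] by simp
      then show ?thesis using Add_Hom[OF YO O(3) upz bd] by blast
    qed
  qed
  then have "cls B B' ?s' \<in> R B B'" by (rule X_bijective_regular[OF O(3) B' s'])
  moreover have "cls A' B' ?u' \<in> Hom Q A' B'" by (rule cls_in_Q[OF u'])
  ultimately show ?thesis using B' by auto
qed

lemma left_fractions_R: "left_fractions Q R"
  unfolding left_fractions_def
proof (intro conjI ballI impI)
  show "R A B \<subseteq> Hom Q A B" for A B by (auto simp: regular_maps_def)
  show "Idn Q A \<in> R A A" if "A \<in> Obj Q" for A by (rule Q.regular_maps_Idn[OF that])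
  show "Cmp Q A B D t s \<in> R A D"
    if "A \<in> Obj Q" "B \<in> Obj Q" "D \<in> Obj Q" "s \<in> R A B" "t \<in> R B D" for A B D s t
    by (rule Q.regular_maps_Cmp[OF that])
  show "\<exists>B'\<in>Obj Q. \<exists>s'\<in>R B B'. \<exists>u'\<in>Hom Q A' B'. Cmp Q A A' B' u' s = Cmp Q A B B' s' u"
    if "A \<in> Obj Q" "A' \<in> Obj Q" "B \<in> Obj Q" "s \<in> R A A'" "u \<in> Hom Q A B" for A A' B s u
    using left_Ore that by simp
  show "\<exists>B'\<in>Obj Q. \<exists>t\<in>R B B'. Cmp Q A B B' t f = Cmp Q A B B' t g"
    if "A' \<in> Obj Q" "A \<in> Obj Q" "B \<in> Obj Q" "s \<in> R A' A" "f \<in> Hom Q A B" "g \<in> Hom Q A B"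
      "Cmp Q A' A B f s = Cmp Q A' A B g s" for A' A B s f g
  proof -
    \<comment> \<open>Regular maps are epic, so the cancellation axiom holds with an identity as
      \<open>t\<close>.\<close>
    have "f = g" using that unfolding regular_maps_def epi_mor_def by blast
    then show ?thesis using that(3) Q.regular_maps_Idn by blast
  qed
qed

lemma right_fractions_R: "right_fractions Q R"
  unfolding right_fractions_def left_fractions_def op_cat_def cat.simps
proof (intro conjI ballI impI)
  show "R B A \<subseteq> Hom Q B A" for A B by (auto simp: regular_maps_def)
  show "Idn Q A \<in> R A A" if "A \<in> Obj Q" for A by (rule Q.regular_maps_Idn[OF that])
  show "Cmp Q D B A s t \<in> R D A"
    if "A \<in> Obj Q" "B \<in> Obj Q" "D \<in> Obj Q" "s \<in> R B A" "t \<in> R D B" for A B D s t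
    by (rule Q.regular_maps_Cmp[OF that(3,2,1,5,4)])
  show "\<exists>B'\<in>Obj Q. \<exists>s'\<in>R B' B. \<exists>u'\<in>Hom Q B' A'. Cmp Q B' A' A s u' = Cmp Q B' B A u s'"
    if "A \<in> Obj Q" "A' \<in> Obj Q" "B \<in> Obj Q" "s \<in> R A' A" "u \<in> Hom Q B A" for A A' B s u
    using right_Ore that by simp
  show "\<exists>B'\<in>Obj Q. \<exists>t\<in>R B' B. Cmp Q B' B A f t = Cmp Q B' B A g t"
    if "A' \<in> Obj Q" "A \<in> Obj Q" "B \<in> Obj Q" "s \<in> R A A'" "f \<in> Hom Q B A" "g \<in> Hom Q B A"
      "Cmp Q B A A' s f = Cmp Q B A A' s g" for A' A B s f g
  proof -
    have "f = g" using that unfolding regular_maps_def mono_mor_def by blast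
    then show ?thesis using that(3) Q.regular_maps_Idn by blast
  qed
qed

end

section \<open>Coherent functors\<close>

lemma Ab_simps:
  "Obj Ab_cat = {G. comm_group G}"
  "Hom Ab_cat G H = hom G H \<inter> extensional (carrier G)"
  "Idn Ab_cat G = (\<lambda>x\<in>carrier G. x)"
  "Cmp Ab_cat G H K \<psi> \<phi> = compose (carrier G) \<psi> \<phi>"
  by (simp_all add: Ab_cat_def)

lemma category_Ab: "category Ab_cat"
proof (unfold_locales, unfold Ab_simps)
  show "(\<lambda>x\<in>carrier G. x) \<in> hom G G \<inter> extensional (carrier G)"
    if "G \<in> {G. comm_group G}" for G :: "'g monoid"
  proof -
    interpret comm_group G using that by simp
    show ?thesis by (auto simp: hom_def)
  qed
  show "compose (carrier A) g f \<in> hom A D \<inter> extensional (carrier A)"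
    if "A \<in> {G. comm_group G}" "f \<in> hom A B \<inter> extensional (carrier A)"
      "g \<in> hom B D \<inter> extensional (carrier B)" for A B D :: "'g monoid" and f g
  proof -
    interpret comm_group A using that by simp
    show ?thesis using that hom_compose by (auto simp: compose_extensional)
  qed
  show "compose (carrier A) f (\<lambda>x\<in>carrier A. x) = f"
    if "f \<in> hom A B \<inter> extensional (carrier A)" for A B :: "'g monoid" and f
    using that by (intro extensionalityI[of _ "carrier A"]) (auto simp: compose_def)
  show "compose (carrier A) (\<lambda>x\<in>carrier B. x) f = f"
    if "f \<in> hom A B \<inter> extensional (carrier A)" for A B :: "'g monoid" and f
    using that by (intro extensionalityI[of _ "carrier A"]) (auto simp: compose_def hom_def)
  show "compose (carrier A) (compose (carrier B) h g) f = compose (carrier A) h (compose (carrier A) g f)"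
    if "f \<in> hom A B \<inter> extensional (carrier A)" for A B :: "'g monoid" and f g h
    using that by (intro extensionalityI[of _ "carrier A"]) (auto simp: compose_def hom_def)
qed

lemma nat_trans_Idn:
  assumes D: "category D" and F: "is_functor C D F"
  shows "nat_trans C D F F (\<lambda>A. Idn D (Fo F A))"
  using is_functorD(1,2)[OF F] category.Idn_in_Hom[OF D] category.Cmp_Idn_left[OF D]
    category.Cmp_Idn_right[OF D]
  unfolding nat_trans_def by simp

lemma nat_trans_Cmp:
  assumes D: "category D" and F: "is_functor C D F" and G: "is_functor C D G" and H: "is_functor C D H"
    and \<alpha>: "nat_trans C D F G \<alpha>" and \<beta>: "nat_trans C D G H \<beta>"
  shows "nat_trans C D F H (\<lambda>A. Cmp D (Fo F A) (Fo G A) (Fo H A) (\<beta> A) (\<alpha> A))"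
  unfolding nat_trans_def
proof (intro conjI ballI)
  interpret D: category D by (rule D)
  note FO = is_functorD(1)[OF F] and GO = is_functorD(1)[OF G] and HO = is_functorD(1)[OF H]
  have a: "\<And>A. A \<in> Obj C \<Longrightarrow> \<alpha> A \<in> Hom D (Fo F A) (Fo G A)"
    and b: "\<And>A. A \<in> Obj C \<Longrightarrow> \<beta> A \<in> Hom D (Fo G A) (Fo H A)"
    using \<alpha> \<beta> unfolding nat_trans_def by blast+
  show "Cmp D (Fo F A) (Fo G A) (Fo H A) (\<beta> A) (\<alpha> A) \<in> Hom D (Fo F A) (Fo H A)" if "A \<in> Obj C" for A
    by (rule D.Cmp_in_Hom[OF FO[OF that] GO[OF that] HO[OF that] a[OF that] b[OF that]])
  fix A B f assume A: "A \<in> Obj C" and B: "B \<in> Obj C" and f: "f \<in> Hom C A B"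
  note Ff = is_functorD(2)[OF F A B f] and Gf = is_functorD(2)[OF G A B f] and Hf = is_functorD(2)[OF H A B f]
  have na: "Cmp D (Fo F A) (Fo G A) (Fo G B) (Fm G A B f) (\<alpha> A) =
      Cmp D (Fo F A) (Fo F B) (Fo G B) (\<alpha> B) (Fm F A B f)"
    and nb: "Cmp D (Fo G A) (Fo H A) (Fo H B) (Fm H A B f) (\<beta> A) =
      Cmp D (Fo G A) (Fo G B) (Fo H B) (\<beta> B) (Fm G A B f)"
    using \<alpha> \<beta> A B f unfolding nat_trans_def by blast+
  show "Cmp D (Fo F A) (Fo H A) (Fo H B) (Fm H A B f) (Cmp D (Fo F A) (Fo G A) (Fo H A) (\<beta> A) (\<alpha> A)) =
      Cmp D (Fo F A) (Fo F B) (Fo H B) (Cmp D (Fo F B) (Fo G B) (Fo H B) (\<beta> B) (\<alpha> B)) (Fm F A B f)"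
    using D.Cmp_assoc[OF FO[OF A] GO[OF A] HO[OF A] HO[OF B] a[OF A] b[OF A] Hf]
      D.Cmp_assoc[OF FO[OF A] GO[OF A] GO[OF B] HO[OF B] a[OF A] Gf b[OF B]]
      D.Cmp_assoc[OF FO[OF A] FO[OF B] GO[OF B] HO[OF B] Ff a[OF B] b[OF B]] na nb by simp
qed

abbreviation presheaf_cat where "presheaf_cat C X \<equiv> op_cat (full_subcat C X)"

lemma presheaf_cat_simps [simp]:
  "Obj (presheaf_cat C X) = X"
  "Hom (presheaf_cat C X) A B = Hom C B A"
  "Idn (presheaf_cat C X) A = Idn C A"
  "Cmp (presheaf_cat C X) A B D g f = Cmp C D B A f g"
  by (simp_all add: op_cat_def full_subcat_def)

lemma nat_trans_restrict [simp]:
  "nat_trans (presheaf_cat C X) D F G (restrict \<alpha> X) \<longleftrightarrow> nat_trans (presheaf_cat C X) D F G \<alpha>"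
  unfolding nat_trans_def by simp

lemma compose_eq_iff: "compose S g f = compose S g' f' \<longleftrightarrow> (\<forall>x\<in>S. g (f x) = g' (f' x))"
  by (auto simp: compose_def fun_eq_iff restrict_def)

lemma nat_trans_Ab_iff:
  "nat_trans (presheaf_cat C X) Ab_cat F G \<alpha> \<longleftrightarrow>
     (\<forall>Y\<in>X. \<alpha> Y \<in> hom (Fo F Y) (Fo G Y) \<and> \<alpha> Y \<in> extensional (carrier (Fo F Y))) \<and>
     (\<forall>Y\<in>X. \<forall>Z\<in>X. \<forall>f\<in>Hom C Z Y. \<forall>x\<in>carrier (Fo F Y).
        Fm G Y Z f (\<alpha> Y x) = \<alpha> Z (Fm F Y Z f x))"
  unfolding nat_trans_def by (simp add: Ab_simps compose_eq_iff)

lemma mod_cat_simps: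
  "Obj (mod_cat C X) = {F. coherent C X F}"
  "Hom (mod_cat C X) F G = {\<alpha> \<in> extensional X. nat_trans (presheaf_cat C X) Ab_cat F G \<alpha>}"
  "Idn (mod_cat C X) F = (\<lambda>A\<in>X. Idn Ab_cat (Fo F A))"
  "Cmp (mod_cat C X) F G H \<beta> \<alpha> = (\<lambda>A\<in>X. Cmp Ab_cat (Fo F A) (Fo G A) (Fo H A) (\<beta> A) (\<alpha> A))"
  by (simp_all add: mod_cat_def)

lemma coherent_functor: "coherent C X F \<Longrightarrow> is_functor (presheaf_cat C X) Ab_cat F"
  unfolding coherent_def by blast

lemma category_mod_cat: "category (mod_cat C X)"
proof (unfold_locales, unfold mod_cat_simps mem_Collect_eq)
  interpret Ab: category Ab_cat by (rule category_Ab)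
  have Ob: "Fo F Y \<in> Obj Ab_cat" if "coherent C X F" "Y \<in> X" for F Y
    using is_functorD(1)[OF coherent_functor[OF that(1)]] that(2) by simp
  have nt: "\<alpha> Y \<in> Hom Ab_cat (Fo F Y) (Fo G Y)"
    if "\<alpha> \<in> extensional X \<and> nat_trans (presheaf_cat C X) Ab_cat F G \<alpha>" "Y \<in> X" for F G \<alpha> Y
    using that unfolding nat_trans_def by simp
  show "(\<lambda>A\<in>X. Idn Ab_cat (Fo F A)) \<in> extensional X \<and>
      nat_trans (presheaf_cat C X) Ab_cat F F (\<lambda>A\<in>X. Idn Ab_cat (Fo F A))" if "coherent C X F" for F
    using nat_trans_Idn[OF category_Ab coherent_functor[OF that]] by simp
  show "(\<lambda>Y\<in>X. Cmp Ab_cat (Fo F Y) (Fo G Y) (Fo H Y) (\<beta> Y) (\<alpha> Y)) \<in> extensional X \<and>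
      nat_trans (presheaf_cat C X) Ab_cat F H (\<lambda>Y\<in>X. Cmp Ab_cat (Fo F Y) (Fo G Y) (Fo H Y) (\<beta> Y) (\<alpha> Y))"
    if "coherent C X F" "coherent C X G" "coherent C X H"
      "\<alpha> \<in> extensional X \<and> nat_trans (presheaf_cat C X) Ab_cat F G \<alpha>"
      "\<beta> \<in> extensional X \<and> nat_trans (presheaf_cat C X) Ab_cat G H \<beta>" for F G H \<alpha> \<beta>
    using nat_trans_Cmp[OF category_Ab coherent_functor[OF that(1)] coherent_functor[OF that(2)]
        coherent_functor[OF that(3)], of \<alpha> \<beta>] that(4,5) by simp
  show "(\<lambda>Y\<in>X. Cmp Ab_cat (Fo F Y) (Fo F Y) (Fo G Y) (\<alpha> Y) ((\<lambda>A\<in>X. Idn Ab_cat (Fo F A)) Y)) = \<alpha>"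
    if "coherent C X F" "coherent C X G"
      "\<alpha> \<in> extensional X \<and> nat_trans (presheaf_cat C X) Ab_cat F G \<alpha>" for F G \<alpha>
    by (rule extensionalityI[of _ X])
      (use that Ab.Cmp_Idn_right[OF Ob[OF that(1)] Ob[OF that(2)] nt[OF that(3)]] in simp_all)
  show "(\<lambda>Y\<in>X. Cmp Ab_cat (Fo F Y) (Fo G Y) (Fo G Y) ((\<lambda>A\<in>X. Idn Ab_cat (Fo G A)) Y) (\<alpha> Y)) = \<alpha>"
    if "coherent C X F" "coherent C X G"
      "\<alpha> \<in> extensional X \<and> nat_trans (presheaf_cat C X) Ab_cat F G \<alpha>" for F G \<alpha>
    by (rule extensionalityI[of _ X])
      (use that Ab.Cmp_Idn_left[OF Ob[OF that(1)] Ob[OF that(2)] nt[OF that(3)]] in simp_all)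
  show "(\<lambda>Y\<in>X. Cmp Ab_cat (Fo F Y) (Fo G Y) (Fo K Y)
          ((\<lambda>Y\<in>X. Cmp Ab_cat (Fo G Y) (Fo H Y) (Fo K Y) (\<kappa> Y) (\<beta> Y)) Y) (\<alpha> Y)) =
      (\<lambda>Y\<in>X. Cmp Ab_cat (Fo F Y) (Fo H Y) (Fo K Y) (\<kappa> Y)
          ((\<lambda>Y\<in>X. Cmp Ab_cat (Fo F Y) (Fo G Y) (Fo H Y) (\<beta> Y) (\<alpha> Y)) Y))"
    if "coherent C X F" "coherent C X G" "coherent C X H" "coherent C X K"
      "\<alpha> \<in> extensional X \<and> nat_trans (presheaf_cat C X) Ab_cat F G \<alpha>"
      "\<beta> \<in> extensional X \<and> nat_trans (presheaf_cat C X) Ab_cat G H \<beta>"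
      "\<kappa> \<in> extensional X \<and> nat_trans (presheaf_cat C X) Ab_cat H K \<kappa>" for F G H K \<alpha> \<beta> \<kappa>
    by (rule restrict_ext)
      (use Ab.Cmp_assoc[OF Ob[OF that(1)] Ob[OF that(2)] Ob[OF that(3)] Ob[OF that(4)]
          nt[OF that(5)] nt[OF that(6)] nt[OF that(7)]] in simp)
qed

text \<open>Pointwise inverses of bijective components are again additive and natural. They are
  restricted because hom-sets of \<open>mod_cat\<close> and \<open>Ab_cat\<close> consist of
  extensional functions.\<close>

lemma mod_iso_if_bij:
  assumes F: "coherent C X F" and G: "coherent C X G"
    and \<alpha>: "\<alpha> \<in> Hom (mod_cat C X) F G"
    and bij: "\<And>Y. Y \<in> X \<Longrightarrow> bij_betw (\<alpha> Y) (carrier (Fo F Y)) (carrier (Fo G Y))"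
  shows "iso_mor (mod_cat C X) F G \<alpha>"
proof -
  have grp: "group (Fo F Y)" "group (Fo G Y)" if "Y \<in> X" for Y
    using is_functorD(1)[OF coherent_functor[OF F]] is_functorD(1)[OF coherent_functor[OF G]] that
    by (auto simp: Ab_simps comm_group_def)
  have aH: "\<alpha> Y \<in> hom (Fo F Y) (Fo G Y)" and aE: "\<alpha> Y \<in> extensional (carrier (Fo F Y))" if "Y \<in> X" for Y
    using \<alpha> that unfolding mod_cat_simps nat_trans_Ab_iff by blast+
  have nat: "Fm G Y Z f (\<alpha> Y x) = \<alpha> Z (Fm F Y Z f x)"
    if "Y \<in> X" "Z \<in> X" "f \<in> Hom C Z Y" "x \<in> carrier (Fo F Y)" for Y Z f x
    using \<alpha> that unfolding mod_cat_simps nat_trans_Ab_iff by blast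
  have FmF: "Fm F Y Z f x \<in> carrier (Fo F Z)"
    if "Y \<in> X" "Z \<in> X" "f \<in> Hom C Z Y" "x \<in> carrier (Fo F Y)" for Y Z f x
    using is_functorD(2)[OF coherent_functor[OF F], of Y Z f] that by (auto simp: Ab_simps hom_def)
  have FmG: "Fm G Y Z f x \<in> carrier (Fo G Z)"
    if "Y \<in> X" "Z \<in> X" "f \<in> Hom C Z Y" "x \<in> carrier (Fo G Y)" for Y Z f x
    using is_functorD(2)[OF coherent_functor[OF G], of Y Z f] that by (auto simp: Ab_simps hom_def)
  define b where "b Y = the_inv_into (carrier (Fo F Y)) (\<alpha> Y)" for Y
  have b1: "b Y (\<alpha> Y x) = x" if "Y \<in> X" "x \<in> carrier (Fo F Y)" for Y x
    using bij[OF that(1)] that(2) unfolding b_def bij_betw_def by (simp add: the_inv_into_f_f)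
  have b2: "\<alpha> Y (b Y y) = y" if "Y \<in> X" "y \<in> carrier (Fo G Y)" for Y y
    using f_the_inv_into_f_bij_betw[OF bij[OF that(1)]] that(2) unfolding b_def by blast
  have b3: "b Y y \<in> carrier (Fo F Y)" if "Y \<in> X" "y \<in> carrier (Fo G Y)" for Y y
    using bij_betw_apply[OF bij_betw_the_inv_into[OF bij[OF that(1)]] that(2)] unfolding b_def .
  have a3: "\<alpha> Y x \<in> carrier (Fo G Y)" if "Y \<in> X" "x \<in> carrier (Fo F Y)" for Y x
    using bij_betw_apply[OF bij[OF that(1)] that(2)] .
  define \<beta> where "\<beta> = (\<lambda>Y\<in>X. restrict (b Y) (carrier (Fo G Y)))"
  have bH: "b Y (x \<otimes>\<^bsub>Fo G Y\<^esub> y) = b Y x \<otimes>\<^bsub>Fo F Y\<^esub> b Y y"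
    if Y: "Y \<in> X" and x: "x \<in> carrier (Fo G Y)" and y: "y \<in> carrier (Fo G Y)" for Y x y
  proof -
    interpret F: group "Fo F Y" by (rule grp(1)[OF Y])
    have "\<alpha> Y (b Y x \<otimes>\<^bsub>Fo F Y\<^esub> b Y y) = x \<otimes>\<^bsub>Fo G Y\<^esub> y"
      using hom_mult[OF aH[OF Y] b3[OF Y x] b3[OF Y y]] b2[OF Y x] b2[OF Y y] by simp
    then show ?thesis using b1[OF Y F.m_closed[OF b3[OF Y x] b3[OF Y y]]] by simp
  qed
  have "\<beta> \<in> Hom (mod_cat C X) G F"
    unfolding mod_cat_simps mem_Collect_eq nat_trans_Ab_iff
  proof (intro conjI ballI)
    show "\<beta> \<in> extensional X" by (simp add: \<beta>_def)
    fix Y assume Y: "Y \<in> X"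
    interpret G: group "Fo G Y" by (rule grp(2)[OF Y])
    show "\<beta> Y \<in> extensional (carrier (Fo G Y))" using Y by (simp add: \<beta>_def)
    show "\<beta> Y \<in> hom (Fo G Y) (Fo F Y)"
      by (rule homI) (use Y b3[OF Y] bH[OF Y] in \<open>simp_all add: \<beta>_def\<close>)
    fix Z f y assume Z: "Z \<in> X" and f: "f \<in> Hom C Z Y" and y: "y \<in> carrier (Fo G Y)"
    have "b Z (Fm G Y Z f y) = Fm F Y Z f (b Y y)"
      using nat[OF Y Z f b3[OF Y y]] b2[OF Y y] b1[OF Z FmF[OF Y Z f b3[OF Y y]]] by simp
    then show "Fm F Y Z f (\<beta> Y y) = \<beta> Z (Fm G Y Z f y)"
      using Y Z y FmG[OF Y Z f y] by (simp add: \<beta>_def)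
  qed
  moreover have "Cmp (mod_cat C X) F G F \<beta> \<alpha> = Idn (mod_cat C X) F"
    unfolding mod_cat_simps Ab_simps
    by (intro restrict_ext) (use b1 a3 in \<open>auto simp: \<beta>_def compose_def intro!: restrict_ext\<close>)
  moreover have "Cmp (mod_cat C X) G F G \<alpha> \<beta> = Idn (mod_cat C X) G"
    unfolding mod_cat_simps Ab_simps
    by (intro restrict_ext) (use b2 b3 in \<open>auto simp: \<beta>_def compose_def intro!: restrict_ext\<close>)
  ultimately show ?thesis unfolding iso_mor_def using \<alpha> by blast
qed

section \<open>The comparison functor to coherent functors\<close>

context rigid_subcategory
begin

abbreviation "M \<equiv> mod_cat T X"
abbreviation "rep \<equiv> representable T"

lemma rep_simps [simp]:
  "Fo (rep A) Y = hom_group T Y A"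
  "Fm (rep A) Y Z f = (\<lambda>x\<in>Hom T Y A. Cmp T Z Y A x f)"
  by (simp_all add: representable_def)

text \<open>The action of \<open>f\<close> as a transformation of restricted representables. One
  restriction is for extensionality in \<open>M\<close>, the other for extensionality in
  \<open>Ab_cat\<close>.\<close>

definition postcomp where
  "postcomp A B f = (\<lambda>Y\<in>X. \<lambda>x\<in>Hom T Y A. Cmp T Y A B f x)"

lemma postcomp_apply: "\<lbrakk>Y \<in> X; x \<in> Hom T Y A\<rbrakk> \<Longrightarrow> postcomp A B f Y x = Cmp T Y A B f x"
  by (simp add: postcomp_def)

lemma postcomp_eq_iff: "postcomp A B f = postcomp A B g \<longleftrightarrow> same_action A B f g"
proof
  assume eq: "postcomp A B f = postcomp A B g"
  show "same_action A B f g"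
  proof (intro ballI)
    fix Y x assume "Y \<in> X" "x \<in> Hom T Y A"
    then show "Cmp T Y A B f x = Cmp T Y A B g x"
      using postcomp_apply[of Y x A B f] postcomp_apply[of Y x A B g] eq by simp
  qed
next
  assume "same_action A B f g"
  then show "postcomp A B f = postcomp A B g"
    unfolding postcomp_def by (intro restrict_ext) simp
qed

lemma nat_trans_postcomp:
  assumes A: "A \<in> Obj T" and B: "B \<in> Obj T" and f: "f \<in> Hom T A B"
  shows "nat_trans (presheaf_cat T X) Ab_cat (rep A) (rep B) (postcomp A B f)"
  unfolding nat_trans_Ab_iff
proof (intro conjI ballI)
  fix Y assume Y: "Y \<in> X"
  note YO = X_Obj[OF Y]
  show "postcomp A B f Y \<in> extensional (carrier (Fo (rep A) Y))" using Y by (simp add: postcomp_def)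
  show "postcomp A B f Y \<in> hom (Fo (rep A) Y) (Fo (rep B) Y)"
    by (rule homI)
      (use Y Cmp_in_Hom[OF YO A B _ f] Cmp_Add_right[OF YO A B _ _ f] Add_Hom[OF YO A]
        in \<open>simp_all add: postcomp_def\<close>)
  fix Z g x assume Z: "Z \<in> X" and g: "g \<in> Hom T Z Y" and x: "x \<in> carrier (Fo (rep A) Y)"
  then have x: "x \<in> Hom T Y A" by simp
  note ZO = X_Obj[OF Z]
  show "Fm (rep B) Y Z g (postcomp A B f Y x) = postcomp A B f Z (Fm (rep A) Y Z g x)"
    using Y Z x Cmp_in_Hom[OF YO A B x f] Cmp_in_Hom[OF ZO YO A g x] Cmp_assoc[OF ZO YO A B g x f]
    by (simp add: postcomp_def)
qed

lemma rep_functor: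
  assumes A: "A \<in> Obj T"
  shows "is_functor (presheaf_cat T X) Ab_cat (rep A)"
  unfolding is_functor_def
proof (intro conjI ballI, unfold presheaf_cat_simps Ab_simps)
  show "Fo (rep A) Y \<in> {G. comm_group G}" if "Y \<in> X" for Y
    using hom_comm_group[OF X_Obj[OF that] A] by simp
  show "Fm (rep A) Y Z f \<in> hom (Fo (rep A) Y) (Fo (rep A) Z) \<inter> extensional (carrier (Fo (rep A) Y))"
    if "Y \<in> X" "Z \<in> X" "f \<in> Hom T Z Y" for Y Z f
  proof (intro IntI homI)
    note Y = X_Obj[OF that(1)] and Z = X_Obj[OF that(2)]
    show "Fm (rep A) Y Z f x \<in> carrier (Fo (rep A) Z)" if "x \<in> carrier (Fo (rep A) Y)" for x
      using that Cmp_in_Hom[OF Z Y A \<open>f \<in> Hom T Z Y\<close>] by simp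
    show "Fm (rep A) Y Z f (x \<otimes>\<^bsub>Fo (rep A) Y\<^esub> y) =
        Fm (rep A) Y Z f x \<otimes>\<^bsub>Fo (rep A) Z\<^esub> Fm (rep A) Y Z f y"
      if "x \<in> carrier (Fo (rep A) Y)" "y \<in> carrier (Fo (rep A) Y)" for x y
      using that Cmp_Add_left[OF Z Y A \<open>f \<in> Hom T Z Y\<close>] Add_Hom[OF Y A] by simp
  qed simp
  show "Fm (rep A) Y Y (Idn T Y) = (\<lambda>x\<in>carrier (Fo (rep A) Y). x)" if "Y \<in> X" for Y
    using Cmp_Idn_right[OF X_Obj[OF that] A] by (auto intro!: restrict_ext)
  show "Fm (rep A) Y W (Cmp T W Z Y f g) = compose (carrier (Fo (rep A) Y)) (Fm (rep A) Z W g) (Fm (rep A) Y Z f)"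
    if "Y \<in> X" "Z \<in> X" "W \<in> X" "f \<in> Hom T Z Y" "g \<in> Hom T W Z" for Y Z W f g
  proof -
    note Y = X_Obj[OF that(1)] and Z = X_Obj[OF that(2)] and W = X_Obj[OF that(3)]
    show ?thesis
      using Cmp_assoc[OF W Z Y A that(5,4)] Cmp_in_Hom[OF Z Y A that(4)]
      by (auto simp: compose_def intro!: restrict_ext)
  qed
qed

text \<open>\<open>X_presentation\<close> supplies the exact sequence, even though \<open>A\<close>
  itself need not lie in \<open>X\<close>.\<close>

lemma rep_coherent:
  assumes A: "A \<in> Obj T"
  shows "coherent T X (rep A)"
proof -
  obtain X1 X0 m p where p: "X1 \<in> X" "X0 \<in> X" "m \<in> Hom T X1 X0" "p \<in> Hom T X0 A"
    "Cmp T X1 X0 A p m = Zero T X1 A"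
    "\<And>Y y. \<lbrakk>Y \<in> X; y \<in> Hom T Y A\<rbrakk> \<Longrightarrow> \<exists>z\<in>Hom T Y X0. y = Cmp T Y X0 A p z"
    "\<And>Y y. \<lbrakk>Y \<in> X; y \<in> Hom T Y X0; Cmp T Y X0 A p y = Zero T Y A\<rbrakk>
      \<Longrightarrow> \<exists>z\<in>Hom T Y X1. y = Cmp T Y X1 X0 m z"
    using X_presentation[OF A] by metis
  note X1 = X_Obj[OF p(1)] and X0 = X_Obj[OF p(2)]
  have "postcomp X1 X0 m Y ` carrier (hom_group T Y X1) =
        kernel (hom_group T Y X0) (Fo (rep A) Y) (postcomp X0 A p Y) \<and>
      postcomp X0 A p Y ` carrier (hom_group T Y X0) = carrier (Fo (rep A) Y)" if Y: "Y \<in> X" for Y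
  proof (intro conjI equalityI subsetI)
    note YO = X_Obj[OF Y]
    show "y \<in> kernel (hom_group T Y X0) (Fo (rep A) Y) (postcomp X0 A p Y)"
      if y: "y \<in> postcomp X1 X0 m Y ` carrier (hom_group T Y X1)" for y
    proof -
      obtain z where z: "z \<in> Hom T Y X1" "y = Cmp T Y X1 X0 m z"
        using y by (auto simp: postcomp_apply[OF Y])
      have "Cmp T Y X0 A p y = Zero T Y A"
        using z(2) Cmp_assoc[OF YO X1 X0 A z(1) p(3,4)] p(5) Cmp_Zero_left[OF YO X1 A z(1)] by simp
      then show ?thesis
        using z(2) Cmp_in_Hom[OF YO X1 X0 z(1) p(3)] by (simp add: kernel_def postcomp_apply[OF Y])
    qed
    show "y \<in> postcomp X1 X0 m Y ` carrier (hom_group T Y X1)"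
      if y: "y \<in> kernel (hom_group T Y X0) (Fo (rep A) Y) (postcomp X0 A p Y)" for y
    proof -
      have "y \<in> Hom T Y X0" "Cmp T Y X0 A p y = Zero T Y A"
        using y by (auto simp: kernel_def postcomp_apply[OF Y])
      then obtain z where "z \<in> Hom T Y X1" "y = Cmp T Y X1 X0 m z" using p(7)[OF Y] by blast
      then show ?thesis using postcomp_apply[OF Y] by (auto intro!: image_eqI)
    qed
    show "y \<in> carrier (Fo (rep A) Y)" if "y \<in> postcomp X0 A p Y ` carrier (hom_group T Y X0)" for y
      using that Cmp_in_Hom[OF YO X0 A _ p(4)] by (auto simp: postcomp_apply[OF Y])
    show "y \<in> postcomp X0 A p Y ` carrier (hom_group T Y X0)" if y: "y \<in> carrier (Fo (rep A) Y)" for y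
    proof -
      obtain z where "z \<in> Hom T Y X0" "y = Cmp T Y X0 A p z" using p(6)[OF Y, of y] y by auto
      then show ?thesis using postcomp_apply[OF Y] by (auto intro!: image_eqI)
    qed
  qed
  then show ?thesis
    unfolding coherent_def
    using rep_functor[OF A] p(1,2) nat_trans_postcomp[OF X1 X0 p(3)] nat_trans_postcomp[OF X0 A p(4)]
    by blast
qed

lemma postcomp_in_M:
  "\<lbrakk>A \<in> Obj T; B \<in> Obj T; f \<in> Hom T A B\<rbrakk> \<Longrightarrow> postcomp A B f \<in> Hom M (rep A) (rep B)"
  using nat_trans_postcomp by (simp add: mod_cat_simps) (simp add: postcomp_def)

text \<open>A representative of the class is chosen; by \<open>postcomp_eq_iff\<close> the result
  does not depend on it, see \<open>H_cls\<close>.\<close>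

definition H where
  "H = \<lparr>Fo = rep, Fm = (\<lambda>A B F. postcomp A B (SOME f. f \<in> F))\<rparr>"

lemma H_Fo [simp]: "Fo H A = rep A" by (simp add: H_def)

lemma H_cls:
  assumes "A \<in> Obj T" "B \<in> Obj T" "f \<in> Hom T A B"
  shows "Fm H A B (cls A B f) = postcomp A B f"
proof -
  have "(SOME g. g \<in> cls A B f) \<in> cls A B f" using cls_self[OF assms] by (rule someI)
  then have "same_action A B (SOME g. g \<in> cls A B f) f" unfolding cls_eq[OF assms] by blast
  then show ?thesis unfolding H_def by (simp add: postcomp_eq_iff)
qed

lemma H_functor: "is_functor Q M H"
  unfolding is_functor_def
proof (intro conjI ballI)
  show "Fo H A \<in> Obj M" if "A \<in> Obj Q" for A
    using that rep_coherent by (simp add: mod_cat_simps)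
  show "Fm H A B F \<in> Hom M (Fo H A) (Fo H B)" if "A \<in> Obj Q" "B \<in> Obj Q" "F \<in> Hom Q A B" for A B F
    using that postcomp_in_M H_cls by (auto simp: Q_Hom)
  show "Fm H A A (Idn Q A) = Idn M (Fo H A)" if "A \<in> Obj Q" for A
  proof -
    have A: "A \<in> Obj T" using that by simp
    have "postcomp A A (Idn T A) = Idn M (rep A)"
      unfolding postcomp_def mod_cat_simps Ab_simps
      by (intro restrict_ext) (use Cmp_Idn_left[OF X_Obj A] in \<open>auto intro!: restrict_ext\<close>)
    then show ?thesis using H_cls[OF A A Idn_in_Hom[OF A]] by (simp add: Q_Idn)
  qed
  show "Fm H A E (Cmp Q A B E G F) = Cmp M (Fo H A) (Fo H B) (Fo H E) (Fm H B E G) (Fm H A B F)"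
    if "A \<in> Obj Q" "B \<in> Obj Q" "E \<in> Obj Q" "F \<in> Hom Q A B" "G \<in> Hom Q B E" for A B E F G
  proof -
    have O: "A \<in> Obj T" "B \<in> Obj T" "E \<in> Obj T" using that by simp_all
    obtain f g where f: "f \<in> Hom T A B" "F = cls A B f" and g: "g \<in> Hom T B E" "G = cls B E g"
      using \<open>F \<in> Hom Q A B\<close> \<open>G \<in> Hom Q B E\<close> unfolding Q_Hom by blast
    note gf = Cmp_in_Hom[OF O f(1) g(1)]
    have "postcomp A E (Cmp T A B E g f) Y =
        compose (carrier (hom_group T Y A)) (postcomp B E g Y) (postcomp A B f Y)" if Y: "Y \<in> X" for Y
    proof (rule extensionalityI[of _ "Hom T Y A"])
      show "postcomp A E (Cmp T A B E g f) Y \<in> extensional (Hom T Y A)" using Y by (simp add: postcomp_def)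
      show "compose (carrier (hom_group T Y A)) (postcomp B E g Y) (postcomp A B f Y) \<in> extensional (Hom T Y A)"
        by (simp add: compose_def)
      fix x assume x: "x \<in> Hom T Y A"
      show "postcomp A E (Cmp T A B E g f) Y x =
          compose (carrier (hom_group T Y A)) (postcomp B E g Y) (postcomp A B f Y) x"
        using x Y Cmp_in_Hom[OF X_Obj[OF Y] O(1,2) x f(1)] Cmp_assoc[OF X_Obj[OF Y] O x f(1) g(1)]
        by (simp add: postcomp_apply compose_def)
    qed
    then have "postcomp A E (Cmp T A B E g f) = Cmp M (rep A) (rep B) (rep E) (postcomp B E g) (postcomp A B f)"
      by (intro extensionalityI[of _ X]) (simp_all add: mod_cat_simps Ab_simps postcomp_def[of A E])
    then show ?thesis
      using H_cls[OF O(1,2) f(1)] H_cls[OF O(2,3) g(1)] H_cls[OF O(1,3) gf] Q_Cmp[OF O f(1) g(1)] f(2) g(2)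
      by simp
  qed
qed

text \<open>Regular maps act bijectively by \<open>R_iff\<close>, and pointwise bijective
  transformations are invertible.\<close>

lemma H_inverts: "inverts Q R M H"
  unfolding inverts_def
proof (intro ballI)
  fix A B S assume "A \<in> Obj Q" "B \<in> Obj Q" and S: "S \<in> R A B"
  then have O: "A \<in> Obj T" "B \<in> Obj T" by simp_all
  obtain s where s: "s \<in> Hom T A B" "S = cls A B s" "X_bijective A B s" using S R_iff[OF O] by blast
  have "iso_mor M (rep A) (rep B) (postcomp A B s)"
  proof (rule mod_iso_if_bij[OF rep_coherent[OF O(1)] rep_coherent[OF O(2)] postcomp_in_M[OF O s(1)]])
    fix Y assume Y: "Y \<in> X"
    have "bij_betw (\<lambda>x. Cmp T Y A B s x) (Hom T Y A) (Hom T Y B)" using s(3) Y by blast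
    then show "bij_betw (postcomp A B s Y) (carrier (Fo (rep A) Y)) (carrier (Fo (rep B) Y))"
      using bij_betw_cong[of "Hom T Y A" "postcomp A B s Y" "\<lambda>x. Cmp T Y A B s x"] postcomp_apply[OF Y]
      by simp
  qed
  then show "iso_mor M (Fo H A) (Fo H B) (Fm H A B S)" using H_cls[OF O s(1)] s(2) by simp
qed

text \<open>Yoneda for a cokernel: every map from \<open>X\<close> to \<open>W\<close> factors
  through \<open>c\<close>, so \<open>\<phi>\<close> is determined by the value of
  \<open>\<phi> X0\<close> at \<open>c\<close>. By naturality this value kills \<open>m\<close>,
  hence it descends to a map \<open>b\<close> on \<open>W\<close>.\<close>

lemma H_bij_presented:
  assumes t: "Tri T X1 X0 W m c h" and X1: "X1 \<in> X" and X0: "X0 \<in> X" and B: "B \<in> Obj T"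
  shows "bij_betw (Fm H W B) (Hom Q W B) (Hom M (rep W) (rep B))"
proof (rule bij_betw_imageI)
  note d = TriD[OF t]
  show "inj_on (Fm H W B) (Hom Q W B)"
  proof (rule inj_onI)
    fix F G assume "F \<in> Hom Q W B" "G \<in> Hom Q W B" and eq: "Fm H W B F = Fm H W B G"
    then obtain f g where f: "f \<in> Hom T W B" "F = cls W B f" and g: "g \<in> Hom T W B" "G = cls W B g"
      unfolding Q_Hom by blast
    then show "F = G"
      using eq H_cls[OF d(3) B f(1)] H_cls[OF d(3) B g(1)] postcomp_eq_iff[of W B f g]
        cls_eq_iff[OF d(3) B f(1) g(1)] by simp
  qed
  show "Fm H W B ` Hom Q W B = Hom M (rep W) (rep B)"
  proof (intro equalityI subsetI)
    show "\<phi> \<in> Hom M (rep W) (rep B)" if "\<phi> \<in> Fm H W B ` Hom Q W B" for \<phi>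
      using that is_functorD(2)[OF H_functor, of W B] d(3) B by auto
    fix \<phi> assume \<phi>: "\<phi> \<in> Hom M (rep W) (rep B)"
    have hom: "\<phi> Y \<in> hom (hom_group T Y W) (hom_group T Y B)"
      and ext: "\<phi> Y \<in> extensional (Hom T Y W)" if "Y \<in> X" for Y
      using \<phi> that unfolding mod_cat_simps nat_trans_Ab_iff by simp_all
    have mem: "\<phi> Y y \<in> Hom T Y B" if "Y \<in> X" "y \<in> Hom T Y W" for Y y
      using hom_in_carrier[OF hom[OF that(1)]] that(2) by simp
    have nat: "\<phi> Z (Cmp T Z Y W y f) = Cmp T Z Y B (\<phi> Y y) f"
      if "Y \<in> X" "Z \<in> X" "f \<in> Hom T Z Y" "y \<in> Hom T Y W" for Y Z f y
    proof -
      have "Fm (rep B) Y Z f (\<phi> Y y) = \<phi> Z (Fm (rep W) Y Z f y)"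
        using \<phi> that unfolding mod_cat_simps nat_trans_Ab_iff by simp
      then show ?thesis using that mem[OF that(1,4)] by simp
    qed
    have "group_hom (hom_group T X1 W) (hom_group T X1 B) (\<phi> X1)"
      using hom_group_group[OF d(1,3)] hom_group_group[OF d(1) B] hom[OF X1]
      by (simp add: group_hom_def group_hom_axioms_def)
    then have zero: "\<phi> X1 (Zero T X1 W) = Zero T X1 B"
      using group_hom.hom_one by fastforce
    note b0 = mem[OF X0 d(5)]
    have "Cmp T X1 X0 B (\<phi> X0 c) m = Zero T X1 B"
      using nat[OF X0 X1 d(4,5)] Tri_Cmp_zero[OF t] zero by simp
    then obtain b where b: "b \<in> Hom T W B" "\<phi> X0 c = Cmp T X0 W B b c"
      using Tri_weak_cokernel[OF t B b0] by blast
    have val: "\<phi> Y y = Cmp T Y W B b y" if Y: "Y \<in> X" and y: "y \<in> Hom T Y W" for Y y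
    proof -
      obtain z where z: "z \<in> Hom T Y X0" "y = Cmp T Y X0 W c z" using cone_lift[OF t X1 Y y] by blast
      show ?thesis
        using nat[OF X0 Y z(1) d(5)] z(2) b(2) Cmp_assoc[OF X_Obj[OF Y] d(2,3) B z(1) d(5) b(1)] by simp
    qed
    have "\<phi> = postcomp W B b"
    proof (rule extensionalityI[of _ X])
      show "\<phi> \<in> extensional X" using \<phi> unfolding mod_cat_simps by blast
      show "postcomp W B b \<in> extensional X" by (simp add: postcomp_def)
      fix Y assume Y: "Y \<in> X"
      show "\<phi> Y = postcomp W B b Y"
        by (rule extensionalityI[OF ext[OF Y]]) (use Y val[OF Y] in \<open>simp_all add: postcomp_def\<close>)
    qed
    then show "\<phi> \<in> Fm H W B ` Hom Q W B"
      using H_cls[OF d(3) B b(1)] cls_in_Q[OF b(1)] by (auto intro!: image_eqI)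
  qed
qed

text \<open>By Yoneda the presenting transformation is composition with a map
  \<open>m : X1 \<rightarrow> X0\<close>. On \<open>X\<close>, both \<open>F\<close> and the functor
  represented by the cone \<open>A\<close> of \<open>m\<close> are cokernels of it.\<close>

lemma H_ess_surj:
  assumes F: "coherent T X F"
  shows "\<exists>A\<in>Obj T. \<exists>e. iso_mor M (rep A) F e"
proof -
  obtain X0 X1 \<alpha> \<beta> where X01: "X0 \<in> X" "X1 \<in> X"
    and \<alpha>: "nat_trans (presheaf_cat T X) Ab_cat (rep X1) (rep X0) \<alpha>"
    and \<beta>: "nat_trans (presheaf_cat T X) Ab_cat (rep X0) F \<beta>"
    and ex: "\<forall>Y\<in>X. \<alpha> Y ` carrier (hom_group T Y X1) = kernel (hom_group T Y X0) (Fo F Y) (\<beta> Y) \<and>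
      \<beta> Y ` carrier (hom_group T Y X0) = carrier (Fo F Y)"
    using F[unfolded coherent_def, THEN conjunct2] by (elim bexE exE conjE) (rule that)
  have exact: "\<alpha> Y ` carrier (hom_group T Y X1) = kernel (hom_group T Y X0) (Fo F Y) (\<beta> Y)"
    and surj: "\<beta> Y ` carrier (hom_group T Y X0) = carrier (Fo F Y)" if "Y \<in> X" for Y
    using ex that by blast+
  note X0 = X_Obj[OF X01(1)] and X1 = X_Obj[OF X01(2)]
  define m where "m = \<alpha> X1 (Idn T X1)"
  note i1 = Idn_in_Hom[OF X1]
  have \<alpha>_hom: "\<alpha> Y \<in> hom (hom_group T Y X1) (hom_group T Y X0)" if "Y \<in> X" for Y
    using \<alpha> that unfolding nat_trans_Ab_iff by simp
  have m: "m \<in> Hom T X1 X0" unfolding m_def using hom_in_carrier[OF \<alpha>_hom[OF X01(2)]] i1 by simp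
  have \<alpha>_eq: "\<alpha> Y w = Cmp T Y X1 X0 m w" if Y: "Y \<in> X" and w: "w \<in> Hom T Y X1" for Y w
  proof -
    have "Fm (rep X0) X1 Y w (\<alpha> X1 (Idn T X1)) = \<alpha> Y (Fm (rep X1) X1 Y w (Idn T X1))"
      using \<alpha> Y w X01 i1 unfolding nat_trans_Ab_iff by simp
    then show ?thesis using m i1 Cmp_Idn_left[OF X_Obj[OF Y] X1 w] by (simp add: m_def)
  qed
  have \<beta>_hom: "\<beta> Y \<in> hom (hom_group T Y X0) (Fo F Y)" if "Y \<in> X" for Y
    using \<beta> that unfolding nat_trans_Ab_iff by simp
  have \<beta>_nat: "Fm F Y Z f (\<beta> Y y) = \<beta> Z (Cmp T Z Y X0 y f)"
    if "Y \<in> X" "Z \<in> X" "f \<in> Hom T Z Y" "y \<in> Hom T Y X0" for Y Z f y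
    using \<beta> that unfolding nat_trans_Ab_iff by simp
  obtain A c h where t: "Tri T X1 X0 A m c h" using TR1_cone[OF X1 X0 m] by blast
  note d = TriD[OF t] and A = TriD(3)[OF t]
  have grp: "group (Fo F Y)" if "Y \<in> X" for Y
    using is_functorD(1)[OF coherent_functor[OF F]] that by (auto simp: Ab_simps comm_group_def)
  \<comment> \<open>\<open>\<beta>\<close> and composition with \<open>c\<close> have the same
    fibres, because both have the image of \<open>m\<close> as kernel.\<close>
  have key: "\<beta> Y z = \<beta> Y z' \<longleftrightarrow> Cmp T Y X0 A c z = Cmp T Y X0 A c z'"
    if Y: "Y \<in> X" and z: "z \<in> Hom T Y X0" and z': "z' \<in> Hom T Y X0" for Y z z'
  proof -
    note YO = X_Obj[OF Y]
    note n = Neg_Hom[OF YO X0 z']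
    let ?k = "Add T Y X0 z (Neg Y X0 z')"
    note k = Add_Hom[OF YO X0 z n]
    interpret K: group "hom_group T Y X0" by (rule hom_group_group[OF YO X0])
    interpret F: group "Fo F Y" by (rule grp[OF Y])
    interpret b: group_hom "hom_group T Y X0" "Fo F Y" "\<beta> Y"
      by standard (rule \<beta>_hom[OF Y])
    have bz: "\<beta> Y z \<in> carrier (Fo F Y)" "\<beta> Y z' \<in> carrier (Fo F Y)"
      using b.hom_closed z z' by simp_all
    have "\<beta> Y ?k = \<beta> Y z \<otimes>\<^bsub>Fo F Y\<^esub> inv\<^bsub>Fo F Y\<^esub> \<beta> Y z'"
      using b.hom_mult[of z "Neg Y X0 z'"] b.hom_inv[of z'] z z' n by simp
    then have "\<beta> Y z = \<beta> Y z' \<longleftrightarrow> \<beta> Y ?k = \<one>\<^bsub>Fo F Y\<^esub>"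
      using F.mult_inv_eq_one_iff[OF bz] by simp
    also have "\<dots> \<longleftrightarrow> ?k \<in> \<alpha> Y ` Hom T Y X1"
      using exact[OF Y] k by (simp add: kernel_def)
    also have "\<dots> \<longleftrightarrow> (\<exists>w\<in>Hom T Y X1. ?k = Cmp T Y X1 X0 m w)"
      using \<alpha>_eq[OF Y] by auto
    also have "\<dots> \<longleftrightarrow> Cmp T Y X0 A c ?k = Zero T Y A"
    proof
      assume "\<exists>w\<in>Hom T Y X1. ?k = Cmp T Y X1 X0 m w"
      then obtain w where w: "w \<in> Hom T Y X1" "?k = Cmp T Y X1 X0 m w" by blast
      show "Cmp T Y X0 A c ?k = Zero T Y A"
        using w(2) Cmp_assoc[OF YO X1 X0 A w(1) m d(5)] Tri_Cmp_zero[OF t] Cmp_Zero_left[OF YO X1 A w(1)]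
        by simp
    next
      assume "Cmp T Y X0 A c ?k = Zero T Y A"
      then show "\<exists>w\<in>Hom T Y X1. ?k = Cmp T Y X1 X0 m w"
        using Tri_weak_kernel[OF t YO k] by blast
    qed
    also have "\<dots> \<longleftrightarrow> Cmp T Y X0 A c z = Cmp T Y X0 A c z'"
      using Cmp_Add_right[OF YO X0 A z n d(5)] Cmp_Neg_right[OF YO X0 A z' d(5)]
        Add_Neg_eq_Zero[OF YO A Cmp_in_Hom[OF YO X0 A z d(5)] Cmp_in_Hom[OF YO X0 A z' d(5)]] by simp
    finally show ?thesis .
  qed
  define l where "l Y y = (SOME z. z \<in> Hom T Y X0 \<and> y = Cmp T Y X0 A c z)" for Y y
  have l: "l Y y \<in> Hom T Y X0" "y = Cmp T Y X0 A c (l Y y)" if "Y \<in> X" "y \<in> Hom T Y A" for Y y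
  proof -
    have "\<exists>z. z \<in> Hom T Y X0 \<and> y = Cmp T Y X0 A c z" using cone_lift[OF t X01(2) that] by blast
    from someI_ex[OF this] show "l Y y \<in> Hom T Y X0" "y = Cmp T Y X0 A c (l Y y)"
      unfolding l_def by blast+
  qed
  \<comment> \<open>Lift along \<open>c\<close>, then apply \<open>\<beta>\<close>; by
    \<open>key\<close> the choice of the lift is immaterial.\<close>
  define e where "e = (\<lambda>Y\<in>X. \<lambda>y\<in>Hom T Y A. \<beta> Y (l Y y))"
  have e: "e Y (Cmp T Y X0 A c z) = \<beta> Y z" if Y: "Y \<in> X" and z: "z \<in> Hom T Y X0" for Y z
  proof -
    note cz = Cmp_in_Hom[OF X_Obj[OF Y] X0 A z d(5)]
    show ?thesis using key[OF Y l(1)[OF Y cz] z] l(2)[OF Y cz] Y cz by (simp add: e_def)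
  qed
  have lift: "\<exists>z\<in>Hom T Y X0. y = Cmp T Y X0 A c z" if "Y \<in> X" "y \<in> Hom T Y A" for Y y
    using l[OF that] by blast
  have \<beta>_mem: "\<beta> Y z \<in> carrier (Fo F Y)" if "Y \<in> X" "z \<in> Hom T Y X0" for Y z
    using hom_in_carrier[OF \<beta>_hom[OF that(1)]] that(2) by simp
  have "e \<in> Hom M (rep A) F"
    unfolding mod_cat_simps mem_Collect_eq nat_trans_Ab_iff
  proof (intro conjI ballI)
    show "e \<in> extensional X" by (simp add: e_def)
    fix Y assume Y: "Y \<in> X"
    note YO = X_Obj[OF Y]
    show "e Y \<in> extensional (carrier (Fo (rep A) Y))" using Y by (simp add: e_def)
    show "e Y \<in> hom (Fo (rep A) Y) (Fo F Y)"
    proof (rule homI)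
      fix y assume "y \<in> carrier (Fo (rep A) Y)"
      then obtain z where z: "z \<in> Hom T Y X0" "y = Cmp T Y X0 A c z" using lift[OF Y] by auto
      show "e Y y \<in> carrier (Fo F Y)" using e[OF Y z(1)] z(2) \<beta>_mem[OF Y z(1)] by simp
      fix y' assume "y' \<in> carrier (Fo (rep A) Y)"
      then obtain z' where z': "z' \<in> Hom T Y X0" "y' = Cmp T Y X0 A c z'" using lift[OF Y] by auto
      have "e Y (Add T Y A y y') = \<beta> Y (Add T Y X0 z z')"
        using e[OF Y Add_Hom[OF YO X0 z(1) z'(1)]] Cmp_Add_right[OF YO X0 A z(1) z'(1) d(5)] z(2) z'(2)
        by simp
      then show "e Y (y \<otimes>\<^bsub>Fo (rep A) Y\<^esub> y') = e Y y \<otimes>\<^bsub>Fo F Y\<^esub> e Y y'"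
        using hom_mult[OF \<beta>_hom[OF Y], of z z'] e[OF Y z(1)] e[OF Y z'(1)] z z' by simp
    qed
    fix Z f y assume Z: "Z \<in> X" and f: "f \<in> Hom T Z Y" and y: "y \<in> carrier (Fo (rep A) Y)"
    then obtain z where z: "z \<in> Hom T Y X0" "y = Cmp T Y X0 A c z" using lift[OF Y] by auto
    show "Fm F Y Z f (e Y y) = e Z (Fm (rep A) Y Z f y)"
      using y z e[OF Y z(1)] \<beta>_nat[OF Y Z f z(1)] Cmp_assoc[OF X_Obj[OF Z] YO X0 A f z(1) d(5)]
        e[OF Z Cmp_in_Hom[OF X_Obj[OF Z] YO X0 f z(1)]] by simp
  qed
  moreover have "bij_betw (e Y) (carrier (Fo (rep A) Y)) (carrier (Fo F Y))" if Y: "Y \<in> X" for Y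
  proof (intro bij_betw_imageI inj_onI)
    fix y y' assume "y \<in> carrier (Fo (rep A) Y)" "y' \<in> carrier (Fo (rep A) Y)" and eq: "e Y y = e Y y'"
    then obtain z z' where z: "z \<in> Hom T Y X0" "y = Cmp T Y X0 A c z"
      and z': "z' \<in> Hom T Y X0" "y' = Cmp T Y X0 A c z'"
      using lift[OF Y, of y] lift[OF Y, of y'] by auto
    show "y = y'" using key[OF Y z(1) z'(1)] e[OF Y z(1)] e[OF Y z'(1)] eq z(2) z'(2) by simp
  next
    have "e Y ` Hom T Y A = \<beta> Y ` Hom T Y X0"
    proof (intro equalityI subsetI)
      fix v assume "v \<in> e Y ` Hom T Y A"
      then obtain y where y: "y \<in> Hom T Y A" "v = e Y y" by blast
      obtain z where z: "z \<in> Hom T Y X0" "y = Cmp T Y X0 A c z" using lift[OF Y y(1)] by blast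
      show "v \<in> \<beta> Y ` Hom T Y X0" using e[OF Y z(1)] y(2) z by simp
    next
      fix v assume "v \<in> \<beta> Y ` Hom T Y X0"
      then obtain z where z: "z \<in> Hom T Y X0" "v = \<beta> Y z" by blast
      show "v \<in> e Y ` Hom T Y A"
        using e[OF Y z(1)] z(2) Cmp_in_Hom[OF X_Obj[OF Y] X0 A z(1) d(5)] by (metis imageI)
    qed
    then show "e Y ` carrier (Fo (rep A) Y) = carrier (Fo F Y)" using surj[OF Y] by simp
  qed
  ultimately show ?thesis using A mod_iso_if_bij[OF rep_coherent[OF A] F] by blast
qed

end

theorem theorem4p6:
  fixes T :: "('o, 'h) tricat" and X :: "'o set"
  assumes "triangulated_category T"
    and "split_idempotents T"
    and "subcategory T X"
    and "contravariantly_finite T X"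
    and "rigid T X"
  shows "let Q = factor_category T (perp T X);
             R = regular_maps Q;
             L = localization Q R;
             P = localization_functor Q R
         in left_fractions Q R \<and> right_fractions Q R \<and>
            category L \<and> has_small_homs TYPE('h) L \<and>
            is_functor Q L P \<and> inverts Q R L P \<and>
            (\<forall>D :: ('d, 'e) cat. category D \<longrightarrow> universally_inverts Q R L P D) \<and>
            faithful Q L P \<and> preserves_kernels Q L P \<and> preserves_cokernels Q L P \<and>
            (\<exists>G. left_adjoint L Q G P \<and> fully_faithful L Q G) \<and>
            equivalent_cats L (mod_cat T X)"
proof -
  interpret rigid_subcategory T X
    using assms by (simp add: rigid_subcategory_def rigid_subcategory_axioms_def subcategory_def)
  \<comment> \<open>Besides the regular map, only the presenting triangle of \<open>W\<close> is
    recorded: it yields both colocality of \<open>W\<close> and bijectivity of \<open>H\<close> on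
    maps out of \<open>W\<close>.\<close>
  have "\<exists>W g. (\<exists>X1\<in>X. \<exists>X0\<in>X. \<exists>m c h. Tri T X1 X0 W m c h) \<and> g \<in> R W A" if A: "A \<in> Obj T" for A
  proof -
    obtain X1 X0 W m c h g where w: "X1 \<in> X" "X0 \<in> X" "Tri T X1 X0 W m c h" "g \<in> Hom T W A"
      "X_bijective W A g"
      using coreflection[OF A] by metis
    then show ?thesis using X_bijective_regular[OF TriD(3)[OF w(3)] A w(4,5)] by blast
  qed
  then obtain r \<gamma> where r: "\<And>A. A \<in> Obj T \<Longrightarrow> \<exists>X1\<in>X. \<exists>X0\<in>X. \<exists>m c h. Tri T X1 X0 (r A) m c h"
    and \<gamma>: "\<And>A. A \<in> Obj T \<Longrightarrow> \<gamma> A \<in> R (r A) A"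
    by metis
  interpret L: enough_colocals Q R r \<gamma>
  proof
    show "Q.colocal (r A)" if "A \<in> Obj Q" for A
      using r[of A] that presented_colocal[of _ _ "r A"] by (metis Q_Obj)
    show "\<gamma> A \<in> R (r A) A" if "A \<in> Obj Q" for A
      using \<gamma> that by simp
  qed
  have epi: "epi_mor Q A B s" if "s \<in> R A B" for A B s
    using that unfolding regular_maps_def by blast
  have faith: "faithful Q Q.L Q.P" by (rule L.faithful_P) (rule epi)
  have "equivalent_cats Q.L (mod_cat T X)"
  proof (rule L.induced_equivalence[OF category_mod_cat H_functor H_inverts])
    show "bij_betw (Fm H (r A) B) (Hom Q (r A) B) (Hom M (Fo H (r A)) (Fo H B))"
      if "A \<in> Obj Q" "B \<in> Obj Q" for A B
      using r[of A] H_bij_presented[of _ _ "r A" _ _ _ B] that by auto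
    show "\<exists>A\<in>Obj Q. \<exists>e. iso_mor M (Fo H A) F e" if "F \<in> Obj M" for F
      using H_ess_surj that by (simp add: mod_cat_simps)
  qed
  then show ?thesis
    unfolding Let_def
    using left_fractions_R right_fractions_R Q.category_L L.has_small_homs_L[OF has_small_homs_Q]
      Q.P_functor Q.P_inverts Q.universal_property faith L.preserves_kernels_P[OF zero_object_Q]
      L.preserves_cokernels_P[OF zero_object_Q left_fractions_R faith] L.left_adjoint_P
    by blast
qed

end
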